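(* Let $\mathcal{M},S,c$ be as in the context and belong to the following geometric setting: there exist sequences $(\lambda_n)_{n\in\mathbb{N}}\subset\mathbb{R}$ with $\lambda_n\to+\infty$ and $(u_n)_{n\in\mathbb{N}}\subset\mathcal{A}$ with $-\Delta_c u_n=\lambda_n u_n$, $\|u_n\|_{L^2(\mathcal{M})}=1$, such that for every measurable $\omega\subset\mathcal{M}$ with $\mathrm{dist}(\overline{\omega},S)>0$ there exist $C,d>0$ with $\|u_n\|_{L^2(\omega)}\le Ce^{-d\sqrt{\lambda_n}}$ for all $n$. Let $T>0$. Then there exist solutions $(w_n)_{n\in\mathbb{N}}$ of the wave system $$\begin{cases}(\partial_t^2-\Delta_c)w=0 & \text{in }(0,T)\times(\Omega_-\cup\Omega_+)\\ w|_{S_-}=w|_{S_+} & \text{in }(0,T)\times S\\ (c\,\partial_\nu w)|_{S_-}=(c\,\partial_\nu w)|_{S_+} & \text{in }(0,T)\times S\\ w=0 & \text{in }(0,T)\times\partial\mathcal{M}\\ (w,\partial_t w)|_{t=0}=(w_0,w_1) & \text{in }\mathcal{M}\end{cases}$$ (with initial data $(w_0,w_1)\in H^1_0(\mathcal{M})\times L^2(\mathcal{M})$ depending on $n$) with $\|w_n(0)\|_{L^2(\mathcal{M})}=1$ and such that for every measurable $\omega\subset\mathcal{M}$ with $\mathrm{dist}(\overline{\omega},S)>0$ there exist $C,d>0$ with, for all $n\in\mathbb{N}$, $$\|w_n\|_{L^2((0,T)\times\omega)}\le Ce^{-d\Lambda(w_n)}.$$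
   Context: $\mathcal{M}$ is a compact, connected subset of a Euclidean space with smooth boundary $\partial\mathcal{M}$, and $S\subset\mathrm{Int}(\mathcal{M})$ is a smooth hypersurface such that $\mathrm{Int}(\mathcal{M})\setminus S=\Omega_-\cup\Omega_+$ with $\Omega_-\cap\Omega_+=\emptyset$, $\Omega_\pm$ open. The coefficient $c=\mathbf{1}_{\Omega_-}c_-+\mathbf{1}_{\Omega_+}c_+$ is strictly positive, piecewise smooth, with a jump across $S$. $\nu$ is the unit normal to $S$ pointing into $\Omega_+$, and $w|_{S_\pm}$ denotes the trace on $S$ of $w|_{\Omega_\pm}$ (similarly $(c\,\partial_\nu w)|_{S_\pm}$ is the trace on $S$ of $c_\pm\partial_\nu(w|_{\Omega_\pm})$). The operator is $-\Delta_c:=-\mathrm{div}(c\nabla\,\cdot)$, with self-adjoint domain $$\mathcal{A}=\{u\in H^1_0(\mathcal{M}) : u|_{\Omega_-}\in H^2(\Omega_-),\ u|_{\Omega_+}\in H^2(\Omega_+),\ c_-\partial_\nu(u|_{\Omega_-})|_S=c_+\partial_\nu(u|_{\Omega_+})|_S\}.$$ For a solution $w$ of the wave system with nonzero initial data, its typical frequency is $$\Lambda(w):=\frac{\|(w(0),\partial_t w(0))\|_{H^1\times L^2}}{\|(w(0),\partial_t w(0))\|_{L^2\times H^{-1}}}.$$ *)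

theory Defs
  imports "HOL-Analysis.Analysis"
begin

section \<open>Smooth functions and test functions\<close>

definition pd :: "'a::euclidean_space \<Rightarrow> ('a \<Rightarrow> real) \<Rightarrow> 'a \<Rightarrow> real" where
  "pd b f x = frechet_derivative f (at x) b"

definition grad :: "('a::euclidean_space \<Rightarrow> real) \<Rightarrow> 'a \<Rightarrow> 'a" where
  "grad f x = (\<Sum>b\<in>Basis. pd b f x *\<^sub>R b)"

(* Meant for open U: f is of class C^k on U. *)
fun Ck_on :: "nat \<Rightarrow> 'a::euclidean_space set \<Rightarrow> ('a \<Rightarrow> real) \<Rightarrow> bool" where
  "Ck_on 0 U f \<longleftrightarrow> continuous_on U f"
| "Ck_on (Suc k) U f \<longleftrightarrow>
     (\<forall>x\<in>U. f differentiable (at x)) \<and> (\<forall>b\<in>Basis. Ck_on k U (pd b f))"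

definition smooth_on :: "'a::euclidean_space set \<Rightarrow> ('a \<Rightarrow> real) \<Rightarrow> bool" where
  "smooth_on U f \<longleftrightarrow> (\<forall>k. Ck_on k U f)"

definition smooth_up_to_closure :: "'a::euclidean_space set \<Rightarrow> ('a \<Rightarrow> real) \<Rightarrow> bool" where
  "smooth_up_to_closure \<Omega> f \<longleftrightarrow> (\<exists>V. open V \<and> closure \<Omega> \<subseteq> V \<and> smooth_on V f)"

(* The space of smooth functions with compact support in \<Omega>, extended by 0. *)
definition test_fun :: "'a::euclidean_space set \<Rightarrow> ('a \<Rightarrow> real) \<Rightarrow> bool" where
  "test_fun \<Omega> \<phi> \<longleftrightarrow>
     smooth_on UNIV \<phi> \<and> compact (closure {x. \<phi> x \<noteq> 0}) \<and> closure {x. \<phi> x \<noteq> 0} \<subseteq> \<Omega>"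


section \<open>Lebesgue and Sobolev spaces\<close>

definition L2 :: "'a::euclidean_space set \<Rightarrow> ('a \<Rightarrow> real) \<Rightarrow> bool" where
  "L2 \<Omega> f \<longleftrightarrow>
     f \<in> borel_measurable (lebesgue_on \<Omega>) \<and> integrable (lebesgue_on \<Omega>) (\<lambda>x. (f x)\<^sup>2)"

definition L2_norm :: "'a::euclidean_space set \<Rightarrow> ('a \<Rightarrow> real) \<Rightarrow> real" where
  "L2_norm \<Omega> f = sqrt (LINT x|lebesgue_on \<Omega>. (f x)\<^sup>2)"

definition has_weak_deriv ::
  "'a::euclidean_space set \<Rightarrow> 'a \<Rightarrow> ('a \<Rightarrow> real) \<Rightarrow> ('a \<Rightarrow> real) \<Rightarrow> bool" where
  "has_weak_deriv \<Omega> b f g \<longleftrightarrow>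
     (\<forall>\<phi>. test_fun \<Omega> \<phi> \<longrightarrow>
        (LINT x|lebesgue_on \<Omega>. f x * pd b \<phi> x) = - (LINT x|lebesgue_on \<Omega>. g x * \<phi> x))"

definition H1 :: "'a::euclidean_space set \<Rightarrow> ('a \<Rightarrow> real) \<Rightarrow> bool" where
  "H1 \<Omega> f \<longleftrightarrow> L2 \<Omega> f \<and> (\<forall>b\<in>Basis. \<exists>g. L2 \<Omega> g \<and> has_weak_deriv \<Omega> b f g)"

(* A representative of the weak derivative; unique almost everywhere on open \<Omega>, if f is in H1. *)
definition wderiv :: "'a::euclidean_space set \<Rightarrow> 'a \<Rightarrow> ('a \<Rightarrow> real) \<Rightarrow> 'a \<Rightarrow> real" where
  "wderiv \<Omega> b f = (SOME g. L2 \<Omega> g \<and> has_weak_deriv \<Omega> b f g)"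

definition H1_norm :: "'a::euclidean_space set \<Rightarrow> ('a \<Rightarrow> real) \<Rightarrow> real" where
  "H1_norm \<Omega> f = sqrt ((L2_norm \<Omega> f)\<^sup>2 + (\<Sum>b\<in>Basis. (L2_norm \<Omega> (wderiv \<Omega> b f))\<^sup>2))"

definition H2 :: "'a::euclidean_space set \<Rightarrow> ('a \<Rightarrow> real) \<Rightarrow> bool" where
  "H2 \<Omega> f \<longleftrightarrow> H1 \<Omega> f \<and> (\<forall>b\<in>Basis. H1 \<Omega> (wderiv \<Omega> b f))"

definition H10 :: "'a::euclidean_space set \<Rightarrow> ('a \<Rightarrow> real) \<Rightarrow> bool" where
  "H10 \<Omega> f \<longleftrightarrow> H1 \<Omega> f \<and>
     (\<exists>\<phi>::nat \<Rightarrow> 'a \<Rightarrow> real. (\<forall>k. test_fun \<Omega> (\<phi> k)) \<and>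
        (\<lambda>k. H1_norm \<Omega> (\<lambda>x. f x - \<phi> k x)) \<longlonglongrightarrow> 0)"

(* Norm of f, an element of L2, in the dual of H10 (pivot space L2). *)
definition Hm1_norm :: "'a::euclidean_space set \<Rightarrow> ('a \<Rightarrow> real) \<Rightarrow> real" where
  "Hm1_norm \<Omega> f =
     (SUP \<phi>\<in>{\<phi>. H10 \<Omega> \<phi> \<and> H1_norm \<Omega> \<phi> \<le> 1}. \<bar>LINT x|lebesgue_on \<Omega>. f x * \<phi> x\<bar>)"


section \<open>Smooth boundaries, hypersurfaces and traces\<close>

definition drop_coord :: "'a::euclidean_space \<Rightarrow> 'a \<Rightarrow> 'a" where
  "drop_coord e x = x - (x \<bullet> e) *\<^sub>R e"

(* Signed distance, in the coordinate direction e, to the graph of \<gamma> over the hyperplane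
   orthogonal to e.  Since \<gamma> enters through drop_coord only, the gradient of height e \<gamma> is
   e minus the tangential gradient of \<gamma>, and it never vanishes. *)
definition height :: "'a::euclidean_space \<Rightarrow> ('a \<Rightarrow> real) \<Rightarrow> 'a \<Rightarrow> real" where
  "height e \<gamma> x = x \<bullet> e - \<gamma> (drop_coord e x)"

definition smooth_boundary :: "'a::euclidean_space set \<Rightarrow> bool" where
  "smooth_boundary M \<longleftrightarrow>
     (\<forall>x\<in>frontier M. \<exists>U e s \<gamma>. open U \<and> x \<in> U \<and> e \<in> Basis \<and> s \<in> {-1, 1::real} \<and>
        smooth_on UNIV \<gamma> \<and> M \<inter> U = {y\<in>U. s * height e \<gamma> y \<ge> 0})"

(* S is locally a smooth graph with \<Omega>m on one side and \<Omega>p on the other, and \<nu> is the unit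
   normal of S pointing into \<Omega>p. *)
definition smooth_interface ::
  "'a::euclidean_space set \<Rightarrow> 'a set \<Rightarrow> 'a set \<Rightarrow> ('a \<Rightarrow> 'a) \<Rightarrow> bool" where
  "smooth_interface S \<Omega>m \<Omega>p \<nu> \<longleftrightarrow>
     (\<forall>x\<in>S. \<exists>U e s \<gamma>. open U \<and> x \<in> U \<and> e \<in> Basis \<and> s \<in> {-1, 1::real} \<and>
        smooth_on UNIV \<gamma> \<and>
        S \<inter> U = {y\<in>U. height e \<gamma> y = 0} \<and>
        \<Omega>p \<inter> U = {y\<in>U. s * height e \<gamma> y > 0} \<and>
        \<Omega>m \<inter> U = {y\<in>U. s * height e \<gamma> y < 0} \<and>
        (\<forall>y\<in>S \<inter> U. \<nu> y = (s / norm (grad (height e \<gamma>) y)) *\<^sub>R grad (height e \<gamma>) y))"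

(* Surface measure of the graph of \<gamma>: the image, under the graph map, of (n-1)-dimensional
   Lebesgue measure with the area density sqrt (1 + |tangential gradient of \<gamma>|^2). *)
definition graph_measure :: "'a::euclidean_space \<Rightarrow> ('a \<Rightarrow> real) \<Rightarrow> 'a measure" where
  "graph_measure e \<gamma> =
     (let emb = (\<lambda>y::'a \<Rightarrow> real. \<Sum>b\<in>Basis - {e}. y b *\<^sub>R b);
          lift = (\<lambda>y. emb y + \<gamma> (emb y) *\<^sub>R e)
      in distr (density (Pi\<^sub>M (Basis - {e}) (\<lambda>_. lborel))
                  (\<lambda>y. ennreal (norm (grad (height e \<gamma>) (lift y)))))
           borel lift)"

(* g is (a representative of) the trace on S, a part of the boundary of \<Omega>, of f in H1(\<Omega>):
   the local L2(S)-limit of the restrictions to S of smooth functions approximating f in H1.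
   The formulation is local on S, so that nothing is required of S near its own end. *)
definition has_trace ::
  "'a::euclidean_space set \<Rightarrow> 'a set \<Rightarrow> ('a \<Rightarrow> real) \<Rightarrow> ('a \<Rightarrow> real) \<Rightarrow> bool" where
  "has_trace \<Omega> S f g \<longleftrightarrow> H1 \<Omega> f \<and> g \<in> borel_measurable borel \<and>
     (\<forall>x\<in>S. \<exists>U e \<gamma>. open U \<and> x \<in> U \<and> e \<in> Basis \<and> smooth_on UNIV \<gamma> \<and>
        S \<inter> U = {y\<in>U. height e \<gamma> y = 0} \<and>
        (\<exists>\<phi>::nat \<Rightarrow> 'a \<Rightarrow> real. (\<forall>k. test_fun UNIV (\<phi> k)) \<and>
           (\<lambda>k. H1_norm (\<Omega> \<inter> U) (\<lambda>y. f y - \<phi> k y)) \<longlonglongrightarrow> 0 \<and>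
           (\<lambda>k. \<integral>\<^sup>+y. ennreal ((g y - \<phi> k y)\<^sup>2) * indicator (S \<inter> U) y \<partial>graph_measure e \<gamma>)
              \<longlonglongrightarrow> 0))"

(* h is (a representative of) the trace on S of the derivative of f in the direction \<nu>,
   for f in H2(\<Omega>). *)
definition has_normal_trace ::
  "'a::euclidean_space set \<Rightarrow> 'a set \<Rightarrow> ('a \<Rightarrow> 'a) \<Rightarrow> ('a \<Rightarrow> real) \<Rightarrow> ('a \<Rightarrow> real) \<Rightarrow> bool" where
  "has_normal_trace \<Omega> S \<nu> f h \<longleftrightarrow>
     (\<exists>G::'a \<Rightarrow> 'a. (\<forall>b\<in>Basis. has_trace \<Omega> S (wderiv \<Omega> b f) (\<lambda>x. G x \<bullet> b)) \<and>
        (\<forall>x\<in>S. h x = \<nu> x \<bullet> G x))"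


section \<open>The geometric setting and the operator\<close>

definition interface_setting ::
  "'a::euclidean_space set \<Rightarrow> 'a set \<Rightarrow> 'a set \<Rightarrow> 'a set \<Rightarrow> ('a \<Rightarrow> 'a)
     \<Rightarrow> ('a \<Rightarrow> real) \<Rightarrow> ('a \<Rightarrow> real) \<Rightarrow> bool" where
  "interface_setting M S \<Omega>m \<Omega>p \<nu> cm cp \<longleftrightarrow>
     compact M \<and> connected M \<and> smooth_boundary M \<and>
     S \<noteq> {} \<and> S \<subseteq> interior M \<and> interior M - S = \<Omega>m \<union> \<Omega>p \<and> \<Omega>m \<inter> \<Omega>p = {} \<and>
     open \<Omega>m \<and> open \<Omega>p \<and> smooth_interface S \<Omega>m \<Omega>p \<nu> \<and>
     smooth_up_to_closure \<Omega>m cm \<and> smooth_up_to_closure \<Omega>p cp \<and>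
     (\<forall>x\<in>closure \<Omega>m. cm x > 0) \<and> (\<forall>x\<in>closure \<Omega>p. cp x > 0) \<and>
     (\<forall>x\<in>S. cm x \<noteq> cp x)"

definition glue_coeff ::
  "'a set \<Rightarrow> 'a set \<Rightarrow> ('a \<Rightarrow> real) \<Rightarrow> ('a \<Rightarrow> real) \<Rightarrow> 'a \<Rightarrow> real" where
  "glue_coeff \<Omega>m \<Omega>p cm cp x = indicator \<Omega>m x * cm x + indicator \<Omega>p x * cp x"

(* The domain of the operator.  Traces are determined up to null sets of S, and has_trace accepts
   every Borel representative, so equality everywhere on S for some choice of representatives is
   equality almost everywhere. *)
definition dom_A ::
  "'a::euclidean_space set \<Rightarrow> 'a set \<Rightarrow> 'a set \<Rightarrow> 'a set \<Rightarrow> ('a \<Rightarrow> 'a)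
     \<Rightarrow> ('a \<Rightarrow> real) \<Rightarrow> ('a \<Rightarrow> real) \<Rightarrow> ('a \<Rightarrow> real) \<Rightarrow> bool" where
  "dom_A M S \<Omega>m \<Omega>p \<nu> cm cp u \<longleftrightarrow>
     H10 (interior M) u \<and> H2 \<Omega>m u \<and> H2 \<Omega>p u \<and>
     (\<exists>hm hp. has_normal_trace \<Omega>m S \<nu> u hm \<and> has_normal_trace \<Omega>p S \<nu> u hp \<and>
        (\<forall>x\<in>S. cm x * hm x = cp x * hp x))"

(* - div (c grad u) = f in the sense of distributions on D *)
definition minus_Delta_eq ::
  "'a::euclidean_space set \<Rightarrow> ('a \<Rightarrow> real) \<Rightarrow> ('a \<Rightarrow> real) \<Rightarrow> ('a \<Rightarrow> real) \<Rightarrow> bool" where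
  "minus_Delta_eq D c u f \<longleftrightarrow>
     (\<forall>\<phi>. test_fun D \<phi> \<longrightarrow>
        (LINT x|lebesgue_on D. c x * (\<Sum>b\<in>Basis. wderiv D b u x * pd b \<phi> x))
          = (LINT x|lebesgue_on D. f x * \<phi> x))"


section \<open>The wave system\<close>

(* v is the time derivative at time t of w, as a curve on [0,T] with values in L2(D);
   one-sided at the end points. *)
definition has_time_deriv ::
  "'a::euclidean_space set \<Rightarrow> real \<Rightarrow> (real \<Rightarrow> 'a \<Rightarrow> real) \<Rightarrow> real \<Rightarrow> ('a \<Rightarrow> real) \<Rightarrow> bool" where
  "has_time_deriv D T w t v \<longleftrightarrow> L2 D v \<and>
     ((\<lambda>s. L2_norm D (\<lambda>x. (w s x - w t x) / (s - t) - v x)) \<longlongrightarrow> 0) (at t within {0..T})"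

definition time_deriv ::
  "'a::euclidean_space set \<Rightarrow> real \<Rightarrow> (real \<Rightarrow> 'a \<Rightarrow> real) \<Rightarrow> real \<Rightarrow> 'a \<Rightarrow> real" where
  "time_deriv D T w t = (SOME v. has_time_deriv D T w t v)"

(* w in C([0,T]; H10(D)) with continuous derivative from [0,T] to L2(D) *)
definition finite_energy ::
  "'a::euclidean_space set \<Rightarrow> real \<Rightarrow> (real \<Rightarrow> 'a \<Rightarrow> real) \<Rightarrow> bool" where
  "finite_energy D T w \<longleftrightarrow>
     L2 ({0<..<T} \<times> D) (\<lambda>(t, x). w t x) \<and>
     (\<forall>t\<in>{0..T}. H10 D (w t) \<and>
        ((\<lambda>s. H1_norm D (\<lambda>x. w s x - w t x)) \<longlongrightarrow> 0) (at t within {0..T}) \<and>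
        (\<exists>v. has_time_deriv D T w t v) \<and>
        ((\<lambda>s. L2_norm D (\<lambda>x. time_deriv D T w s x - time_deriv D T w t x)) \<longlongrightarrow> 0)
          (at t within {0..T}))"

(* (d_t^2 - div (c grad)) w = 0 in the sense of distributions on (0,T) x \<Omega>,
   for c smooth on the open set \<Omega>.  Directions of space-time are (1, 0) and (0, b). *)
definition wave_eq ::
  "'a::euclidean_space set \<Rightarrow> ('a \<Rightarrow> real) \<Rightarrow> real \<Rightarrow> (real \<Rightarrow> 'a \<Rightarrow> real) \<Rightarrow> bool" where
  "wave_eq \<Omega> c T w \<longleftrightarrow>
     (\<forall>\<phi>::real \<times> 'a \<Rightarrow> real. test_fun ({0<..<T} \<times> \<Omega>) \<phi> \<longrightarrow>
        (LINT t|lebesgue_on {0<..<T}. LINT x|lebesgue_on \<Omega>.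
           w t x * (pd (1, 0) (pd (1, 0) \<phi>) (t, x)
             - (\<Sum>b\<in>Basis. pd (0, b) (\<lambda>z. c (snd z) * pd (0, b) \<phi> z) (t, x)))) = 0)"

(* For a finite energy solution w of the wave equation on \<Omega>, the conormal derivative
   c d_n w, n the outer normal of \<Omega>, is not a function on the boundary in general: it is the
   normal trace of the square integrable, divergence free space-time field
   (- d_t w, c grad w), that is, the distribution defined by Green's formula
     < c d_n w, \<phi> > = integral of  c grad w . grad \<phi> - d_t w d_t \<phi>  over (0,T) x \<Omega>. *)
definition outer_conormal_trace ::
  "'a::euclidean_space set \<Rightarrow> 'a set \<Rightarrow> ('a \<Rightarrow> real) \<Rightarrow> real \<Rightarrow> (real \<Rightarrow> 'a \<Rightarrow> real)
     \<Rightarrow> (real \<times> 'a \<Rightarrow> real) \<Rightarrow> real" where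
  "outer_conormal_trace D \<Omega> c T w \<phi> =
     (LINT t|lebesgue_on {0<..<T}. LINT x|lebesgue_on \<Omega>.
        c x * (\<Sum>b\<in>Basis. wderiv \<Omega> b (w t) x * pd (0, b) \<phi> (t, x))
          - time_deriv D T w t x * pd (1, 0) \<phi> (t, x))"

(* Traces of (c d_\<nu> w) on the two sides of S; \<nu> is the outer normal of \<Omega>m and the inner
   normal of \<Omega>p.  Test functions are supported in (0,T) x interior M, so that only the part S
   of the boundaries of \<Omega>m and \<Omega>p contributes. *)
definition flux_transmission ::
  "'a::euclidean_space set \<Rightarrow> 'a set \<Rightarrow> 'a set \<Rightarrow> ('a \<Rightarrow> real) \<Rightarrow> ('a \<Rightarrow> real)
     \<Rightarrow> real \<Rightarrow> (real \<Rightarrow> 'a \<Rightarrow> real) \<Rightarrow> bool" where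
  "flux_transmission M \<Omega>m \<Omega>p cm cp T w \<longleftrightarrow>
     (\<forall>\<phi>. test_fun ({0<..<T} \<times> interior M) \<phi> \<longrightarrow>
        outer_conormal_trace (interior M) \<Omega>m cm T w \<phi>
          = - outer_conormal_trace (interior M) \<Omega>p cp T w \<phi>)"

(* The finite energy solutions with initial data w0 in H10 and w1 in L2.  The condition w = 0 on
   the boundary of M is part of finite_energy. *)
definition wave_solution ::
  "'a::euclidean_space set \<Rightarrow> 'a set \<Rightarrow> 'a set \<Rightarrow> 'a set \<Rightarrow> ('a \<Rightarrow> real) \<Rightarrow> ('a \<Rightarrow> real)
     \<Rightarrow> real \<Rightarrow> ('a \<Rightarrow> real) \<Rightarrow> ('a \<Rightarrow> real) \<Rightarrow> (real \<Rightarrow> 'a \<Rightarrow> real) \<Rightarrow> bool" where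
  "wave_solution M S \<Omega>m \<Omega>p cm cp T w0 w1 w \<longleftrightarrow>
     H10 (interior M) w0 \<and> L2 (interior M) w1 \<and>
     finite_energy (interior M) T w \<and>
     wave_eq (\<Omega>m \<union> \<Omega>p) (glue_coeff \<Omega>m \<Omega>p cm cp) T w \<and>
     (\<forall>t\<in>{0<..<T}. \<exists>g. has_trace \<Omega>m S (w t) g \<and> has_trace \<Omega>p S (w t) g) \<and>
     flux_transmission M \<Omega>m \<Omega>p cm cp T w \<and>
     (AE x in lebesgue_on (interior M). w 0 x = w0 x) \<and>
     (AE x in lebesgue_on (interior M). time_deriv (interior M) T w 0 x = w1 x)"

definition typical_frequency ::
  "'a::euclidean_space set \<Rightarrow> real \<Rightarrow> (real \<Rightarrow> 'a \<Rightarrow> real) \<Rightarrow> real" where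
  "typical_frequency D T w =
     sqrt ((H1_norm D (w 0))\<^sup>2 + (L2_norm D (time_deriv D T w 0))\<^sup>2)
       / sqrt ((L2_norm D (w 0))\<^sup>2 + (Hm1_norm D (time_deriv D T w 0))\<^sup>2)"

end

theory Submission
  imports Defs
begin

text \<open>The solutions are the standing waves \<open>w\<^sub>n(t, x) = cos (t sqrt \<lambda>\<^sub>n) u\<^sub>n(x)\<close>, with vanishing initial
  velocity. At every time they inherit the decay of \<open>u\<^sub>n\<close> away from the interface, and it remains to
  compare the rate \<open>sqrt \<lambda>\<^sub>n\<close> with the typical frequency. Testing the eigenvalue equation with \<open>u\<^sub>n\<close>
  (lemma \<open>energy_identity\<close>) gives \<open>\<integral> c \<bar>\<nabla>u\<^sub>n\<bar>\<^sup>2 = \<lambda>\<^sub>n\<close>. As \<open>c\<close> is bounded below by some \<open>c0 > 0\<close>, this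
  shows \<open>\<lambda>\<^sub>n \<ge> 0\<close> and bounds the typical frequency, which is the \<open>H\<^sup>1\<close> norm of \<open>u\<^sub>n\<close>, by
  \<open>1 + sqrt (\<lambda>\<^sub>n / c0)\<close> (lemma \<open>H1_norm_eigenfunction_bound\<close>).

  Most of the work lies in verifying that a standing wave is a finite energy solution of the
  transmission problem. Three facts carry it.

  Weak derivatives and time derivatives are chosen representatives. Weak derivatives are unique
  almost everywhere by the fundamental lemma of the calculus of variations, which is obtained from
  smooth bumps converging to indicators of boxes; time derivatives are unique as limits in \<open>L\<^sup>2\<close>.

  The two traces on the interface agree because a function in \<open>H\<^sup>1\<^sub>0\<close> of the interior is a limit of
  smooth functions that do not see the interface. A trace inequality on graphs
  (lemma \<open>trace_inequality\<close>) makes these converge on the interface, along a fast sequence even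
  pointwise almost everywhere, to one common trace (lemma \<open>H10_trace_exists\<close>).

  The wave equation and the equality of the conormal traces follow from the eigenvalue equation,
  which holds in the sense of distributions on the whole interior: it is tested with the time
  slices of a space-time test function, and the result is integrated by parts in time
  (lemmas \<open>wave_eq_product\<close> and \<open>flux_transmission_product\<close>).\<close>

section \<open>Calculus of smooth functions\<close>

text \<open>Differentiability at a point, and hence the value of \<open>pd\<close> there, depends only on the germ of the
  function. This also covers points where \<open>pd\<close> is an arbitrary default value.\<close>

lemma pd_cong_open:
  assumes "open U" "\<And>x. x \<in> U \<Longrightarrow> f x = g x" "x \<in> U"
  shows "f differentiable (at x) \<longleftrightarrow> g differentiable (at x)" and "pd b f x = pd b g x"
proof -
  have *: "(f has_derivative D) (at x) \<longleftrightarrow> (g has_derivative D) (at x)" for D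
    using has_derivative_transform_within_open[OF _ assms(1,3), of f D UNIV g]
      has_derivative_transform_within_open[OF _ assms(1,3), of g D UNIV f] assms(2)
    by auto
  then show "f differentiable (at x) \<longleftrightarrow> g differentiable (at x)"
    by (simp add: differentiable_def)
  show "pd b f x = pd b g x"
    unfolding pd_def frechet_derivative_def using * by simp
qed

lemma pd_eqI: "(f has_derivative D) (at x) \<Longrightarrow> pd b f x = D b"
  unfolding pd_def using frechet_derivative_at by metis

lemma has_derivative_pd:
  "f differentiable (at x) \<Longrightarrow> (f has_derivative (\<lambda>h. pd h f x)) (at x)"
  unfolding pd_def by (simp add: frechet_derivative_works)

lemma pd_expand:
  assumes "f differentiable (at x)"
  shows "pd h f x = (\<Sum>b\<in>Basis. (h \<bullet> b) * pd b f x)"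
proof -
  have "linear (\<lambda>h. pd h f x)"
    using has_derivative_linear[OF has_derivative_pd[OF assms]] .
  then have "pd (\<Sum>b\<in>Basis. (h \<bullet> b) *\<^sub>R b) f x = (\<Sum>b\<in>Basis. (h \<bullet> b) * pd b f x)"
    by (subst linear_sum[of "\<lambda>h. pd h f x"]) (simp_all add: linear_scale[of "\<lambda>h. pd h f x"])
  then show ?thesis by (simp add: euclidean_representation)
qed

lemma Ck_on_cong:
  assumes "open U" "\<And>x. x \<in> U \<Longrightarrow> f x = g x" "Ck_on k U f"
  shows "Ck_on k U g"
  using assms(2,3)
proof (induction k arbitrary: f g)
  case 0
  then show ?case by (simp cong: continuous_on_cong)
next
  case (Suc k)
  have "Ck_on k U (pd b g)" if "b \<in> Basis" for b
    using Suc.IH[of "pd b f" "pd b g"] pd_cong_open(2)[OF assms(1)] Suc.prems that by (metis Ck_on.simps(2))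
  then show ?case
    using Suc.prems pd_cong_open(1)[OF assms(1), of f g] by auto
qed

lemma Ck_on_continuous: "Ck_on k U f \<Longrightarrow> continuous_on U f"
  by (cases k) (auto intro!: continuous_at_imp_continuous_on differentiable_imp_continuous_within)

lemma Ck_on_SucD: "Ck_on (Suc k) U f \<Longrightarrow> Ck_on k U f"
proof (induction k arbitrary: f)
  case 0
  then show ?case using Ck_on_continuous by (metis Ck_on.simps(1))
next
  case (Suc k)
  then show ?case by (metis Ck_on.simps(2))
qed

lemma Ck_on_subset: "V \<subseteq> U \<Longrightarrow> Ck_on k U f \<Longrightarrow> Ck_on k V f"
  by (induction k arbitrary: f) (auto intro: continuous_on_subset)

lemma Ck_on_Un: "open U \<Longrightarrow> open V \<Longrightarrow> Ck_on k U f \<Longrightarrow> Ck_on k V f \<Longrightarrow> Ck_on k (U \<union> V) f"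
  by (induction k arbitrary: f) (auto intro: continuous_on_open_Un)

lemma Ck_on_const: "Ck_on k U (\<lambda>x. c)"
proof (induction k arbitrary: c)
  case (Suc k)
  have "pd b (\<lambda>x. c) = (\<lambda>x. 0)" for b :: 'a by (auto simp: pd_def)
  with Suc show ?case by simp
qed simp

lemma Ck_on_add:
  assumes "open U" "Ck_on k U f" "Ck_on k U g"
  shows "Ck_on k U (\<lambda>x. f x + g x)"
  using assms(2,3)
proof (induction k arbitrary: f g)
  case 0
  then show ?case by (auto intro: continuous_on_add)
next
  case (Suc k)
  have "pd b f x + pd b g x = pd b (\<lambda>x. f x + g x) x" if "x \<in> U" for x b
    using pd_eqI[OF has_derivative_add[OF has_derivative_pd has_derivative_pd], of f x g b] Suc.prems that by simp
  then have "Ck_on k U (pd b (\<lambda>x. f x + g x))" if "b \<in> Basis" for b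
    using Ck_on_cong[OF assms(1) _ Suc.IH, of "pd b f" "pd b g"] Suc.prems that by auto
  then show ?case using Suc.prems by auto
qed

lemma pd_mult:
  assumes "f differentiable (at x)" "g differentiable (at x)"
  shows "pd b (\<lambda>x. f x * g x) x = f x * pd b g x + pd b f x * g x"
  using pd_eqI[OF has_derivative_mult[OF has_derivative_pd has_derivative_pd], OF assms] .

lemma Ck_on_mult:
  assumes "open U" "Ck_on k U f" "Ck_on k U g"
  shows "Ck_on k U (\<lambda>x. f x * g x)"
  using assms(2,3)
proof (induction k arbitrary: f g)
  case 0
  then show ?case by (auto intro: continuous_on_mult)
next
  case (Suc k)
  have "f x * pd b g x + pd b f x * g x = pd b (\<lambda>x. f x * g x) x" if "x \<in> U" for x b
    using pd_mult[of f x g b] Suc.prems that by simp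
  moreover have "Ck_on k U f" "Ck_on k U g"
    using Suc.prems Ck_on_SucD by blast+
  ultimately have "Ck_on k U (pd b (\<lambda>x. f x * g x))" if "b \<in> Basis" for b
    using Ck_on_cong[OF assms(1) _ Ck_on_add[OF assms(1) Suc.IH[of f "pd b g"] Suc.IH[of "pd b f" g]],
        of "pd b (\<lambda>x. f x * g x)"] Suc.prems that by simp
  then show ?case using Suc.prems by simp
qed

lemma Ck_on_prod:
  assumes "open U" "finite I" "\<And>i. i \<in> I \<Longrightarrow> Ck_on k U (f i)"
  shows "Ck_on k U (\<lambda>x. \<Prod>i\<in>I. f i x)"
  using assms(2,3) by (induction I) (auto intro: Ck_on_const Ck_on_mult[OF assms(1)])

text \<open>Restriction to a time slice turns space-time derivatives into the derivatives of the slice.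
  Joint differentiability is essential: otherwise the right-hand sides are default values of
  \<open>frechet_derivative\<close>.\<close>

lemma pd_slice:
  fixes f :: "real \<times> 'a::euclidean_space \<Rightarrow> real"
  assumes "f differentiable (at (t, x))"
  shows "(\<lambda>y. f (t, y)) differentiable (at x)" "pd b (\<lambda>y. f (t, y)) x = pd (0, b) f (t, x)"
    and "((\<lambda>s. f (s, x)) has_real_derivative pd (1, 0) f (t, x)) (at t)"
proof -
  have D: "(f has_derivative (\<lambda>h. pd h f (t, x))) (at (t, x))"
    using assms by (rule has_derivative_pd)
  have "((\<lambda>y. (t, y)) has_derivative (\<lambda>h. (0, h))) (at x)"
    by (auto intro!: derivative_eq_intros)
  then have *: "((\<lambda>y. f (t, y)) has_derivative (\<lambda>h. pd (0, h) f (t, x))) (at x)"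
    using has_derivative_compose[of "\<lambda>y. (t, y)" "\<lambda>h. (0, h)" x UNIV f] D by simp
  then show "(\<lambda>y. f (t, y)) differentiable (at x)" "pd b (\<lambda>y. f (t, y)) x = pd (0, b) f (t, x)"
    by (auto simp: differentiable_def pd_eqI)
  have "((\<lambda>y. (y, x)) has_derivative (\<lambda>h. (h, 0))) (at t)"
    by (auto intro!: derivative_eq_intros)
  then have **: "((\<lambda>y. f (y, x)) has_derivative (\<lambda>h. pd (h, 0) f (t, x))) (at t)"
    using has_derivative_compose[of "\<lambda>y. (y, x)" "\<lambda>h. (h, 0)" t UNIV f] D by simp
  have "pd (h, 0) f (t, x) = pd (1, 0) f (t, x) * h" for h
    using linear_scale[OF has_derivative_linear[OF D], of h "(1, 0)"] by simp
  then have "(\<lambda>h. pd (h, 0) f (t, x)) = (*) (pd (1, 0) f (t, x))"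
    by (rule ext)
  then show "((\<lambda>s. f (s, x)) has_real_derivative pd (1, 0) f (t, x)) (at t)"
    using ** unfolding has_field_derivative_def by simp
qed

lemma Ck_on_slice:
  fixes f :: "real \<times> 'a::euclidean_space \<Rightarrow> real"
  shows "Ck_on k UNIV f \<Longrightarrow> Ck_on k UNIV (\<lambda>x. f (t, x))"
proof (induction k arbitrary: f)
  case 0
  then show ?case
    by (auto intro!: continuous_on_compose2[of UNIV f UNIV "\<lambda>x. (t, x)"] continuous_intros)
next
  case (Suc k)
  have "pd b (\<lambda>x. f (t, x)) = (\<lambda>x. pd (0, b) f (t, x))" for b
    using Suc.prems pd_slice(2)[of f t _ b] by auto
  moreover have "Ck_on k UNIV (pd (0, b) f)" if "b \<in> Basis" for b
    using Suc.prems that by (simp add: Basis_prod_def)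
  ultimately show ?case using Suc pd_slice(1)[of f t] by simp
qed

lemma smooth_on_pd: "smooth_on U f \<Longrightarrow> b \<in> Basis \<Longrightarrow> smooth_on U (pd b f)"
  unfolding smooth_on_def by (metis Ck_on.simps(2))

lemma smooth_on_differentiable: "smooth_on U f \<Longrightarrow> x \<in> U \<Longrightarrow> f differentiable (at x)"
  unfolding smooth_on_def by (metis Ck_on.simps(2))

lemma smooth_on_continuous: "smooth_on U f \<Longrightarrow> continuous_on U f"
  unfolding smooth_on_def by (metis Ck_on.simps(1))

section \<open>A smooth function supported on a half line\<close>

text \<open>The polynomial factor makes the family closed under differentiation, so that smoothness of
  \<open>exp (- 1 / t)\<close> becomes an induction.\<close>

definition flat :: "real poly \<Rightarrow> real \<Rightarrow> real" where
  "flat p t = (if t > 0 then poly p (1 / t) * exp (- 1 / t) else 0)"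

text \<open>With \<open>z = 1 / t\<close> the chain rule gives \<open>d/dt (p(z) exp(-z)) = z\<^sup>2 (p(z) - p'(z)) exp(-z)\<close>.\<close>

definition flat_deriv :: "real poly \<Rightarrow> real poly" where
  "flat_deriv p = monom 1 2 * (p - pderiv p)"

lemma poly_div_exp_tendsto_0: "((\<lambda>z. poly p z / exp z) \<longlongrightarrow> (0::real)) at_top"
proof -
  have "((\<lambda>z. \<Sum>i\<le>degree p. coeff p i * (z ^ i / exp z)) \<longlongrightarrow> (\<Sum>i\<le>degree p. coeff p i * 0)) at_top"
    by (intro tendsto_sum tendsto_mult tendsto_const tendsto_power_div_exp_0)
  then show ?thesis
    by (simp add: poly_altdef sum_divide_distrib)
qed

text \<open>Only \<open>t = 0\<close> is delicate; from the right the difference quotient is \<open>z p(z) exp (- z)\<close> with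
  \<open>z = 1 / t\<close>, which tends to 0 because the exponential dominates every polynomial.\<close>

lemma flat_has_derivative: "(flat p has_real_derivative flat (flat_deriv p) t) (at t)"
proof -
  consider "t > 0" | "t < 0" | "t = 0" by linarith
  then show ?thesis
  proof cases
    case 1
    have "((\<lambda>t. poly p (1 / t) * exp (- 1 / t)) has_real_derivative flat (flat_deriv p) t) (at t)"
      using 1 unfolding flat_def flat_deriv_def
      by (auto intro!: derivative_eq_intros DERIV_chain2[OF poly_DERIV]
          simp: poly_monom field_simps power2_eq_square)
    then show ?thesis
      by (rule has_field_derivative_transform_within_open[where S = "{0<..}"]) (use 1 in \<open>auto simp: flat_def\<close>)
  next
    case 2
    have "((\<lambda>t. 0) has_real_derivative flat (flat_deriv p) t) (at t)"
      using 2 unfolding flat_def by auto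
    then show ?thesis
      by (rule has_field_derivative_transform_within_open[where S = "{..<0}"]) (use 2 in \<open>auto simp: flat_def\<close>)
  next
    case 3
    have "((\<lambda>h. flat p h / h) \<longlongrightarrow> 0) (at_right 0)"
    proof -
      have "((\<lambda>h. poly (pCons 0 p) (inverse h) / exp (inverse h)) \<longlongrightarrow> 0) (at_right 0)"
        by (rule filterlim_compose[OF poly_div_exp_tendsto_0 filterlim_inverse_at_top_right])
      moreover have "\<forall>\<^sub>F h in at_right 0. poly (pCons 0 p) (inverse h) / exp (inverse h) = flat p h / h"
        by (auto simp: eventually_at_filter flat_def field_simps exp_minus)
      ultimately show ?thesis by (rule Lim_transform_eventually)
    qed
    moreover have "((\<lambda>h. flat p h / h) \<longlongrightarrow> 0) (at_left 0)"
      by (rule Lim_transform_eventually[OF tendsto_const]) (auto simp: eventually_at_filter flat_def)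
    ultimately have "((\<lambda>h. flat p h / h) \<longlongrightarrow> 0) (at 0)"
      by (simp add: filterlim_at_split)
    then show ?thesis
      using 3 by (simp add: DERIV_def flat_def)
  qed
qed

lemma Ck_on_flat:
  fixes v :: "'a::euclidean_space"
  shows "Ck_on k UNIV (\<lambda>x. flat p (x \<bullet> v + s))"
proof (induction k arbitrary: p)
  case 0
  have "continuous_on UNIV (flat p)"
    using flat_has_derivative DERIV_isCont continuous_at_imp_continuous_on by blast
  then show ?case
    by (auto intro!: continuous_on_compose2[of UNIV "flat p"] continuous_intros)
next
  case (Suc k)
  have D: "((\<lambda>x. flat p (x \<bullet> v + s)) has_derivative (\<lambda>h. flat (flat_deriv p) (x \<bullet> v + s) * (h \<bullet> v))) (at x)" for x
  proof -
    have "((\<lambda>x. x \<bullet> v + s) has_derivative (\<lambda>h. h \<bullet> v)) (at x)"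
      by (auto intro!: derivative_eq_intros)
    from has_derivative_compose[OF this flat_has_derivative[unfolded has_field_derivative_def]]
    show ?thesis .
  qed
  have "pd b (\<lambda>x. flat p (x \<bullet> v + s)) = (\<lambda>x. flat (flat_deriv p) (x \<bullet> v + s) * (b \<bullet> v))" for b
    using pd_eqI[OF D] by auto
  then show ?case
    using D Suc by (auto simp: differentiable_def intro!: Ck_on_mult Ck_on_const)
qed

section \<open>Lebesgue integrals on subsets\<close>

lemma lebesgue_on_support:
  fixes f :: "'a::euclidean_space \<Rightarrow> real"
  assumes "S \<subseteq> T" "S \<in> sets lebesgue" "T \<in> sets lebesgue" "\<And>x. x \<in> T - S \<Longrightarrow> f x = 0"
  shows "integral\<^sup>L (lebesgue_on S) f = integral\<^sup>L (lebesgue_on T) f"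
    and "integrable (lebesgue_on S) f \<longleftrightarrow> integrable (lebesgue_on T) f"
proof -
  have eq: "(\<lambda>x. if x \<in> S then f x else 0) = (\<lambda>x. if x \<in> T then f x else 0)"
  proof
    show "(if x \<in> S then f x else 0) = (if x \<in> T then f x else 0)" for x
      using assms(1,4) by (cases "x \<in> S"; cases "x \<in> T") auto
  qed
  show "integral\<^sup>L (lebesgue_on S) f = integral\<^sup>L (lebesgue_on T) f"
    using Lebesgue_Measure.integral_restrict_UNIV[of S f] Lebesgue_Measure.integral_restrict_UNIV[of T f] assms eq by simp
  show "integrable (lebesgue_on S) f \<longleftrightarrow> integrable (lebesgue_on T) f"
    using Lebesgue_Measure.integrable_restrict_UNIV[of S f] Lebesgue_Measure.integrable_restrict_UNIV[of T f] assms eq by simp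
qed

lemma integrable_lebesgue_on_subset:
  fixes f :: "'a::euclidean_space \<Rightarrow> real"
  assumes "S \<subseteq> T" "S \<in> sets lebesgue" "T \<in> sets lebesgue" "integrable (lebesgue_on T) f"
  shows "integrable (lebesgue_on S) f"
proof -
  have "integrable lebesgue (\<lambda>x. if x \<in> T then f x else 0)"
    using assms by (simp add: Lebesgue_Measure.integrable_restrict_UNIV)
  then have "integrable lebesgue (\<lambda>x. indicator S x *\<^sub>R (if x \<in> T then f x else 0))"
    using assms integrable_mult_indicator by blast
  moreover have "(\<lambda>x. indicator S x *\<^sub>R (if x \<in> T then f x else 0)) = (\<lambda>x. if x \<in> S then f x else 0)"
    using assms(1) by (intro ext) (auto simp: indicator_def)
  ultimately show ?thesis
    using assms by (simp add: Lebesgue_Measure.integrable_restrict_UNIV)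
qed

lemma borel_measurable_lebesgue_on_subset:
  fixes f :: "'a::euclidean_space \<Rightarrow> real"
  assumes "S \<subseteq> T" "f \<in> borel_measurable (lebesgue_on T)"
  shows "f \<in> borel_measurable (lebesgue_on S)"
  using assms measurable_restrict_mono by blast

lemma borel_measurable_lebesgueI:
  fixes f :: "'a::euclidean_space \<Rightarrow> real"
  shows "f \<in> borel_measurable borel \<Longrightarrow> f \<in> borel_measurable lebesgue"
  by (simp add: measurable_completion)

lemma borel_measurable_lebesgue_onI:
  fixes f :: "'a::euclidean_space \<Rightarrow> real"
  shows "f \<in> borel_measurable borel \<Longrightarrow> f \<in> borel_measurable (lebesgue_on S)"
  by (simp add: borel_measurable_lebesgueI measurable_restrict_space1)

lemma AE_lebesgue_on_subset:
  assumes "S \<subseteq> T" "S \<in> sets lebesgue" "T \<in> sets lebesgue" "AE x in lebesgue_on T. P x"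
  shows "AE x in lebesgue_on S. P x"
  using assms(4,1) by (auto simp: AE_restrict_space_iff assms(2,3) elim!: eventually_mono)

section \<open>Test functions\<close>

lemma test_funI:
  assumes "smooth_on UNIV \<phi>" "compact K" "K \<subseteq> \<Omega>" "\<And>x. x \<notin> K \<Longrightarrow> \<phi> x = 0"
  shows "test_fun \<Omega> \<phi>"
proof -
  have "closure {x. \<phi> x \<noteq> 0} \<subseteq> K"
    by (rule closure_minimal) (use assms compact_imp_closed in auto)
  moreover have "bounded (closure {x. \<phi> x \<noteq> 0})"
    using calculation compact_imp_bounded[OF assms(2)] bounded_subset by blast
  ultimately show ?thesis
    using assms unfolding test_fun_def by (auto simp: compact_eq_bounded_closed)
qed

lemma test_fun_supportE:
  assumes "test_fun \<Omega> \<phi>"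
  obtains K where "compact K" "K \<subseteq> \<Omega>" "\<forall>x. x \<notin> K \<longrightarrow> \<phi> x = 0"
    "\<forall>x b. x \<notin> K \<longrightarrow> pd b \<phi> x = 0"
proof -
  define K where "K = closure {x. \<phi> x \<noteq> 0}"
  have K: "compact K" "K \<subseteq> \<Omega>" using assms by (auto simp: test_fun_def K_def)
  have z: "\<phi> x = 0" if "x \<notin> K" for x
    using that closure_subset[of "{x. \<phi> x \<noteq> 0}"] by (auto simp: K_def)
  have p: "pd b \<phi> x = 0" if "x \<notin> K" for x b
  proof -
    have "open (- K)" by (simp add: K_def open_Compl)
    then have "pd b \<phi> x = pd b (\<lambda>x. 0) x"
      using z that by (intro pd_cong_open(2)[of "- K"]) simp_all
    then show ?thesis by (simp add: pd_def)
  qed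
  show ?thesis by (rule that[OF K]) (use z p in blast)+
qed

lemma test_fun_eq_0: "test_fun \<Omega> \<phi> \<Longrightarrow> x \<notin> \<Omega> \<Longrightarrow> \<phi> x = 0" "test_fun \<Omega> \<phi> \<Longrightarrow> x \<notin> \<Omega> \<Longrightarrow> pd b \<phi> x = 0"
  by (erule test_fun_supportE, blast)+

lemma test_fun_mono: "test_fun \<Omega> \<phi> \<Longrightarrow> \<Omega> \<subseteq> \<Omega>' \<Longrightarrow> test_fun \<Omega>' \<phi>"
  unfolding test_fun_def by auto

lemma test_fun_smooth: "test_fun \<Omega> \<phi> \<Longrightarrow> smooth_on UNIV \<phi>"
  unfolding test_fun_def by auto

lemma test_fun_zero: "test_fun \<Omega> (\<lambda>x. 0)"
  by (rule test_funI[of _ "{}"]) (auto simp: smooth_on_def Ck_on_const)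

lemma test_fun_pd:
  assumes "test_fun \<Omega> \<phi>" "b \<in> Basis"
  shows "test_fun \<Omega> (pd b \<phi>)"
proof -
  obtain K where K[rule_format]: "compact K" "K \<subseteq> \<Omega>" "\<forall>x. x \<notin> K \<longrightarrow> \<phi> x = 0" "\<forall>x b. x \<notin> K \<longrightarrow> pd b \<phi> x = 0"
    by (rule test_fun_supportE[OF assms(1)])
  show ?thesis
    using assms K by (intro test_funI[of _ K] smooth_on_pd) (simp_all add: test_fun_smooth)
qed

text \<open>The factor \<open>c\<close> is smooth on \<open>\<Omega>\<close> only, but the product vanishes off a compact subset \<open>K\<close> of \<open>\<Omega>\<close>;
  the open sets \<open>\<Omega>\<close> and \<open>- K\<close> cover the whole space.\<close>

lemma test_fun_mult_smooth:
  assumes "open \<Omega>" "smooth_on \<Omega> c" "test_fun \<Omega> \<phi>"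
  shows "test_fun \<Omega> (\<lambda>x. c x * \<phi> x)"
proof -
  obtain K where K[rule_format]: "compact K" "K \<subseteq> \<Omega>" "\<forall>x. x \<notin> K \<longrightarrow> \<phi> x = 0" "\<forall>x b. x \<notin> K \<longrightarrow> pd b \<phi> x = 0"
    by (rule test_fun_supportE[OF assms(3)])
  have "Ck_on k UNIV (\<lambda>x. c x * \<phi> x)" for k
  proof -
    have "Ck_on k \<Omega> \<phi>" "Ck_on k \<Omega> c"
      using assms(2) test_fun_smooth[OF assms(3)] Ck_on_subset[of \<Omega> UNIV] by (auto simp: smooth_on_def)
    then have "Ck_on k \<Omega> (\<lambda>x. c x * \<phi> x)"
      using Ck_on_mult[OF assms(1)] by simp
    moreover have "Ck_on k (- K) (\<lambda>x. c x * \<phi> x)"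
      using Ck_on_cong[OF _ _ Ck_on_const[of k "- K" 0], of "\<lambda>x. c x * \<phi> x"] K(3)
        open_Compl[OF compact_imp_closed[OF K(1)]] by simp
    ultimately have "Ck_on k (\<Omega> \<union> - K) (\<lambda>x. c x * \<phi> x)"
      using open_Compl[OF compact_imp_closed[OF K(1)]] by (intro Ck_on_Un assms(1))
    moreover have "\<Omega> \<union> - K = UNIV" using K(2) by auto
    ultimately show ?thesis by simp
  qed
  then show ?thesis
    using K by (intro test_funI[of _ K]) (auto simp: smooth_on_def)
qed

lemma test_fun_slice:
  fixes \<phi> :: "real \<times> 'a::euclidean_space \<Rightarrow> real"
  assumes "test_fun (I \<times> D) \<phi>"
  shows "test_fun D (\<lambda>x. \<phi> (t, x))"
proof -
  obtain K where K[rule_format]: "compact K" "K \<subseteq> I \<times> D" "\<forall>x. x \<notin> K \<longrightarrow> \<phi> x = 0" "\<forall>x b. x \<notin> K \<longrightarrow> pd b \<phi> x = 0"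
    by (rule test_fun_supportE[OF assms])
  show ?thesis
  proof (rule test_funI[of _ "snd ` K"])
    show "smooth_on UNIV (\<lambda>x. \<phi> (t, x))"
      using test_fun_smooth[OF assms] by (auto simp: smooth_on_def intro: Ck_on_slice)
    show "compact (snd ` K)" using K(1) by (intro compact_continuous_image continuous_intros)
    show "\<phi> (t, x) = 0" if "x \<notin> snd ` K" for x using that K(3)[of "(t,x)"] by force
  qed (use K(2) in auto)
qed

lemma test_fun_continuous: "test_fun \<Omega> \<phi> \<Longrightarrow> continuous_on UNIV \<phi>"
  by (intro smooth_on_continuous test_fun_smooth)

lemma test_fun_borel: "test_fun \<Omega> \<phi> \<Longrightarrow> \<phi> \<in> borel_measurable borel"
  by (intro borel_measurable_continuous_onI test_fun_continuous)

lemma test_fun_boundedE: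
  assumes "test_fun \<Omega> \<phi>"
  obtains B where "B > 0" "\<forall>x. \<bar>\<phi> x\<bar> \<le> B"
proof -
  obtain K where K[rule_format]: "compact K" "K \<subseteq> \<Omega>" "\<forall>x. x \<notin> K \<longrightarrow> \<phi> x = 0" "\<forall>x b. x \<notin> K \<longrightarrow> pd b \<phi> x = 0"
    by (rule test_fun_supportE[OF assms])
  have c: "compact (\<phi> ` K)"
    using K(1) continuous_on_subset[OF test_fun_continuous[OF assms] subset_UNIV] by (intro compact_continuous_image)
  obtain B where B: "\<forall>y\<in>\<phi> ` K. norm y \<le> B"
    using compact_imp_bounded[OF c, unfolded bounded_iff] by (rule exE)
  have "\<bar>\<phi> x\<bar> \<le> max B 1" for x
  proof (cases "x \<in> K")
    case True
    then show ?thesis using B[THEN bspec, OF imageI[OF True]] by simp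
  next
    case False
    then show ?thesis using K(3)[of x] by simp
  qed
  then show ?thesis by (intro that[of "max B 1"] allI) simp
qed

lemma compact_support_cballE:
  assumes "test_fun \<Omega> (\<phi> :: 'a::euclidean_space \<Rightarrow> real)"
  obtains R where "R > 0" "\<forall>x. norm x > R \<longrightarrow> \<phi> x = 0" "\<forall>x b. norm x > R \<longrightarrow> pd b \<phi> x = 0"
proof -
  obtain K where K[rule_format]: "compact K" "K \<subseteq> \<Omega>" "\<forall>x. x \<notin> K \<longrightarrow> \<phi> x = 0" "\<forall>x b. x \<notin> K \<longrightarrow> pd b \<phi> x = 0"
    by (rule test_fun_supportE[OF assms])
  obtain R where R: "R > 0 \<and> (\<forall>x\<in>K. norm x \<le> R)"
    using compact_imp_bounded[OF K(1), unfolded bounded_pos] by (rule exE)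
  have "x \<notin> K" if "norm x > R" for x
  proof
    assume "x \<in> K"
    with R have "norm x \<le> R" by simp
    with that show False by simp
  qed
  then show ?thesis using R K(3,4) by (intro that[of R]) simp_all
qed

lemma bounded_support_integrable:
  fixes f :: "'a::euclidean_space \<Rightarrow> real"
  assumes "f \<in> borel_measurable lebesgue" "\<And>x. \<bar>f x\<bar> \<le> B" "\<And>x. norm x > R \<Longrightarrow> f x = 0"
  shows "integrable lebesgue f"
proof (rule Bochner_Integration.integrable_bound)
  show "integrable lebesgue (\<lambda>x. B * indicator (cball 0 R) x)"
    by (intro integrable_mult_right integrable_real_indicator)
      (use emeasure_bounded_finite[OF bounded_cball] in \<open>auto simp: less_top\<close>)
  show "AE x in lebesgue. norm (f x) \<le> norm (B * indicator (cball 0 R) x)"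
    using assms(2,3) by (auto simp: indicator_def intro!: AE_I2) (smt (verit))
qed fact

lemma test_fun_integrable:
  assumes "test_fun \<Omega> \<phi>"
  shows "integrable lebesgue \<phi>"
proof -
  obtain B where "B > 0" "\<forall>x. \<bar>\<phi> x\<bar> \<le> B" by (rule test_fun_boundedE[OF assms])
  obtain R where "R > 0" "\<forall>x. norm x > R \<longrightarrow> \<phi> x = 0" "\<forall>x b. norm x > R \<longrightarrow> pd b \<phi> x = 0"
    by (rule compact_support_cballE[OF assms])
  show ?thesis
    using test_fun_borel[OF assms] by (intro bounded_support_integrable[of _ B R] borel_measurable_lebesgueI) (use \<open>\<forall>x. \<bar>\<phi> x\<bar> \<le> B\<close> \<open>\<forall>x. norm x > R \<longrightarrow> \<phi> x = 0\<close> in blast)+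
qed

lemma lebesgue_integral_translation:
  fixes f :: "'a::euclidean_space \<Rightarrow> real"
  assumes "f \<in> borel_measurable borel"
  shows "(LINT x|lebesgue. f (h + x)) = (LINT x|lebesgue. f x)"
proof -
  have "(LINT x|lborel. f (h + x)) = (LINT x|distr lborel borel ((+) h). f x)"
    using assms by (subst integral_distr) auto
  also have "\<dots> = (LINT x|lborel. f x)" by (simp add: lborel_distr_plus)
  finally show ?thesis using assms by (simp add: integral_completion)
qed

lemma has_real_derivative_along_line:
  assumes "f differentiable (at (x + r *\<^sub>R b))"
  shows "((\<lambda>r. f (x + r *\<^sub>R b)) has_real_derivative pd b f (x + r *\<^sub>R b)) (at r)"
proof -
  have D: "(f has_derivative (\<lambda>h. pd h f (x + r *\<^sub>R b))) (at (x + r *\<^sub>R b))"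
    using assms by (rule has_derivative_pd)
  have "((\<lambda>r. x + r *\<^sub>R b) has_derivative (\<lambda>h. h *\<^sub>R b)) (at r)"
    by (auto intro!: derivative_eq_intros)
  then have "((\<lambda>r. f (x + r *\<^sub>R b)) has_derivative (\<lambda>h. pd (h *\<^sub>R b) f (x + r *\<^sub>R b))) (at r)"
    using has_derivative_compose[of "\<lambda>r. x + r *\<^sub>R b" "\<lambda>h. h *\<^sub>R b" r UNIV f] D by simp
  moreover have "(\<lambda>h. pd (h *\<^sub>R b) f (x + r *\<^sub>R b)) = (*) (pd b f (x + r *\<^sub>R b))"
    using linear_scale[OF has_derivative_linear[OF D]] by (auto simp: mult.commute)
  ultimately show ?thesis by (simp add: has_field_derivative_def)
qed

text \<open>Integrals are invariant under translation, so the integrals of the difference quotients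
  vanish. They are dominated because a derivative of a test function is bounded.\<close>

lemma integral_pd_test_fun:
  assumes \<phi>: "test_fun \<Omega> \<phi>" and b: "b \<in> Basis"
  shows "(LINT x|lebesgue. pd b \<phi> x) = 0"
proof -
  obtain B where "B > 0" and B[rule_format]: "\<forall>x. \<bar>pd b \<phi> x\<bar> \<le> B" by (rule test_fun_boundedE[OF test_fun_pd[OF \<phi> b]])
  obtain R where "R > 0" and R[rule_format]: "\<forall>x. norm x > R \<longrightarrow> \<phi> x = 0" "\<forall>x b. norm x > R \<longrightarrow> pd b \<phi> x = 0"
    by (rule compact_support_cballE[OF \<phi>])
  have diff: "\<phi> differentiable (at x)" for x
    using smooth_on_differentiable[OF test_fun_smooth[OF \<phi>]] by simp
  define h where "h n = 1 / real (Suc n)" for n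
  have h: "h n > 0" "h n \<le> 1" for n by (auto simp: h_def)
  define s where "s n x = (\<phi> (h n *\<^sub>R b + x) - \<phi> x) / h n" for n x
  have [measurable]: "\<phi> \<in> borel_measurable borel" using test_fun_borel[OF \<phi>] .
  have meas: "s n \<in> borel_measurable lebesgue" "(\<lambda>x. \<phi> (h n *\<^sub>R b + x)) \<in> borel_measurable borel" for n
    unfolding s_def by (rule borel_measurable_lebesgueI) measurable
  have s0: "s n x = 0" if "norm x > R + 1" for n x
  proof -
    have "norm x \<le> norm (h n *\<^sub>R b + x) + norm (h n *\<^sub>R b)"
      using norm_triangle_ineq4[of "h n *\<^sub>R b + x" "h n *\<^sub>R b"] by simp
    moreover have "norm (h n *\<^sub>R b) \<le> 1" using h[of n] b by simp
    ultimately show ?thesis using that R(1)[of x] R(1)[of "h n *\<^sub>R b + x"] unfolding s_def by simp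
  qed
  have sB: "\<bar>s n x\<bar> \<le> B" for n x
  proof -
    have "norm (\<phi> (x + h n *\<^sub>R b) - \<phi> (x + 0 *\<^sub>R b)) \<le> B * norm (h n - 0)"
      using B has_real_derivative_along_line[OF diff]
      by (intro field_differentiable_bound[of UNIV "\<lambda>r. \<phi> (x + r *\<^sub>R b)" "\<lambda>r. pd b \<phi> (x + r *\<^sub>R b)"]) auto
    then show ?thesis using h[of n] by (simp add: s_def field_simps)
  qed
  have lim: "(\<lambda>n. s n x) \<longlonglongrightarrow> pd b \<phi> x" for x
  proof -
    have "((\<lambda>r. (\<phi> (x + (0 + r) *\<^sub>R b) - \<phi> (x + 0 *\<^sub>R b)) / r) \<longlongrightarrow> pd b \<phi> (x + 0 *\<^sub>R b)) (at 0)"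
      using has_real_derivative_along_line[where x = x and r = 0 and b = b, OF diff] by (simp add: DERIV_def)
    moreover have "filterlim h (at 0) sequentially"
      unfolding filterlim_at h_def using lim_1_over_n LIMSEQ_Suc[OF lim_1_over_n]
      by (auto intro!: always_eventually)
    ultimately have "(\<lambda>n. (\<phi> (x + (0 + h n) *\<^sub>R b) - \<phi> (x + 0 *\<^sub>R b)) / h n) \<longlonglongrightarrow> pd b \<phi> (x + 0 *\<^sub>R b)"
      by (rule filterlim_compose)
    then show ?thesis by (simp add: s_def add.commute)
  qed
  have "(\<lambda>n. LINT x|lebesgue. s n x) \<longlonglongrightarrow> (LINT x|lebesgue. pd b \<phi> x)"
  proof (rule integral_dominated_convergence[where w = "\<lambda>x. B * indicator (cball 0 (R + 1)) x"])
    show "integrable lebesgue (\<lambda>x. B * indicator (cball 0 (R + 1)) x)"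
      by (intro integrable_mult_right integrable_real_indicator)
        (use emeasure_bounded_finite[OF bounded_cball] in \<open>auto simp: less_top\<close>)
    show "AE x in lebesgue. norm (s n x) \<le> B * indicator (cball 0 (R + 1)) x" for n
      using s0[of _ n] sB[of n] by (auto simp: indicator_def intro!: AE_I2)
    show "pd b \<phi> \<in> borel_measurable lebesgue"
      using test_fun_borel[OF test_fun_pd[OF \<phi> b]] borel_measurable_lebesgueI by blast
  qed (auto simp: lim meas)
  moreover have "(LINT x|lebesgue. s n x) = 0" for n
  proof -
    have 1: "integrable lebesgue \<phi>" using test_fun_integrable[OF \<phi>] .
    obtain B' where "B' > 0" and B'[rule_format]: "\<forall>x. \<bar>\<phi> x\<bar> \<le> B'" by (rule test_fun_boundedE[OF \<phi>])
    have 2: "integrable lebesgue (\<lambda>x. \<phi> (h n *\<^sub>R b + x))"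
    proof (rule bounded_support_integrable)
      show "\<bar>\<phi> (h n *\<^sub>R b + x)\<bar> \<le> B'" for x by (rule B')
      show "\<phi> (h n *\<^sub>R b + x) = 0" if "norm x > R + 1" for x
        using s0[OF that, of n] R[of x] that h[of n] unfolding s_def by simp
    qed (use meas(2) borel_measurable_lebesgueI in blast)
    show ?thesis
      using lebesgue_integral_translation[of \<phi> "h n *\<^sub>R b"]
      unfolding s_def by (simp add: Bochner_Integration.integral_diff[OF 2 1])
  qed
  ultimately show ?thesis by (simp add: LIMSEQ_const_iff)
qed

lemma integral_by_parts_test_fun:
  assumes \<phi>: "test_fun UNIV \<phi>" and \<psi>: "test_fun \<Omega> \<psi>" and \<Omega>: "open \<Omega>" and b: "b \<in> Basis"
  shows "(LINT x|lebesgue_on \<Omega>. \<phi> x * pd b \<psi> x) = - (LINT x|lebesgue_on \<Omega>. pd b \<phi> x * \<psi> x)"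
proof -
  have sets: "\<Omega> \<in> sets lebesgue" using \<Omega> by auto
  have t: "test_fun \<Omega> (\<lambda>x. f x * g x)" if "test_fun UNIV f" "test_fun \<Omega> g" for f g
    using test_fun_mult_smooth[OF \<Omega> _ that(2)] test_fun_smooth[OF that(1)]
    by (meson Ck_on_subset smooth_on_def subset_UNIV)
  have "pd b (\<lambda>x. \<phi> x * \<psi> x) = (\<lambda>x. \<phi> x * pd b \<psi> x + pd b \<phi> x * \<psi> x)"
    using smooth_on_differentiable[OF test_fun_smooth[OF \<phi>]] smooth_on_differentiable[OF test_fun_smooth[OF \<psi>]]
    by (auto simp: pd_mult)
  then have "(LINT x|lebesgue. \<phi> x * pd b \<psi> x + pd b \<phi> x * \<psi> x) = 0"
    using integral_pd_test_fun[OF t[OF \<phi> \<psi>] b] by simp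
  moreover have "integrable lebesgue (\<lambda>x. \<phi> x * pd b \<psi> x)" "integrable lebesgue (\<lambda>x. pd b \<phi> x * \<psi> x)"
    using test_fun_integrable[OF t[OF \<phi> test_fun_pd[OF \<psi> b]]]
      test_fun_integrable[OF t[OF test_fun_pd[OF \<phi> b] \<psi>]] .
  ultimately have "(LINT x|lebesgue. \<phi> x * pd b \<psi> x) = - (LINT x|lebesgue. pd b \<phi> x * \<psi> x)"
    by simp
  then show ?thesis
    using lebesgue_on_support(1)[of \<Omega> UNIV "\<lambda>x. \<phi> x * pd b \<psi> x"] lebesgue_on_support(1)[of \<Omega> UNIV "\<lambda>x. pd b \<phi> x * \<psi> x"]
      test_fun_eq_0[OF \<psi>] sets by (simp add: lebesgue_on_UNIV_eq)
qed

section \<open>The fundamental lemma of the calculus of variations\<close>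

text \<open>A test function tending to the indicator of the box \<open>box a b\<close> from below as \<open>n\<close> grows,
  because \<open>flat 1\<close> increases to 1 at infinity. Passing to the limit under an integral yields the
  integral over the box, which takes the place of a regularization by convolution.\<close>

definition box_bump :: "'a::euclidean_space \<Rightarrow> 'a \<Rightarrow> nat \<Rightarrow> 'a \<Rightarrow> real" where
  "box_bump a b n x = (\<Prod>i\<in>Basis. flat 1 (x \<bullet> (real (Suc n) *\<^sub>R i) + - real (Suc n) * (a \<bullet> i))
     * flat 1 (x \<bullet> (- real (Suc n) *\<^sub>R i) + real (Suc n) * (b \<bullet> i)))"

lemma flat_one_bounds: "0 \<le> flat 1 t" "flat 1 t \<le> 1" "t \<le> 0 \<Longrightarrow> flat 1 t = 0"
  by (auto simp: flat_def)

lemma flat_one_tendsto: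
  "(\<lambda>n. flat 1 (real (Suc n) * t)) \<longlonglongrightarrow> indicator {0<..} t"
proof (cases "t > 0")
  case True
  have "(\<lambda>n. exp (- (1 / real (Suc n)) * (1 / t))) \<longlonglongrightarrow> exp (- 0 * (1 / t))"
    by (intro tendsto_intros LIMSEQ_Suc[OF lim_1_over_n])
  moreover have "exp (- (1 / real (Suc n)) * (1 / t)) = flat 1 (real (Suc n) * t)" for n
    using True by (simp add: flat_def)
  ultimately show ?thesis using True by simp
next
  case False
  then have "flat 1 (real (Suc n) * t) = 0" for n
    by (intro flat_one_bounds(3)) (simp add: mult_nonneg_nonpos)
  with False show ?thesis by simp
qed

lemma box_bump_alt:
  "box_bump a b n x = (\<Prod>i\<in>Basis. flat 1 (real (Suc n) * (x \<bullet> i - a \<bullet> i)) * flat 1 (real (Suc n) * (b \<bullet> i - x \<bullet> i)))"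
  unfolding box_bump_def by (intro prod.cong refl arg_cong2[where f = "(*)"] arg_cong[where f = "flat 1"])
    (simp_all add: algebra_simps)

lemma box_bump_bounds: "0 \<le> box_bump a b n x" "box_bump a b n x \<le> 1"
  unfolding box_bump_def
  by (auto intro!: prod_nonneg prod_le_1 mult_nonneg_nonneg mult_le_one flat_one_bounds)

lemma box_bump_outside: "x \<notin> box a b \<Longrightarrow> box_bump a b n x = 0"
proof -
  assume "x \<notin> box a b"
  then obtain i where i: "i \<in> Basis" "x \<bullet> i - a \<bullet> i \<le> 0 \<or> b \<bullet> i - x \<bullet> i \<le> 0"
    unfolding mem_box by force
  have "flat 1 (real (Suc n) * (x \<bullet> i - a \<bullet> i)) * flat 1 (real (Suc n) * (b \<bullet> i - x \<bullet> i)) = 0"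
    using i(2) flat_one_bounds(3)[OF mult_nonneg_nonpos[of "real (Suc n)"]] by auto
  then show ?thesis
    unfolding box_bump_alt using i(1) by (intro prod_zero) auto
qed

lemma box_bump_tendsto: "(\<lambda>n. box_bump a b n x) \<longlonglongrightarrow> indicator (box a b) x"
proof -
  have "(\<lambda>n. box_bump a b n x) \<longlonglongrightarrow>
     (\<Prod>i\<in>Basis. indicator {0<..} (x \<bullet> i - a \<bullet> i) * indicator {0<..} (b \<bullet> i - x \<bullet> i))"
    unfolding box_bump_alt by (intro tendsto_prod tendsto_mult flat_one_tendsto)
  moreover have "(\<Prod>i\<in>Basis. indicator {0<..} (x \<bullet> i - a \<bullet> i) * indicator {0<..} (b \<bullet> i - x \<bullet> i))
     = (indicator (box a b) x :: real)"
    by (auto simp: indicator_def mem_box prod_zero_iff)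
  ultimately show ?thesis by simp
qed

lemma test_fun_box_bump:
  assumes "cbox a b \<subseteq> \<Omega>"
  shows "test_fun \<Omega> (box_bump a b n)"
proof (rule test_funI[of _ "cbox a b"])
  show "smooth_on UNIV (box_bump a b n)"
    unfolding smooth_on_def box_bump_def[abs_def]
    by (intro allI Ck_on_prod Ck_on_mult Ck_on_flat) auto
  show "box_bump a b n x = 0" if "x \<notin> cbox a b" for x
    using that box_subset_cbox[of a b] by (intro box_bump_outside) auto
qed (use assms in auto)

text \<open>Boxes form an intersection stable generator of the Borel sets, so the integrals over all Borel
  sets vanish.\<close>

lemma AE_zero_if_integral_box_zero:
  fixes f :: "'a::euclidean_space \<Rightarrow> real"
  assumes f: "integrable lebesgue f" and f0: "(LINT x|lebesgue. f x) = 0"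
    and box: "\<And>a b. (LINT x|lebesgue. indicator (box a b) x * f x) = 0"
  shows "AE x in lebesgue. f x = 0"
proof -
  obtain g where g[measurable]: "g \<in> borel_measurable lborel" and fg: "AE x in lborel. f x = g x"
    using completion_ex_borel_measurable_real[OF borel_measurable_integrable[OF f]] by auto
  have fg': "AE x in lebesgue. f x = g x" using fg by (rule AE_completion)
  have [measurable]: "g \<in> borel_measurable borel" "f \<in> borel_measurable lebesgue" 
    using g borel_measurable_integrable[OF f] by simp_all
  have [measurable]: "g \<in> borel_measurable lebesgue" by (rule borel_measurable_lebesgueI) measurable
  have "integrable lebesgue g"
    using f by (subst integrable_cong_AE[OF _ _ fg', symmetric]) auto
  then have gi: "integrable lborel g" by (simp add: integrable_completion)
  have tr: "(LINT x|lborel. indicator A x * g x) = (LINT x|lebesgue. indicator A x * f x)" if [measurable]: "A \<in> sets borel" for A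
  proof -
    have [measurable]: "(indicator A :: 'a \<Rightarrow> real) \<in> borel_measurable lebesgue" by (rule borel_measurable_lebesgueI) measurable
    have "(LINT x|lborel. indicator A x * g x) = (LINT x|lebesgue. indicator A x * g x)"
      by (subst integral_completion) auto
    also have "\<dots> = (LINT x|lebesgue. indicator A x * f x)"
      by (rule integral_cong_AE) (use fg' in auto)
    finally show ?thesis .
  qed
  have "(LINT x:A|lborel. g x) = 0" if "A \<in> sigma_sets UNIV (range (\<lambda>(a, b). box a b))" for A
  proof -
    have "Int_stable (range (\<lambda>(a, b). box a b :: 'a set))"
      by (auto simp: Int_stable_def box_Int_box)
    moreover have "range (\<lambda>(a, b). box a b :: 'a set) \<subseteq> Pow UNIV" by simp
    ultimately show ?thesis using that
  proof (induction rule: sigma_sets_induct_disjoint)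
    case (basic A)
    then show ?case using tr box by (auto simp: set_lebesgue_integral_def)
  next
    case (compl A)
    then have [measurable]: "A \<in> sets borel" by (metis borel_eq_box sets_measure_of subset_UNIV Pow_UNIV)
    have "(LINT x:(UNIV - A)|lborel. g x) = (LINT x:UNIV|lborel. g x) - (LINT x:A|lborel. g x)"
    proof -
      have "(LINT x:UNIV|lborel. g x) = (LINT x:(A \<union> (UNIV - A))|lborel. g x)" by simp
      also have "\<dots> = (LINT x:A|lborel. g x) + (LINT x:(UNIV - A)|lborel. g x)"
        using gi by (intro set_integral_Un) (auto simp: set_integrable_def intro!: integrable_mult_indicator[where 'b = real, simplified])
      finally show ?thesis by simp
    qed
    moreover have "(LINT x:UNIV|lborel. g x) = 0"
      using tr[of UNIV] f0 by (simp add: set_lebesgue_integral_def)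
    ultimately show ?case using compl by simp
  next
    case (union A)
    then have [measurable]: "A i \<in> sets borel" for i by (metis borel_eq_box sets_measure_of subset_UNIV Pow_UNIV range_subsetD)
    have "(LINT x:(\<Union>i. A i)|lborel. g x) = (\<Sum>i. LINT x:A i|lborel. g x)"
      using gi union by (intro lebesgue_integral_countable_add)
        (auto simp: disjoint_family_on_def set_integrable_def intro!: integrable_mult_indicator[where 'b = real, simplified])
    then show ?case using union by simp
  qed (auto simp: set_lebesgue_integral_def)
  qed
  then have "(LINT x:A|lborel. g x) = (LINT x:A|lborel. 0)" if "A \<in> sets lborel" for A
    using that by (simp add: borel_eq_box)
  then have "AE x in lborel. g x = 0"
    by (intro density_unique_real gi) auto
  with fg have "AE x in lborel. f x = 0" by auto
  then show ?thesis by (rule AE_completion)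
qed

section \<open>Square integrable functions\<close>

lemma L2_measurable: "L2 \<Omega> f \<Longrightarrow> f \<in> borel_measurable (lebesgue_on \<Omega>)"
  by (simp add: L2_def)

lemma L2_integrable_square: "L2 \<Omega> f \<Longrightarrow> integrable (lebesgue_on \<Omega>) (\<lambda>x. (f x)\<^sup>2)"
  by (simp add: L2_def)

lemma L2_cmult: "L2 \<Omega> f \<Longrightarrow> L2 \<Omega> (\<lambda>x. a * f x)"
  by (auto simp: L2_def power_mult_distrib)

lemma L2_zero: "L2 \<Omega> (\<lambda>x. 0)"
  by (simp add: L2_def)

lemma L2_integrable_mult:
  assumes "L2 \<Omega> f" "L2 \<Omega> g"
  shows "integrable (lebesgue_on \<Omega>) (\<lambda>x. f x * g x)"
proof (rule Bochner_Integration.integrable_bound)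
  show "integrable (lebesgue_on \<Omega>) (\<lambda>x. (f x)\<^sup>2 + (g x)\<^sup>2)"
    using assms by (simp add: L2_def)
  have "\<bar>f x * g x\<bar> \<le> (f x)\<^sup>2 + (g x)\<^sup>2" for x
    unfolding abs_mult using sum_squares_bound[of "\<bar>f x\<bar>" "\<bar>g x\<bar>"] mult_nonneg_nonneg[of "\<bar>f x\<bar>" "\<bar>g x\<bar>", OF abs_ge_zero abs_ge_zero]
    unfolding power2_abs by linarith
  then show "AE x in lebesgue_on \<Omega>. norm (f x * g x) \<le> norm ((f x)\<^sup>2 + (g x)\<^sup>2)"
    by (auto intro!: AE_I2 order_trans[OF _ abs_ge_self])
  show "(\<lambda>x. f x * g x) \<in> borel_measurable (lebesgue_on \<Omega>)"
    using assms by (auto simp: L2_def)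
qed

lemma L2_add:
  assumes "L2 \<Omega> f" "L2 \<Omega> g"
  shows "L2 \<Omega> (\<lambda>x. f x + g x)"
proof -
  have "(\<lambda>x. (f x + g x)\<^sup>2) = (\<lambda>x. (f x)\<^sup>2 + 2 * (f x * g x) + (g x)\<^sup>2)"
    by (auto simp: power2_sum)
  then show ?thesis
    using assms L2_integrable_mult[OF assms] by (auto simp: L2_def)
qed

lemma L2_diff: "L2 \<Omega> f \<Longrightarrow> L2 \<Omega> g \<Longrightarrow> L2 \<Omega> (\<lambda>x. f x - g x)"
  using L2_add[of \<Omega> f "\<lambda>x. - 1 * g x"] L2_cmult[of \<Omega> g "- 1"] by simp

lemma L2_mult_bounded:
  assumes "L2 \<Omega> f" "c \<in> borel_measurable (lebesgue_on \<Omega>)" "\<And>x. x \<in> \<Omega> \<Longrightarrow> \<bar>c x\<bar> \<le> B"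
  shows "L2 \<Omega> (\<lambda>x. c x * f x)"
  unfolding L2_def
proof
  show "integrable (lebesgue_on \<Omega>) (\<lambda>x. (c x * f x)\<^sup>2)"
  proof (rule Bochner_Integration.integrable_bound)
    show "integrable (lebesgue_on \<Omega>) (\<lambda>x. B\<^sup>2 * (f x)\<^sup>2)" using assms by (simp add: L2_def)
    have "(c x * f x)\<^sup>2 \<le> B\<^sup>2 * (f x)\<^sup>2" if "x \<in> \<Omega>" for x
      unfolding power_mult_distrib
      by (rule mult_right_mono) (use assms(3)[OF that] abs_le_square_iff[of "c x" B] in auto)
    then show "AE x in lebesgue_on \<Omega>. norm ((c x * f x)\<^sup>2) \<le> norm (B\<^sup>2 * (f x)\<^sup>2)"
      by (auto intro!: AE_I2 simp: zero_le_mult_iff)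
  qed (use assms in \<open>auto simp: L2_def\<close>)
qed (use assms in \<open>auto simp: L2_def\<close>)

lemma L2_subset:
  assumes "\<Omega>' \<subseteq> \<Omega>" "\<Omega>' \<in> sets lebesgue" "\<Omega> \<in> sets lebesgue" "L2 \<Omega> f"
  shows "L2 \<Omega>' f"
  using assms integrable_lebesgue_on_subset[OF assms(1-3)] borel_measurable_lebesgue_on_subset[OF assms(1)]
  unfolding L2_def by blast

lemma L2_test_fun:
  assumes "test_fun \<Omega>' \<phi>" "\<Omega> \<in> sets lebesgue"
  shows "L2 \<Omega> \<phi>"
proof -
  have "test_fun UNIV \<phi>" using assms(1) test_fun_mono by blast
  then have "test_fun UNIV (\<lambda>x. \<phi> x * \<phi> x)"
    by (intro test_fun_mult_smooth) (auto simp: test_fun_smooth)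
  then have "integrable (lebesgue_on UNIV) (\<lambda>x. (\<phi> x)\<^sup>2)"
    using test_fun_integrable by (auto simp: power2_eq_square lebesgue_on_UNIV_eq)
  then have "integrable (lebesgue_on \<Omega>) (\<lambda>x. (\<phi> x)\<^sup>2)"
    using integrable_lebesgue_on_subset[OF subset_UNIV assms(2)] by simp
  then show ?thesis
    unfolding L2_def using borel_measurable_lebesgue_onI[OF test_fun_borel[OF assms(1)]] by blast
qed

lemma L2_norm_nonneg: "0 \<le> L2_norm \<Omega> f"
  by (simp add: L2_norm_def)

lemma L2_norm_sq: "(L2_norm \<Omega> f)\<^sup>2 = (LINT x|lebesgue_on \<Omega>. (f x)\<^sup>2)"
  by (simp add: L2_norm_def integral_nonneg_AE)

lemma L2_norm_cmult: "L2_norm \<Omega> (\<lambda>x. a * f x) = \<bar>a\<bar> * L2_norm \<Omega> f"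
  by (simp add: L2_norm_def power_mult_distrib real_sqrt_mult)

lemma L2_norm_cong_AE:
  assumes "AE x in lebesgue_on \<Omega>. f x = g x" "L2 \<Omega> f" "L2 \<Omega> g"
  shows "L2_norm \<Omega> f = L2_norm \<Omega> g"
  unfolding L2_norm_def
  by (rule arg_cong[where f = sqrt], rule integral_cong_AE) (use assms in \<open>auto simp: L2_def\<close>)

lemma L2_norm_eq_0_imp:
  assumes "L2 \<Omega> f" "L2_norm \<Omega> f = 0"
  shows "AE x in lebesgue_on \<Omega>. f x = 0"
proof -
  have "(LINT x|lebesgue_on \<Omega>. (f x)\<^sup>2) = 0"
    using assms(2) L2_norm_sq[of \<Omega> f] by simp
  then have "AE x in lebesgue_on \<Omega>. (f x)\<^sup>2 = 0"
    using integral_nonneg_eq_0_iff_AE[OF L2_integrable_square[OF assms(1)]] by auto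
  then show ?thesis by simp
qed

lemma L2_norm_diff_sq:
  assumes "L2 \<Omega> f" "L2 \<Omega> g"
  shows "(L2_norm \<Omega> (\<lambda>x. f x - g x))\<^sup>2 \<le> 2 * (L2_norm \<Omega> f)\<^sup>2 + 2 * (L2_norm \<Omega> g)\<^sup>2"
proof -
  have "(f x - g x)\<^sup>2 \<le> 2 * (f x)\<^sup>2 + 2 * (g x)\<^sup>2" for x
    using zero_le_power2[of "f x + g x"] by (simp add: power2_eq_square algebra_simps)
  then have "(LINT x|lebesgue_on \<Omega>. (f x - g x)\<^sup>2) \<le> (LINT x|lebesgue_on \<Omega>. 2 * (f x)\<^sup>2 + 2 * (g x)\<^sup>2)"
    using assms L2_diff[OF assms] by (intro integral_mono) (auto simp: L2_def)
  also have "\<dots> = 2 * (LINT x|lebesgue_on \<Omega>. (f x)\<^sup>2) + 2 * (LINT x|lebesgue_on \<Omega>. (g x)\<^sup>2)"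
    using assms by (simp add: L2_def)
  finally show ?thesis by (simp add: L2_norm_sq)
qed

text \<open>The quadratic polynomial \<open>s \<mapsto> \<parallel>f - s g\<parallel>\<^sup>2\<close> is nonnegative, so its discriminant is not positive.\<close>

lemma L2_Cauchy_Schwarz:
  assumes f: "L2 \<Omega> f" and g: "L2 \<Omega> g"
  shows "\<bar>LINT x|lebesgue_on \<Omega>. f x * g x\<bar> \<le> L2_norm \<Omega> f * L2_norm \<Omega> g"
proof -
  define A B C where "A = (LINT x|lebesgue_on \<Omega>. (f x)\<^sup>2)" and "B = (LINT x|lebesgue_on \<Omega>. f x * g x)"
    and "C = (LINT x|lebesgue_on \<Omega>. (g x)\<^sup>2)"
  have quad: "0 \<le> A - 2 * s * B + s\<^sup>2 * C" for s
  proof -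
    have "0 \<le> (LINT x|lebesgue_on \<Omega>. (f x - s * g x)\<^sup>2)" by (simp add: integral_nonneg_AE)
    also have "(LINT x|lebesgue_on \<Omega>. (f x - s * g x)\<^sup>2) =
       (LINT x|lebesgue_on \<Omega>. (f x)\<^sup>2 - 2 * s * (f x * g x) + s\<^sup>2 * (g x)\<^sup>2)"
      by (intro Bochner_Integration.integral_cong) (auto simp: power2_eq_square algebra_simps)
    also have "\<dots> = A - 2 * s * B + s\<^sup>2 * C"
      using f g L2_integrable_mult[OF f g] by (simp add: L2_def A_def B_def C_def)
    finally show ?thesis .
  qed
  have AC: "A \<ge> 0" "C \<ge> 0" by (auto simp: A_def C_def integral_nonneg_AE)
  have "B\<^sup>2 \<le> A * C"
  proof (cases "C = 0")
    case True
    have "B = 0"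
    proof (rule ccontr)
      assume "B \<noteq> 0"
      then show False
        using quad[of "(A + 1) / (2 * B)"] True by (simp add: field_simps)
    qed
    with True show ?thesis by simp
  next
    case False
    with AC have "C > 0" by simp
    then show ?thesis
      using quad[of "B / C"] by (simp add: field_simps power2_eq_square)
  qed
  then have "sqrt (B\<^sup>2) \<le> sqrt (A * C)" by (rule real_sqrt_le_mono)
  then show ?thesis by (simp add: real_sqrt_mult L2_norm_def A_def B_def C_def)
qed

section \<open>Weak derivatives\<close>

text \<open>Orthogonality to the bumps passes to their limit: the products with \<open>g\<close> are dominated by \<open>\<bar>g\<bar>\<close> on
  the closed box, and \<open>g\<close> is integrable there because the box has finite measure.\<close>

lemma integral_box_zero:
  fixes g :: "'a::euclidean_space \<Rightarrow> real"
  assumes \<Omega>: "open \<Omega>" and g: "L2 \<Omega> g"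
    and orth: "\<And>\<phi>. test_fun \<Omega> \<phi> \<Longrightarrow> (LINT x|lebesgue_on \<Omega>. g x * \<phi> x) = 0"
    and ab: "cbox a b \<subseteq> \<Omega>"
  shows "integrable lebesgue (\<lambda>x. if x \<in> box a b then g x else 0)"
    and "(LINT x|lebesgue. (if x \<in> box a b then g x else 0)) = 0"
proof -
  have sets: "\<Omega> \<in> sets lebesgue" "cbox a b \<in> sets lebesgue" "box a b \<in> sets lebesgue"
    using \<Omega> by auto
  have int: "integrable (lebesgue_on (cbox a b)) g"
  proof (rule Bochner_Integration.integrable_bound)
    have "L2 (cbox a b) g" by (rule L2_subset[OF ab sets(2,1) g])
    moreover have "integrable (lebesgue_on (cbox a b)) (\<lambda>x. 1::real)"
      by (rule finite_measure.integrable_const[OF finite_measure_lebesgue_on[OF lmeasurable_cbox]])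
    ultimately show "integrable (lebesgue_on (cbox a b)) (\<lambda>x. 1 + (g x)\<^sup>2)"
      by (simp add: L2_def)
    have "\<bar>g x\<bar> \<le> 1 + (g x)\<^sup>2" for x
      using sum_squares_bound[of "\<bar>g x\<bar>" 1] by simp
    then show "AE x in lebesgue_on (cbox a b). norm (g x) \<le> norm (1 + (g x)\<^sup>2)"
      by (auto intro!: AE_I2)
    show "g \<in> borel_measurable (lebesgue_on (cbox a b))"
      using borel_measurable_lebesgue_on_subset[OF ab L2_measurable[OF g]] .
  qed
  then have "integrable (lebesgue_on (box a b)) g"
    by (rule integrable_lebesgue_on_subset[OF box_subset_cbox sets(3,2)])
  then show "integrable lebesgue (\<lambda>x. if x \<in> box a b then g x else 0)"
    by (simp add: Lebesgue_Measure.integrable_restrict_UNIV sets)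
  have boxO: "box a b \<subseteq> \<Omega>" using ab box_subset_cbox by blast
  have "(\<lambda>n. LINT x|lebesgue_on \<Omega>. g x * box_bump a b n x) \<longlonglongrightarrow>
      (LINT x|lebesgue_on \<Omega>. g x * indicator (box a b) x)"
  proof (rule integral_dominated_convergence[where w = "\<lambda>x. if x \<in> cbox a b then \<bar>g x\<bar> else 0"])
    have "integrable (lebesgue_on (cbox a b)) (\<lambda>x. if x \<in> cbox a b then \<bar>g x\<bar> else 0)"
      using integrable_abs[OF int] by (rule Bochner_Integration.integrable_cong[THEN iffD1, rotated 2]) auto
    then show "integrable (lebesgue_on \<Omega>) (\<lambda>x. if x \<in> cbox a b then \<bar>g x\<bar> else 0)"
      using lebesgue_on_support(2)[OF ab sets(2,1), of "\<lambda>x. if x \<in> cbox a b then \<bar>g x\<bar> else 0"] by simp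
    show "(\<lambda>x. g x * box_bump a b n x) \<in> borel_measurable (lebesgue_on \<Omega>)" for n
      using L2_measurable[OF g] borel_measurable_lebesgue_onI[OF test_fun_borel[OF test_fun_box_bump[OF ab]]]
      by (rule borel_measurable_times)
    show "(\<lambda>x. g x * indicator (box a b) x) \<in> borel_measurable (lebesgue_on \<Omega>)"
      using L2_measurable[OF g] by (rule borel_measurable_times) (intro borel_measurable_lebesgue_onI, simp)
    show "AE x in lebesgue_on \<Omega>. (\<lambda>n. g x * box_bump a b n x) \<longlonglongrightarrow> g x * indicator (box a b) x"
      by (intro AE_I2 tendsto_intros box_bump_tendsto)
    have "norm (g x * box_bump a b n x) \<le> (if x \<in> cbox a b then \<bar>g x\<bar> else 0)" for n x
    proof (cases "x \<in> box a b")
      case True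
      then have "x \<in> cbox a b" using box_subset_cbox by blast
      then show ?thesis
        using box_bump_bounds[of a b n x] by (simp add: abs_mult mult_left_le)
    qed (simp add: box_bump_outside)
    then show "AE x in lebesgue_on \<Omega>. norm (g x * box_bump a b n x) \<le> (if x \<in> cbox a b then \<bar>g x\<bar> else 0)" for n
      by (intro AE_I2)
  qed
  then have "(LINT x|lebesgue_on \<Omega>. g x * indicator (box a b) x) = 0"
    by (simp add: orth[OF test_fun_box_bump[OF ab]] LIMSEQ_const_iff)
  moreover have "(LINT x|lebesgue_on \<Omega>. g x * indicator (box a b) x) = (LINT x|lebesgue_on (box a b). g x * indicator (box a b) x)"
    using lebesgue_on_support(1)[OF boxO sets(3,1), of "\<lambda>x. g x * indicator (box a b) x"] by simp
  moreover have "\<dots> = (LINT x|lebesgue_on (box a b). g x)"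
    by (intro Bochner_Integration.integral_cong) auto
  ultimately show "(LINT x|lebesgue. (if x \<in> box a b then g x else 0)) = 0"
    by (simp add: Lebesgue_Measure.integral_restrict_UNIV sets)
qed

text \<open>Countably many closed boxes exhaust \<open>\<Omega>\<close>. Inside such a box the integrals over all smaller boxes
  vanish, since the intersection of two boxes is a box.\<close>

lemma fundamental_lemma_calculus_of_variations:
  fixes g :: "'a::euclidean_space \<Rightarrow> real"
  assumes \<Omega>: "open \<Omega>" and g: "L2 \<Omega> g"
    and orth: "\<And>\<phi>. test_fun \<Omega> \<phi> \<Longrightarrow> (LINT x|lebesgue_on \<Omega>. g x * \<phi> x) = 0"
  shows "AE x in lebesgue_on \<Omega>. g x = 0"
proof -
  have bz: "integrable lebesgue (\<lambda>x. if x \<in> box a b then g x else 0)"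
    "(LINT x|lebesgue. (if x \<in> box a b then g x else 0)) = 0" if "cbox a b \<subseteq> \<Omega>" for a b
    by (rule integral_box_zero[OF \<Omega> g _ that], rule orth, assumption)+
  have box: "AE x in lebesgue. x \<in> cbox a b \<longrightarrow> g x = 0" if ab: "cbox a b \<subseteq> \<Omega>" for a b
  proof -
    let ?f = "\<lambda>x. if x \<in> box a b then g x else 0"
    have "AE x in lebesgue. ?f x = 0"
    proof (rule AE_zero_if_integral_box_zero)
      show "integrable lebesgue ?f" "(LINT x|lebesgue. ?f x) = 0"
        using bz[OF ab] by simp_all
      fix c d :: 'a
      define l u where "l = (\<Sum>i\<in>Basis. max (c \<bullet> i) (a \<bullet> i) *\<^sub>R i)"
        and "u = (\<Sum>i\<in>Basis. min (d \<bullet> i) (b \<bullet> i) *\<^sub>R i)"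
      have box_eq: "box c d \<inter> box a b = box l u"
        by (simp add: box_Int_box l_def u_def)
      have "cbox l u \<subseteq> \<Omega>"
        using ab by (rule order_trans[rotated]) (auto simp: mem_box l_def u_def)
      then have "(LINT x|lebesgue. (if x \<in> box l u then g x else 0)) = 0"
        by (rule bz(2))
      moreover have "(\<lambda>x. indicator (box c d) x * ?f x) = (\<lambda>x. if x \<in> box l u then g x else 0)"
        using box_eq by (intro ext) (auto simp: indicator_def)
      ultimately show "(LINT x|lebesgue. indicator (box c d) x * ?f x) = 0" by simp
    qed
    moreover have "AE x in lebesgue. x \<notin> cbox a b - box a b"
      using negligible_frontier_interval[of a b] by (intro AE_not_in) (simp add: negligible_iff_null_sets)
    ultimately show ?thesis
      by eventually_elim (auto split: if_splits)
  qed
  obtain \<D> where D: "countable \<D>" "\<D> \<subseteq> Pow \<Omega>" "\<And>X. X \<in> \<D> \<Longrightarrow> \<exists>a b. X = cbox a b" "\<Union>\<D> = \<Omega>"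
    using open_countable_Union_open_cbox[OF \<Omega>] by blast
  have "AE x in lebesgue. \<forall>X\<in>\<D>. x \<in> X \<longrightarrow> g x = 0"
  proof (rule AE_ball_countable'[OF _ D(1)])
    fix X assume "X \<in> \<D>"
    then obtain a b where "X = cbox a b" "cbox a b \<subseteq> \<Omega>" using D(2) D(3)[of X] by auto
    then show "AE x in lebesgue. x \<in> X \<longrightarrow> g x = 0" using box by simp
  qed
  then have "AE x in lebesgue. x \<in> \<Omega> \<longrightarrow> g x = 0"
    by eventually_elim (use D(4) in blast)
  then show ?thesis
    using \<Omega> by (simp add: AE_restrict_space_iff)
qed

lemma has_weak_deriv_cmult:
  "has_weak_deriv \<Omega> b f g \<Longrightarrow> has_weak_deriv \<Omega> b (\<lambda>x. a * f x) (\<lambda>x. a * g x)"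
  by (auto simp: has_weak_deriv_def mult.assoc)

lemma has_weak_deriv_diff:
  assumes "has_weak_deriv \<Omega> b f f'" "has_weak_deriv \<Omega> b g g'" "L2 \<Omega> f" "L2 \<Omega> f'" "L2 \<Omega> g" "L2 \<Omega> g'"
    and "b \<in> Basis" "open \<Omega>"
  shows "has_weak_deriv \<Omega> b (\<lambda>x. f x - g x) (\<lambda>x. f' x - g' x)"
  unfolding has_weak_deriv_def
proof (intro allI impI)
  fix \<phi> assume \<phi>: "test_fun \<Omega> \<phi>"
  have "L2 \<Omega> \<phi>" "L2 \<Omega> (pd b \<phi>)"
    using L2_test_fun[OF \<phi>] L2_test_fun[OF test_fun_pd[OF \<phi> assms(7)]] assms(8) by auto
  then show "(LINT x|lebesgue_on \<Omega>. (f x - g x) * pd b \<phi> x) = - (LINT x|lebesgue_on \<Omega>. (f' x - g' x) * \<phi> x)"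
    using assms \<phi> by (simp add: has_weak_deriv_def left_diff_distrib L2_integrable_mult)
qed

lemma has_weak_deriv_subset:
  assumes "has_weak_deriv \<Omega> b f g" "open \<Omega>'" "open \<Omega>" "\<Omega>' \<subseteq> \<Omega>"
  shows "has_weak_deriv \<Omega>' b f g"
  unfolding has_weak_deriv_def
proof (intro allI impI)
  fix \<phi> assume \<phi>: "test_fun \<Omega>' \<phi>"
  have "(LINT x|lebesgue_on \<Omega>'. h x * p x) = (LINT x|lebesgue_on \<Omega>. h x * p x)" if "\<And>x. x \<notin> \<Omega>' \<Longrightarrow> p x = 0" for h p :: "'a \<Rightarrow> real"
    using assms that by (intro lebesgue_on_support(1)) auto
  from this[of \<phi>] this[of "pd b \<phi>"]
  show "(LINT x|lebesgue_on \<Omega>'. f x * pd b \<phi> x) = - (LINT x|lebesgue_on \<Omega>'. g x * \<phi> x)"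
    using assms(1) test_fun_mono[OF \<phi> assms(4)] test_fun_eq_0[OF \<phi>] by (simp add: has_weak_deriv_def)
qed

lemma has_weak_deriv_test_fun:
  "open \<Omega> \<Longrightarrow> test_fun UNIV \<phi> \<Longrightarrow> b \<in> Basis \<Longrightarrow> has_weak_deriv \<Omega> b \<phi> (pd b \<phi>)"
  by (simp add: has_weak_deriv_def integral_by_parts_test_fun)

lemma weak_deriv_unique:
  assumes "open \<Omega>" "L2 \<Omega> g" "L2 \<Omega> h" "has_weak_deriv \<Omega> b f g" "has_weak_deriv \<Omega> b f h"
  shows "AE x in lebesgue_on \<Omega>. g x = h x"
proof -
  have "(LINT x|lebesgue_on \<Omega>. (g x - h x) * \<phi> x) = 0" if \<phi>: "test_fun \<Omega> \<phi>" for \<phi>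
  proof -
    have "L2 \<Omega> \<phi>" using L2_test_fun[OF \<phi>] assms(1) by auto
    then show ?thesis
      using assms \<phi> by (simp add: has_weak_deriv_def left_diff_distrib L2_integrable_mult)
  qed
  then have "AE x in lebesgue_on \<Omega>. g x - h x = 0"
    by (intro fundamental_lemma_calculus_of_variations L2_diff assms)
  then show ?thesis by simp
qed

lemma H1_L2: "H1 \<Omega> f \<Longrightarrow> L2 \<Omega> f"
  by (simp add: H1_def)

lemma H1_wderiv:
  assumes "H1 \<Omega> f" "b \<in> Basis"
  shows "L2 \<Omega> (wderiv \<Omega> b f)" "has_weak_deriv \<Omega> b f (wderiv \<Omega> b f)"
  using assms someI_ex[of "\<lambda>g. L2 \<Omega> g \<and> has_weak_deriv \<Omega> b f g"] unfolding H1_def wderiv_def by auto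

lemma H1I: "L2 \<Omega> f \<Longrightarrow> (\<And>b. b \<in> Basis \<Longrightarrow> L2 \<Omega> (g b)) \<Longrightarrow> (\<And>b. b \<in> Basis \<Longrightarrow> has_weak_deriv \<Omega> b f (g b)) \<Longrightarrow> H1 \<Omega> f"
  unfolding H1_def by blast

text \<open>The function \<open>wderiv\<close> is an arbitrary choice among the weak derivatives. Computing or
  comparing \<open>H1_norm\<close> therefore rests on the uniqueness of weak derivatives almost everywhere.\<close>

lemma wderiv_AE_eq:
  assumes "open \<Omega>" "L2 \<Omega> g" "has_weak_deriv \<Omega> b f g"
  shows "AE x in lebesgue_on \<Omega>. wderiv \<Omega> b f x = g x"
proof -
  have "L2 \<Omega> (wderiv \<Omega> b f) \<and> has_weak_deriv \<Omega> b f (wderiv \<Omega> b f)"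
    unfolding wderiv_def by (rule someI[of _ g]) (use assms in auto)
  then show ?thesis using weak_deriv_unique[OF assms(1)] assms(2,3) by blast
qed

lemma H1_norm_nonneg: "0 \<le> H1_norm \<Omega> f"
  by (auto simp: H1_norm_def intro!: add_nonneg_nonneg sum_nonneg)

lemma H1_norm_sq: "(H1_norm \<Omega> f)\<^sup>2 = (L2_norm \<Omega> f)\<^sup>2 + (\<Sum>b\<in>Basis. (L2_norm \<Omega> (wderiv \<Omega> b f))\<^sup>2)"
  unfolding H1_norm_def by (subst real_sqrt_pow2) (auto intro!: add_nonneg_nonneg sum_nonneg)

lemma H1_norm_sq_eq:
  assumes "open \<Omega>" "L2 \<Omega> f" "\<And>b. b \<in> Basis \<Longrightarrow> L2 \<Omega> (g b)" "\<And>b. b \<in> Basis \<Longrightarrow> has_weak_deriv \<Omega> b f (g b)"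
  shows "(H1_norm \<Omega> f)\<^sup>2 = (L2_norm \<Omega> f)\<^sup>2 + (\<Sum>b\<in>Basis. (L2_norm \<Omega> (g b))\<^sup>2)"
proof -
  have "L2_norm \<Omega> (wderiv \<Omega> b f) = L2_norm \<Omega> (g b)" if "b \<in> Basis" for b
    using H1_wderiv(1)[OF H1I[of \<Omega> f g] that] wderiv_AE_eq[OF assms(1), of "g b" b f] assms that
    by (intro L2_norm_cong_AE) auto
  then show ?thesis by (simp add: H1_norm_sq)
qed

lemma L2_norm_le_H1_norm: "L2_norm \<Omega> f \<le> H1_norm \<Omega> f"
  by (rule power2_le_imp_le) (auto simp: H1_norm_sq H1_norm_nonneg intro!: sum_nonneg)

lemma L2_norm_wderiv_le_H1_norm: "b \<in> Basis \<Longrightarrow> L2_norm \<Omega> (wderiv \<Omega> b f) \<le> H1_norm \<Omega> f"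
proof (rule power2_le_imp_le)
  assume "b \<in> Basis"
  then have "(L2_norm \<Omega> (wderiv \<Omega> b f))\<^sup>2 \<le> (\<Sum>b\<in>Basis. (L2_norm \<Omega> (wderiv \<Omega> b f))\<^sup>2)"
    by (intro member_le_sum) auto
  then show "(L2_norm \<Omega> (wderiv \<Omega> b f))\<^sup>2 \<le> (H1_norm \<Omega> f)\<^sup>2"
    using zero_le_power2[of "L2_norm \<Omega> f"] unfolding H1_norm_sq by linarith
qed (rule H1_norm_nonneg)

lemma H1_cmult:
  assumes "open \<Omega>" "H1 \<Omega> f"
  shows "H1 \<Omega> (\<lambda>x. a * f x)" and "H1_norm \<Omega> (\<lambda>x. a * f x) = \<bar>a\<bar> * H1_norm \<Omega> f"
    and "b \<in> Basis \<Longrightarrow> AE x in lebesgue_on \<Omega>. wderiv \<Omega> b (\<lambda>x. a * f x) x = a * wderiv \<Omega> b f x"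
proof -
  have *: "L2 \<Omega> (\<lambda>x. a * f x)" "b \<in> Basis \<Longrightarrow> L2 \<Omega> (\<lambda>x. a * wderiv \<Omega> b f x)"
    "b \<in> Basis \<Longrightarrow> has_weak_deriv \<Omega> b (\<lambda>x. a * f x) (\<lambda>x. a * wderiv \<Omega> b f x)" for b
    using assms by (auto intro: L2_cmult has_weak_deriv_cmult H1_wderiv H1_L2)
  show "H1 \<Omega> (\<lambda>x. a * f x)" by (rule H1I[OF *])
  show "b \<in> Basis \<Longrightarrow> AE x in lebesgue_on \<Omega>. wderiv \<Omega> b (\<lambda>x. a * f x) x = a * wderiv \<Omega> b f x"
    using wderiv_AE_eq[OF assms(1)] * by blast
  have "(H1_norm \<Omega> (\<lambda>x. a * f x))\<^sup>2 = (\<bar>a\<bar> * H1_norm \<Omega> f)\<^sup>2"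
    using H1_norm_sq_eq[OF assms(1) *] by (simp add: H1_norm_sq power_mult_distrib L2_norm_cmult sum_distrib_left distrib_left)
  then show "H1_norm \<Omega> (\<lambda>x. a * f x) = \<bar>a\<bar> * H1_norm \<Omega> f"
    by (rule power2_eq_imp_eq) (simp_all add: H1_norm_nonneg)
qed

lemma H1_subset:
  assumes "open \<Omega>" "open \<Omega>'" "\<Omega>' \<subseteq> \<Omega>" "H1 \<Omega> f"
  shows "H1 \<Omega>' f" and "H1_norm \<Omega>' f \<le> H1_norm \<Omega> f"
    and "b \<in> Basis \<Longrightarrow> AE x in lebesgue_on \<Omega>'. wderiv \<Omega>' b f x = wderiv \<Omega> b f x"
proof -
  have sets: "\<Omega> \<in> sets lebesgue" "\<Omega>' \<in> sets lebesgue" using assms by auto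
  have *: "L2 \<Omega>' f" "b \<in> Basis \<Longrightarrow> L2 \<Omega>' (wderiv \<Omega> b f)"
    "b \<in> Basis \<Longrightarrow> has_weak_deriv \<Omega>' b f (wderiv \<Omega> b f)" for b
    using assms L2_subset[OF assms(3) sets(2,1)] H1_wderiv[OF assms(4)] H1_L2 has_weak_deriv_subset
    by blast+
  show "H1 \<Omega>' f" by (rule H1I[OF *])
  show "b \<in> Basis \<Longrightarrow> AE x in lebesgue_on \<Omega>'. wderiv \<Omega>' b f x = wderiv \<Omega> b f x"
    using wderiv_AE_eq[OF assms(2)] * by blast
  have mono: "(L2_norm \<Omega>' g)\<^sup>2 \<le> (L2_norm \<Omega> g)\<^sup>2" if "L2 \<Omega> g" for g
    unfolding L2_norm_sq using that L2_integrable_square assms(3) sets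
    by (intro integral_mono_lebesgue_on_AE) auto
  have "(H1_norm \<Omega>' f)\<^sup>2 = (L2_norm \<Omega>' f)\<^sup>2 + (\<Sum>b\<in>Basis. (L2_norm \<Omega>' (wderiv \<Omega> b f))\<^sup>2)"
    by (rule H1_norm_sq_eq[OF assms(2)]) (use * in auto)
  also have "\<dots> \<le> (H1_norm \<Omega> f)\<^sup>2"
    unfolding H1_norm_sq[of \<Omega>]
    using H1_wderiv(1)[OF assms(4)] H1_L2[OF assms(4)] by (intro add_mono sum_mono mono)
  finally show "H1_norm \<Omega>' f \<le> H1_norm \<Omega> f"
    by (rule power2_le_imp_le) (rule H1_norm_nonneg)
qed

lemma H1_test_fun:
  assumes "open \<Omega>" "test_fun UNIV \<phi>"
  shows "H1 \<Omega> \<phi>" and "b \<in> Basis \<Longrightarrow> AE x in lebesgue_on \<Omega>. wderiv \<Omega> b \<phi> x = pd b \<phi> x"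
    and "(H1_norm \<Omega> \<phi>)\<^sup>2 = (L2_norm \<Omega> \<phi>)\<^sup>2 + (\<Sum>b\<in>Basis. (L2_norm \<Omega> (pd b \<phi>))\<^sup>2)"
proof -
  have *: "L2 \<Omega> \<phi>" "b \<in> Basis \<Longrightarrow> L2 \<Omega> (pd b \<phi>)" "b \<in> Basis \<Longrightarrow> has_weak_deriv \<Omega> b \<phi> (pd b \<phi>)" for b
    using L2_test_fun[OF assms(2)] L2_test_fun[OF test_fun_pd[OF assms(2)]] has_weak_deriv_test_fun[OF assms] assms(1) by simp_all
  show "H1 \<Omega> \<phi>" by (rule H1I[OF *])
  show "b \<in> Basis \<Longrightarrow> AE x in lebesgue_on \<Omega>. wderiv \<Omega> b \<phi> x = pd b \<phi> x"
    using wderiv_AE_eq[OF assms(1)] * by blast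
  show "(H1_norm \<Omega> \<phi>)\<^sup>2 = (L2_norm \<Omega> \<phi>)\<^sup>2 + (\<Sum>b\<in>Basis. (L2_norm \<Omega> (pd b \<phi>))\<^sup>2)"
    using H1_norm_sq_eq[OF assms(1) *] by simp
qed

lemma H1_diff:
  assumes "open \<Omega>" "H1 \<Omega> f" "H1 \<Omega> g"
  shows "H1 \<Omega> (\<lambda>x. f x - g x)"
    and "b \<in> Basis \<Longrightarrow> AE x in lebesgue_on \<Omega>. wderiv \<Omega> b (\<lambda>x. f x - g x) x = wderiv \<Omega> b f x - wderiv \<Omega> b g x"
    and "(H1_norm \<Omega> (\<lambda>x. f x - g x))\<^sup>2 \<le> 2 * (H1_norm \<Omega> f)\<^sup>2 + 2 * (H1_norm \<Omega> g)\<^sup>2"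
proof -
  have *: "L2 \<Omega> (\<lambda>x. f x - g x)" "b \<in> Basis \<Longrightarrow> L2 \<Omega> (\<lambda>x. wderiv \<Omega> b f x - wderiv \<Omega> b g x)"
    "b \<in> Basis \<Longrightarrow> has_weak_deriv \<Omega> b (\<lambda>x. f x - g x) (\<lambda>x. wderiv \<Omega> b f x - wderiv \<Omega> b g x)" for b
    using assms(1) H1_wderiv[OF assms(2)] H1_wderiv[OF assms(3)] H1_L2[OF assms(2)] H1_L2[OF assms(3)]
    by (auto intro!: L2_diff has_weak_deriv_diff)
  show "H1 \<Omega> (\<lambda>x. f x - g x)" by (rule H1I[OF *])
  show "b \<in> Basis \<Longrightarrow> AE x in lebesgue_on \<Omega>. wderiv \<Omega> b (\<lambda>x. f x - g x) x = wderiv \<Omega> b f x - wderiv \<Omega> b g x"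
    using wderiv_AE_eq[OF assms(1)] * by blast
  have "(H1_norm \<Omega> (\<lambda>x. f x - g x))\<^sup>2 = (L2_norm \<Omega> (\<lambda>x. f x - g x))\<^sup>2
      + (\<Sum>b\<in>Basis. (L2_norm \<Omega> (\<lambda>x. wderiv \<Omega> b f x - wderiv \<Omega> b g x))\<^sup>2)"
    by (rule H1_norm_sq_eq[OF assms(1)]) (use * in auto)
  also have "\<dots> \<le> (2 * (L2_norm \<Omega> f)\<^sup>2 + 2 * (L2_norm \<Omega> g)\<^sup>2)
      + (\<Sum>b\<in>Basis. 2 * (L2_norm \<Omega> (wderiv \<Omega> b f))\<^sup>2 + 2 * (L2_norm \<Omega> (wderiv \<Omega> b g))\<^sup>2)"
    using H1_wderiv(1)[OF assms(2)] H1_wderiv(1)[OF assms(3)] H1_L2[OF assms(2)] H1_L2[OF assms(3)]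
    by (intro add_mono sum_mono L2_norm_diff_sq)
  finally show "(H1_norm \<Omega> (\<lambda>x. f x - g x))\<^sup>2 \<le> 2 * (H1_norm \<Omega> f)\<^sup>2 + 2 * (H1_norm \<Omega> g)\<^sup>2"
    by (simp add: H1_norm_sq sum.distrib sum_distrib_left distrib_left)
qed

lemma H10_H1: "H10 \<Omega> f \<Longrightarrow> H1 \<Omega> f"
  by (simp add: H10_def)

lemma test_fun_cmult: "test_fun \<Omega> \<phi> \<Longrightarrow> test_fun \<Omega> (\<lambda>x. a * \<phi> x)"
proof -
  assume \<phi>: "test_fun \<Omega> \<phi>"
  have "test_fun UNIV (\<lambda>x. a * \<phi> x)"
    using test_fun_mono[OF \<phi> subset_UNIV] by (intro test_fun_mult_smooth) (auto simp: smooth_on_def Ck_on_const)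
  moreover have "closure {x. a * \<phi> x \<noteq> 0} \<subseteq> closure {x. \<phi> x \<noteq> 0}"
    by (rule closure_mono) auto
  ultimately show ?thesis using \<phi> unfolding test_fun_def by auto
qed

lemma H10_cmult:
  assumes "open \<Omega>" "H10 \<Omega> f"
  shows "H10 \<Omega> (\<lambda>x. a * f x)"
proof -
  obtain \<phi> where \<phi>: "\<forall>k::nat. test_fun \<Omega> (\<phi> k)" "(\<lambda>k. H1_norm \<Omega> (\<lambda>x. f x - \<phi> k x)) \<longlonglongrightarrow> 0"
    using assms(2) unfolding H10_def by auto
  have "H1_norm \<Omega> (\<lambda>x. a * f x - a * \<phi> k x) = \<bar>a\<bar> * H1_norm \<Omega> (\<lambda>x. f x - \<phi> k x)" for k
  proof -
    have "test_fun UNIV (\<phi> k)" using \<phi>(1) test_fun_mono by blast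
    then have "H1 \<Omega> (\<lambda>x. f x - \<phi> k x)"
      by (intro H1_diff(1) H1_test_fun(1) assms H10_H1)
    from H1_cmult(2)[OF assms(1) this, of a] show ?thesis by (simp add: right_diff_distrib)
  qed
  then have "(\<lambda>k. H1_norm \<Omega> (\<lambda>x. a * f x - a * \<phi> k x)) \<longlonglongrightarrow> 0"
    using tendsto_mult_right_zero[OF \<phi>(2)] by simp
  then show ?thesis
    unfolding H10_def using H1_cmult(1)[OF assms(1) H10_H1[OF assms(2)]] test_fun_cmult \<phi>(1)
    by (intro conjI exI[of _ "\<lambda>k x. a * \<phi> k x"] allI test_fun_cmult) simp_all
qed

section \<open>Graphs over coordinate hyperplanes\<close>

text \<open>The point of the hyperplane orthogonal to \<open>e\<close> with coordinates \<open>y\<close>; the map that enters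
  \<open>graph_measure\<close>.\<close>

definition emb :: "'a::euclidean_space \<Rightarrow> ('a \<Rightarrow> real) \<Rightarrow> 'a" where
  "emb e y = (\<Sum>b\<in>Basis - {e}. y b *\<^sub>R b)"

abbreviation hyperplane_lborel :: "'a::euclidean_space \<Rightarrow> ('a \<Rightarrow> real) measure" where
  "hyperplane_lborel e \<equiv> Pi\<^sub>M (Basis - {e}) (\<lambda>_. lborel)"

text \<open>Tonelli in the coordinate \<open>e\<close>, in the coordinates used by \<open>graph_measure\<close>.\<close>

lemma nn_integral_lborel_split:
  fixes f :: "'a::euclidean_space \<Rightarrow> ennreal"
  assumes e: "e \<in> Basis" and [measurable]: "f \<in> borel_measurable borel"
  shows "(\<integral>\<^sup>+x. f x \<partial>lborel) =
    (\<integral>\<^sup>+y. (\<integral>\<^sup>+s. f (emb e y + s *\<^sub>R e) \<partial>lborel) \<partial>hyperplane_lborel e)"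
proof -
  interpret product_sigma_finite "\<lambda>_::'a. lborel :: real measure" ..
  have "(\<integral>\<^sup>+x. f x \<partial>lborel) = (\<integral>\<^sup>+y. f (\<Sum>b\<in>Basis. y b *\<^sub>R b) \<partial>Pi\<^sub>M Basis (\<lambda>_. lborel))"
    by (subst lborel_eq) (simp add: nn_integral_distr)
  also have "Basis = insert e (Basis - {e})" using e by auto
  also have "(\<integral>\<^sup>+y. f (\<Sum>b\<in>insert e (Basis - {e}). y b *\<^sub>R b) \<partial>Pi\<^sub>M (insert e (Basis - {e})) (\<lambda>_. lborel))
    = (\<integral>\<^sup>+y. (\<integral>\<^sup>+s. f (\<Sum>b\<in>insert e (Basis - {e}). (y(e := s)) b *\<^sub>R b) \<partial>lborel) \<partial>hyperplane_lborel e)"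
    by (rule product_nn_integral_insert) auto
  finally have "(\<integral>\<^sup>+x. f x \<partial>lborel) = \<dots>" .
  moreover have "(\<Sum>b\<in>insert e (Basis - {e}). (y(e := s)) b *\<^sub>R b) = emb e y + s *\<^sub>R e" for y s
    by (subst sum.insert) (auto simp: emb_def intro!: sum.cong)
  ultimately show ?thesis by simp
qed

lemma emb_inner: "e \<in> Basis \<Longrightarrow> emb e y \<bullet> e = 0"
  by (auto simp: emb_def inner_sum_left inner_Basis intro!: sum.neutral)

lemma drop_coord_emb: "e \<in> Basis \<Longrightarrow> drop_coord e (emb e y + s *\<^sub>R e) = emb e y"
  by (simp add: drop_coord_def inner_add_left emb_inner)

lemma height_emb: "e \<in> Basis \<Longrightarrow> height e \<gamma> (emb e y + s *\<^sub>R e) = s - \<gamma> (emb e y)"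
  by (simp add: height_def drop_coord_emb inner_add_left emb_inner)

lemma emb_measurable [measurable]: "emb e \<in> borel_measurable (hyperplane_lborel e)"
  unfolding emb_def by measurable

lemma continuous_on_height:
  assumes "smooth_on UNIV \<gamma>"
  shows "continuous_on UNIV (height e \<gamma>)"
  unfolding height_def drop_coord_def
  by (intro continuous_intros continuous_on_compose2[OF smooth_on_continuous[OF assms]]) auto

text \<open>Every line in the direction \<open>e\<close> meets the graph in exactly one point.\<close>

lemma negligible_graph:
  assumes e: "e \<in> Basis" and \<gamma>: "smooth_on UNIV \<gamma>"
  shows "negligible {x. height e \<gamma> x = 0}"
proof -
  have c: "closed {x. height e \<gamma> x = 0}"
    using continuous_closed_preimage_constant[OF continuous_on_height[OF \<gamma>], of e 0] by simp
  then have [measurable]: "{x. height e \<gamma> x = 0} \<in> sets borel" by simp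
  have "emeasure lborel {x. height e \<gamma> x = 0} = (\<integral>\<^sup>+x. indicator {x. height e \<gamma> x = 0} x \<partial>lborel)"
    by simp
  also have "\<dots> = (\<integral>\<^sup>+y. (\<integral>\<^sup>+s. indicator {x. height e \<gamma> x = 0} (emb e y + s *\<^sub>R e) \<partial>lborel) \<partial>hyperplane_lborel e)"
    by (rule nn_integral_lborel_split[OF e]) measurable
  also have "\<dots> = (\<integral>\<^sup>+y. (\<integral>\<^sup>+s. indicator {\<gamma> (emb e y)} s \<partial>lborel) \<partial>hyperplane_lborel e)"
    by (intro nn_integral_cong) (auto simp: height_emb[OF e] indicator_def)
  finally have "emeasure lborel {x. height e \<gamma> x = 0} = 0" by simp
  then have "{x. height e \<gamma> x = 0} \<in> null_sets lborel" by (auto simp: null_sets_def)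
  then show ?thesis by (simp add: negligible_iff_null_sets null_sets_completionI)
qed

lemma negligible_locally_graph:
  assumes "\<And>x. x \<in> S \<Longrightarrow> \<exists>U e \<gamma>. open U \<and> x \<in> U \<and> e \<in> Basis \<and> smooth_on UNIV \<gamma> \<and> (\<forall>y\<in>S \<inter> U. height e \<gamma> y = 0)"
  shows "negligible S"
proof (rule locally_negligible_alt[THEN iffD2], rule ballI)
  fix x assume "x \<in> S"
  then have "\<exists>U e \<gamma>. open U \<and> x \<in> U \<and> e \<in> Basis \<and> smooth_on UNIV \<gamma> \<and> (\<forall>y\<in>S \<inter> U. height e \<gamma> y = 0)"
    by (rule assms)
  then obtain U e \<gamma> where U: "open U \<and> x \<in> U \<and> e \<in> Basis \<and> smooth_on UNIV \<gamma> \<and> (\<forall>y\<in>S \<inter> U. height e \<gamma> y = 0)"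
    by (elim exE)
  have "S \<inter> U \<subseteq> {x. height e \<gamma> x = 0}" using U by auto
  then have "negligible (S \<inter> U)"
    using negligible_subset[OF negligible_graph] U by blast
  moreover have "openin (top_of_set S) (S \<inter> U)" using U by (simp add: openin_open_Int)
  ultimately show "\<exists>U. openin (top_of_set S) U \<and> x \<in> U \<and> negligible U"
    using U \<open>x \<in> S\<close> by (intro exI[of _ "S \<inter> U"] conjI IntI) simp_all
qed

lemma negligible_interface:
  assumes "smooth_interface S \<Omega>m \<Omega>p \<nu>"
  shows "negligible S"
proof (rule negligible_locally_graph)
  fix x assume "x \<in> S"
  then obtain U e \<gamma> where "open U" "x \<in> U" "e \<in> Basis" "smooth_on UNIV \<gamma>" "S \<inter> U = {y\<in>U. height e \<gamma> y = 0}"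
    using assms[unfolded smooth_interface_def, THEN bspec, OF \<open>x \<in> S\<close>] by blast
  then show "\<exists>U e \<gamma>. open U \<and> x \<in> U \<and> e \<in> Basis \<and> smooth_on UNIV \<gamma> \<and> (\<forall>y\<in>S \<inter> U. height e \<gamma> y = 0)"
    by blast
qed

text \<open>Where the defining inequality of \<open>M\<close> is strict, \<open>M\<close> is a neighbourhood of the point; so the
  boundary lies in the graphs.\<close>

lemma negligible_frontier_smooth_boundary:
  assumes "closed M" "smooth_boundary M"
  shows "negligible (frontier M)"
proof (rule negligible_locally_graph)
  fix x assume "x \<in> frontier M"
  then obtain U e s \<gamma> where U: "open U" "x \<in> U" "e \<in> Basis" "s \<in> {-1, 1::real}" "smooth_on UNIV \<gamma>"
      "M \<inter> U = {y\<in>U. s * height e \<gamma> y \<ge> 0}"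
    using assms(2)[unfolded smooth_boundary_def, THEN bspec, OF \<open>x \<in> frontier M\<close>]
    by (elim exE conjE) (rule that)
  have "height e \<gamma> y = 0" if y: "y \<in> frontier M \<inter> U" for y
  proof (rule ccontr)
    assume n0: "height e \<gamma> y \<noteq> 0"
    have "y \<in> M" using y assms(1) by (simp add: frontier_def)
    with U(6) y have "s * height e \<gamma> y \<ge> 0" by blast
    with n0 U(4) have pos: "s * height e \<gamma> y > 0" by auto
    have "open {z. s * height e \<gamma> z > 0}"
      using continuous_on_height[OF U(5)]
      by (intro open_Collect_less continuous_intros)
    then have o: "open (U \<inter> {z. s * height e \<gamma> z > 0})" using U(1) by auto
    have "U \<inter> {z. s * height e \<gamma> z > 0} \<subseteq> M \<inter> U"
      unfolding U(6) by auto
    then have "y \<in> interior M"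
      using o pos y by (intro interiorI[of "U \<inter> {z. s * height e \<gamma> z > 0}"]) auto
    then show False using y by (simp add: frontier_def)
  qed
  then show "\<exists>U e \<gamma>. open U \<and> x \<in> U \<and> e \<in> Basis \<and> smooth_on UNIV \<gamma> \<and> (\<forall>y\<in>frontier M \<inter> U. height e \<gamma> y = 0)"
    using U by blast
qed

lemma height_has_derivative:
  assumes "smooth_on UNIV \<gamma>"
  shows "(height e \<gamma> has_derivative (\<lambda>h. h \<bullet> e - pd (drop_coord e h) \<gamma> (drop_coord e x))) (at x)"
proof -
  have "(drop_coord e has_derivative drop_coord e) (at x)"
    unfolding drop_coord_def[abs_def] by (auto intro!: derivative_eq_intros)
  moreover have "(\<gamma> has_derivative (\<lambda>h. pd h \<gamma> (drop_coord e x))) (at (drop_coord e x))"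
    using smooth_on_differentiable[OF assms] by (intro has_derivative_pd) simp
  ultimately have "((\<lambda>x. \<gamma> (drop_coord e x)) has_derivative (\<lambda>h. pd (drop_coord e h) \<gamma> (drop_coord e x))) (at x)"
    using has_derivative_compose[of "drop_coord e" "drop_coord e" x UNIV \<gamma>] by simp
  then show ?thesis
    unfolding height_def[abs_def] by (intro has_derivative_diff) (auto intro!: derivative_eq_intros)
qed

lemma continuous_on_grad_height:
  assumes \<gamma>: "smooth_on UNIV \<gamma>" and e: "e \<in> Basis"
  shows "continuous_on UNIV (grad (height e \<gamma>))"
proof -
  have "continuous_on UNIV (pd b (height e \<gamma>))" if b: "b \<in> Basis" for b
  proof -
    have eq: "pd b (height e \<gamma>) = (\<lambda>x. b \<bullet> e - pd (drop_coord e b) \<gamma> (drop_coord e x))"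
      by (intro ext pd_eqI height_has_derivative[OF \<gamma>])
    have cd: "continuous_on UNIV (drop_coord e)"
      unfolding drop_coord_def[abs_def] by (intro continuous_intros)
    show ?thesis
    proof (cases "b = e")
      case True
      have "pd 0 \<gamma> x = 0" for x
        using pd_expand[OF smooth_on_differentiable[OF \<gamma>], of x 0] by simp
      moreover have "drop_coord e b = 0" using True b by (simp add: drop_coord_def)
      ultimately show ?thesis unfolding eq by simp
    next
      case False
      then have "drop_coord e b = b" using b e by (simp add: drop_coord_def inner_Basis)
      then show ?thesis
        unfolding eq using continuous_on_compose2[OF smooth_on_continuous[OF smooth_on_pd[OF \<gamma> b]] cd]
        by (auto intro!: continuous_intros)
    qed
  qed
  then show ?thesis
    unfolding grad_def[abs_def] by (intro continuous_intros)
qed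

lemma sets_graph_measure [simp, measurable_cong]: "sets (graph_measure e \<gamma>) = sets borel"
  by (simp add: graph_measure_def Let_def)

lemma nn_integral_graph_measure:
  fixes f :: "'a::euclidean_space \<Rightarrow> ennreal"
  assumes e: "e \<in> Basis" and \<gamma>: "smooth_on UNIV \<gamma>" and f[measurable]: "f \<in> borel_measurable borel"
  shows "(\<integral>\<^sup>+x. f x \<partial>graph_measure e \<gamma>) =
    (\<integral>\<^sup>+y. ennreal (norm (grad (height e \<gamma>) (emb e y + \<gamma> (emb e y) *\<^sub>R e))) * f (emb e y + \<gamma> (emb e y) *\<^sub>R e)
       \<partial>hyperplane_lborel e)"
proof -
  have [measurable]: "\<gamma> \<in> borel_measurable borel" "grad (height e \<gamma>) \<in> borel_measurable borel"
    using smooth_on_continuous[OF \<gamma>] continuous_on_grad_height[OF \<gamma> e]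
    by (auto intro: borel_measurable_continuous_onI)
  have [measurable]: "(\<lambda>y. emb e y + \<gamma> (emb e y) *\<^sub>R e) \<in> borel_measurable (hyperplane_lborel e)"
    by measurable
  show ?thesis
    unfolding graph_measure_def Let_def emb_def[symmetric]
    by (subst nn_integral_distr) (simp_all add: nn_integral_density)
qed

section \<open>Traces of functions vanishing on the boundary\<close>

text \<open>Integrate the derivative of \<open>\<phi>\<^sup>2\<close> along the line from the given point to a point beyond the support,
  and use \<open>2 \<bar>\<phi> \<partial>\<^sub>e\<phi>\<bar> \<le> \<phi>\<^sup>2 + (\<partial>\<^sub>e\<phi>)\<^sup>2\<close>.\<close>

lemma test_fun_sq_le_line_integral:
  assumes \<phi>: "test_fun UNIV \<phi>" and e: "e \<in> Basis"
  shows "ennreal ((\<phi> (z + t *\<^sub>R e))\<^sup>2) \<le> (\<integral>\<^sup>+s. ennreal ((\<phi> (z + s *\<^sub>R e))\<^sup>2 + (pd e \<phi> (z + s *\<^sub>R e))\<^sup>2) \<partial>lborel)"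
proof -
  obtain R0 where "R0 > 0" and R0[rule_format]: "\<forall>x. norm x > R0 \<longrightarrow> \<phi> x = 0" "\<forall>x b. norm x > R0 \<longrightarrow> pd b \<phi> x = 0"
    by (rule compact_support_cballE[OF \<phi>])
  \<comment> \<open>far enough to the right of \<open>t\<close> for \<open>z + R e\<close> to lie outside the ball of radius \<open>R0\<close>\<close>
  define R where "R = \<bar>t\<bar> + norm z + R0 + 1"
  have tR: "t \<le> R" using \<open>R0 > 0\<close> norm_ge_zero[of z] unfolding R_def by linarith
  have "norm (R *\<^sub>R e) \<le> norm (z + R *\<^sub>R e) + norm z"
    using norm_triangle_ineq4[of "z + R *\<^sub>R e" z] by simp
  moreover have "norm (R *\<^sub>R e) = R" using e \<open>R0 > 0\<close> by (simp add: R_def)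
  ultimately have "norm (z + R *\<^sub>R e) > R0" unfolding R_def by linarith
  then have pR: "\<phi> (z + R *\<^sub>R e) = 0" by (rule R0(1))
  have diff: "\<phi> differentiable (at x)" for x
    using smooth_on_differentiable[OF test_fun_smooth[OF \<phi>]] by simp
  have line: "continuous_on UNIV (\<lambda>s. z + s *\<^sub>R e)" by (intro continuous_intros)
  have c1: "continuous_on UNIV (\<lambda>s. \<phi> (z + s *\<^sub>R e))"
    by (rule continuous_on_compose2[OF test_fun_continuous[OF \<phi>] line]) simp
  have c2: "continuous_on UNIV (\<lambda>s. pd e \<phi> (z + s *\<^sub>R e))"
    by (rule continuous_on_compose2[OF test_fun_continuous[OF test_fun_pd[OF \<phi> e]] line]) simp
  let ?p = "\<lambda>s. - ((\<phi> (z + s *\<^sub>R e))\<^sup>2)" and ?p' = "\<lambda>s. - (2 * \<phi> (z + s *\<^sub>R e) * pd e \<phi> (z + s *\<^sub>R e))"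
  have d: "(?p has_real_derivative ?p' s) (at s)" for s
    using has_real_derivative_along_line[where x = z and r = s and b = e, OF diff] by (auto intro!: derivative_eq_intros)
  have "continuous_on UNIV ?p'" using c1 c2 by (intro continuous_intros)
  then have cont: "isCont ?p' s" for s by (simp add: continuous_on_eq_continuous_at)
  have "has_bochner_integral lborel (\<lambda>s. ?p' s * indicator {t..R} s) (?p R - ?p t)"
    by (rule has_bochner_integral_FTC_Icc_real[OF tR d cont])
  then have int: "integrable lborel (\<lambda>s. ?p' s * indicator {t..R} s)"
    and eq: "(LINT s|lborel. ?p' s * indicator {t..R} s) = (\<phi> (z + t *\<^sub>R e))\<^sup>2"
    using pR by (auto simp: has_bochner_integral_iff)
  have "ennreal ((\<phi> (z + t *\<^sub>R e))\<^sup>2) = ennreal (norm (LINT s|lborel. ?p' s * indicator {t..R} s))"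
    unfolding eq by simp
  also have "\<dots> \<le> (\<integral>\<^sup>+s. norm (?p' s * indicator {t..R} s) \<partial>lborel)"
    by (rule integral_norm_bound_ennreal[OF int])
  also have "\<dots> \<le> (\<integral>\<^sup>+s. ennreal ((\<phi> (z + s *\<^sub>R e))\<^sup>2 + (pd e \<phi> (z + s *\<^sub>R e))\<^sup>2) \<partial>lborel)"
  proof (intro nn_integral_mono ennreal_leI)
    fix s
    have "norm (?p' s * indicator {t..R} s) \<le> \<bar>?p' s\<bar>" by (auto simp: indicator_def)
    also have "\<dots> \<le> (\<phi> (z + s *\<^sub>R e))\<^sup>2 + (pd e \<phi> (z + s *\<^sub>R e))\<^sup>2"
      using sum_squares_bound[of "\<bar>\<phi> (z + s *\<^sub>R e)\<bar>" "\<bar>pd e \<phi> (z + s *\<^sub>R e)\<bar>"] by (simp add: abs_mult)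
    finally show "norm (?p' s * indicator {t..R} s) \<le> (\<phi> (z + s *\<^sub>R e))\<^sup>2 + (pd e \<phi> (z + s *\<^sub>R e))\<^sup>2" .
  qed
  finally show ?thesis .
qed

text \<open>The line estimate is integrated over the hyperplane; \<open>K\<close> bounds the area density. A test
  function of \<open>D\<close> extends by 0 to the whole space, so the lines may leave \<open>D\<close> and the constant depends
  on the graph only.\<close>

lemma trace_inequality:
  assumes D: "open D" and \<phi>: "test_fun D \<phi>" and e: "e \<in> Basis" and \<gamma>: "smooth_on UNIV \<gamma>"
    and A[measurable]: "A \<in> sets borel" and K: "\<And>x. x \<in> A \<Longrightarrow> norm (grad (height e \<gamma>) x) \<le> K" and K0: "K \<ge> 0"
  shows "(\<integral>\<^sup>+x. ennreal ((\<phi> x)\<^sup>2) * indicator A x \<partial>graph_measure e \<gamma>) \<le> ennreal (K * (H1_norm D \<phi>)\<^sup>2)"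
proof -
  have \<phi>': "test_fun UNIV \<phi>" using \<phi> test_fun_mono by blast
  have [measurable]: "\<phi> \<in> borel_measurable borel" "pd e \<phi> \<in> borel_measurable borel"
    using test_fun_borel[OF \<phi>] test_fun_borel[OF test_fun_pd[OF \<phi> e]] .
  let ?q = "\<lambda>x. (\<phi> x)\<^sup>2 + (pd e \<phi> x)\<^sup>2"
  let ?l = "\<lambda>y. emb e y + \<gamma> (emb e y) *\<^sub>R e"
  have "(\<integral>\<^sup>+x. ennreal ((\<phi> x)\<^sup>2) * indicator A x \<partial>graph_measure e \<gamma>) =
    (\<integral>\<^sup>+y. ennreal (norm (grad (height e \<gamma>) (?l y))) *
       (ennreal ((\<phi> (?l y))\<^sup>2) * indicator A (?l y))
       \<partial>hyperplane_lborel e)"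
    by (rule nn_integral_graph_measure[OF e \<gamma>]) measurable
  also have "\<dots> \<le> (\<integral>\<^sup>+y. ennreal K * (\<integral>\<^sup>+s. ennreal (?q (emb e y + s *\<^sub>R e)) \<partial>lborel) \<partial>hyperplane_lborel e)"
  proof (rule nn_integral_mono)
    fix y :: "'a \<Rightarrow> real"
    let ?x = "?l y"
    show "ennreal (norm (grad (height e \<gamma>) ?x)) * (ennreal ((\<phi> ?x)\<^sup>2) * indicator A ?x)
      \<le> ennreal K * (\<integral>\<^sup>+s. ennreal (?q (emb e y + s *\<^sub>R e)) \<partial>lborel)"
    proof (cases "?x \<in> A")
      case True
      then show ?thesis
        using K[OF True] test_fun_sq_le_line_integral[OF \<phi>' e, of "emb e y" "\<gamma> (emb e y)"]
        by (intro mult_mono ennreal_leI) auto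
    qed simp
  qed
  also have "\<dots> = ennreal K * (\<integral>\<^sup>+y. (\<integral>\<^sup>+s. ennreal (?q (emb e y + s *\<^sub>R e)) \<partial>lborel) \<partial>hyperplane_lborel e)"
    by (rule nn_integral_cmult) measurable
  also have "\<dots> = ennreal K * (\<integral>\<^sup>+x. ennreal (?q x) \<partial>lborel)"
    by (subst nn_integral_lborel_split[OF e, of "\<lambda>x. ennreal (?q x)"]) auto
  also have "(\<integral>\<^sup>+x. ennreal (?q x) \<partial>lborel) = ennreal (LINT x|lebesgue_on D. ?q x)"
  proof -
    have sq: "integrable lebesgue (\<lambda>x. (\<psi> x)\<^sup>2)" if "test_fun D \<psi>" for \<psi>
      using L2_test_fun[OF that, of UNIV] by (simp add: L2_def lebesgue_on_UNIV_eq)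
    have "integrable lebesgue ?q" using sq[OF \<phi>] sq[OF test_fun_pd[OF \<phi> e]] by simp
    then have "integrable lborel ?q" by (simp add: integrable_completion)
    then have "(\<integral>\<^sup>+x. ennreal (?q x) \<partial>lborel) = ennreal (LINT x|lborel. ?q x)"
      by (intro nn_integral_eq_integral) auto
    also have "(LINT x|lborel. ?q x) = (LINT x|lebesgue. ?q x)"
      by (simp add: integral_completion)
    also have "\<dots> = (LINT x|lebesgue_on D. ?q x)"
      using lebesgue_on_support(1)[of D UNIV ?q] D test_fun_eq_0[OF \<phi>] by (simp add: lebesgue_on_UNIV_eq)
    finally show ?thesis .
  qed
  also have "ennreal K * ennreal (LINT x|lebesgue_on D. ?q x) \<le> ennreal (K * (H1_norm D \<phi>)\<^sup>2)"
  proof -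
    have L: "L2 D \<phi>" "L2 D (pd e \<phi>)" using L2_test_fun[OF \<phi>] L2_test_fun[OF test_fun_pd[OF \<phi> e]] D by auto
    have "(LINT x|lebesgue_on D. ?q x) = (L2_norm D \<phi>)\<^sup>2 + (L2_norm D (pd e \<phi>))\<^sup>2"
      unfolding L2_norm_sq using L by (intro Bochner_Integration.integral_add) (auto simp: L2_def)
    also have "\<dots> \<le> (L2_norm D \<phi>)\<^sup>2 + (\<Sum>b\<in>Basis. (L2_norm D (pd b \<phi>))\<^sup>2)"
      using e by (intro add_left_mono member_le_sum) auto
    also have "\<dots> = (H1_norm D \<phi>)\<^sup>2" using H1_test_fun(3)[OF D \<phi>'] by simp
    finally show ?thesis
      using K0 by (simp add: ennreal_mult'[symmetric] mult_left_mono ennreal_leI)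
  qed
  finally show ?thesis .
qed

text \<open>Geometric decay gives convergence almost everywhere: \<open>\<Sum>k. 4^k (\<phi>\<^sub>k\<^sub>+\<^sub>1 - \<phi>\<^sub>k)\<^sup>2\<close> has a finite integral,
  so the increments are bounded by a multiple of \<open>2^-k\<close> at almost every point. The estimate for the
  limit is then Fatou's lemma. The limit is the pointwise one, a function defined without reference to
  the measure, so that several measures can share it.\<close>

lemma fast_Cauchy_imp_L2_limit:
  fixes \<phi> :: "nat \<Rightarrow> 'b \<Rightarrow> real"
  assumes [measurable]: "\<And>k. \<phi> k \<in> borel_measurable M" "A \<in> sets M"
    and C: "\<And>k m. k \<le> m \<Longrightarrow> (\<integral>\<^sup>+x. ennreal ((\<phi> m x - \<phi> k x)\<^sup>2) * indicator A x \<partial>M) \<le> ennreal (C * (1/16) ^ k)"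
    and C0: "C \<ge> 0"
  shows "(\<integral>\<^sup>+x. ennreal ((lim (\<lambda>i. \<phi> i x) - \<phi> k x)\<^sup>2) * indicator A x \<partial>M) \<le> ennreal (C * (1/16) ^ k)"
proof -
  let ?d = "\<lambda>k x. \<phi> (Suc k) x - \<phi> k x"
  let ?s = "\<lambda>x. \<Sum>k. ennreal (4 ^ k) * (ennreal ((?d k x)\<^sup>2) * indicator A x)"
  have "(\<integral>\<^sup>+x. ?s x \<partial>M)
    = (\<Sum>k. \<integral>\<^sup>+x. ennreal (4 ^ k) * (ennreal ((?d k x)\<^sup>2) * indicator A x) \<partial>M)"
    by (rule nn_integral_suminf) measurable
  also have "\<dots> = (\<Sum>k. ennreal (4 ^ k) * (\<integral>\<^sup>+x. ennreal ((?d k x)\<^sup>2) * indicator A x \<partial>M))"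
    by (intro suminf_cong nn_integral_cmult) measurable
  also have "\<dots> \<le> (\<Sum>k. ennreal (C * (1/4) ^ k))"
  proof (intro suminf_le)
    fix k
    have "ennreal (4 ^ k) * (\<integral>\<^sup>+x. ennreal ((?d k x)\<^sup>2) * indicator A x \<partial>M) \<le> ennreal (4 ^ k) * ennreal (C * (1/16) ^ k)"
      by (intro mult_left_mono C) auto
    also have "\<dots> = ennreal (C * (1/4) ^ k)"
      by (simp add: ennreal_mult'[symmetric] power_mult_distrib[symmetric] mult.left_commute)
    finally show "ennreal (4 ^ k) * (\<integral>\<^sup>+x. ennreal ((?d k x)\<^sup>2) * indicator A x \<partial>M) \<le> ennreal (C * (1/4) ^ k)" .
  qed auto
  also have "\<dots> = ennreal (\<Sum>k. C * (1/4) ^ k)"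
    using C0 by (intro suminf_ennreal2) (auto intro!: summable_mult summable_geometric)
  also have "\<dots> < \<infinity>" by simp
  finally have "(\<integral>\<^sup>+x. ?s x \<partial>M) \<noteq> \<infinity>" by simp
  then have AE: "AE x in M. ?s x \<noteq> \<infinity>"
    by (intro nn_integral_noteq_infinite) measurable
  have conv: "convergent (\<lambda>i. \<phi> i x)"
    if fin: "?s x \<noteq> \<infinity>" and x: "x \<in> A" for x
  proof -
    define B where "B = enn2real (?s x)"
    have le: "norm (?d k x) \<le> sqrt B * (1/2) ^ k" for k
    proof -
      have "ennreal (4 ^ k * (?d k x)\<^sup>2) = (\<Sum>k\<in>{k}. ennreal (4 ^ k) * (ennreal ((?d k x)\<^sup>2) * indicator A x))"
        using x by (simp add: ennreal_mult)
      also have "\<dots> \<le> ?s x"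
        by (rule sum_le_suminf) auto
      also have "\<dots> = ennreal B" using fin by (simp add: B_def less_top)
      finally have "4 ^ k * (?d k x)\<^sup>2 \<le> B" by (simp add: B_def ennreal_le_iff)
      then have "sqrt (4 ^ k * (?d k x)\<^sup>2) \<le> sqrt B" by (rule real_sqrt_le_mono)
      moreover have "sqrt (4 ^ k) = (2::real) ^ k"
        by (simp add: real_sqrt_power)
      ultimately have "2 ^ k * \<bar>?d k x\<bar> \<le> sqrt B" by (simp add: real_sqrt_mult)
      then have "\<bar>?d k x\<bar> \<le> sqrt B / 2 ^ k" by (simp add: le_divide_eq mult.commute)
      then show ?thesis by (simp add: power_divide)
    qed
    have "summable (\<lambda>k. sqrt B * (1/2) ^ k)"
      by (intro summable_mult summable_geometric) simp
    then have "summable (\<lambda>k. ?d k x)"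
      by (rule summable_comparison_test'[of _ 0]) (rule le)
    then have "convergent (\<lambda>n. \<Sum>k<n. ?d k x)" by (simp add: summable_iff_convergent)
    then have "convergent (\<lambda>n. \<phi> n x - \<phi> 0 x)"
      by (subst sum_lessThan_telescope[of "\<lambda>k. \<phi> k x", symmetric])
    then have "convergent (\<lambda>n. (\<phi> n x - \<phi> 0 x) + \<phi> 0 x)"
      by (intro convergent_add convergent_const)
    then show ?thesis by simp
  qed
  have "(\<integral>\<^sup>+x. ennreal ((lim (\<lambda>i. \<phi> i x) - \<phi> k x)\<^sup>2) * indicator A x \<partial>M)
    = (\<integral>\<^sup>+x. liminf (\<lambda>m. ennreal ((\<phi> m x - \<phi> k x)\<^sup>2) * indicator A x) \<partial>M)"
  proof (rule nn_integral_cong_AE)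
    show "AE x in M. ennreal ((lim (\<lambda>i. \<phi> i x) - \<phi> k x)\<^sup>2) * indicator A x = liminf (\<lambda>m. ennreal ((\<phi> m x - \<phi> k x)\<^sup>2) * indicator A x)"
      using AE
    proof eventually_elim
      case (elim x)
      show ?case
      proof (cases "x \<in> A")
        case True
        then have "(\<lambda>i. \<phi> i x) \<longlonglongrightarrow> lim (\<lambda>i. \<phi> i x)"
          using conv[OF elim] by (simp add: convergent_LIMSEQ_iff)
        then have "(\<lambda>m. ennreal ((\<phi> m x - \<phi> k x)\<^sup>2)) \<longlonglongrightarrow> ennreal ((lim (\<lambda>i. \<phi> i x) - \<phi> k x)\<^sup>2)"
          by (intro tendsto_ennrealI tendsto_intros)
        from lim_imp_Liminf[OF _ this] show ?thesis using True by simp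
      qed (simp add: Liminf_const)
    qed
  qed
  also have "\<dots> \<le> liminf (\<lambda>m. \<integral>\<^sup>+x. ennreal ((\<phi> m x - \<phi> k x)\<^sup>2) * indicator A x \<partial>M)"
    by (rule nn_integral_liminf) measurable
  also have "\<dots> \<le> ennreal (C * (1/16) ^ k)"
  proof -
    have "liminf (\<lambda>m. \<integral>\<^sup>+x. ennreal ((\<phi> m x - \<phi> k x)\<^sup>2) * indicator A x \<partial>M) \<le> liminf (\<lambda>m. ennreal (C * (1/16) ^ k))"
      by (rule Liminf_mono) (auto simp: eventually_sequentially intro!: exI[of _ k] C)
    then show ?thesis by (simp add: Liminf_const)
  qed
  finally show ?thesis .
qed

lemma test_fun_diff:
  assumes "test_fun \<Omega> \<phi>" "test_fun \<Omega> \<psi>"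
  shows "test_fun \<Omega> (\<lambda>x. \<phi> x - \<psi> x)"
proof (rule test_funI)
  let ?K = "closure {x. \<phi> x \<noteq> 0} \<union> closure {x. \<psi> x \<noteq> 0}"
  show "compact ?K" "?K \<subseteq> \<Omega>" using assms unfolding test_fun_def by auto
  show "\<phi> x - \<psi> x = 0" if "x \<notin> ?K" for x
  proof -
    have "x \<notin> {x. \<phi> x \<noteq> 0}" "x \<notin> {x. \<psi> x \<noteq> 0}"
      using that closure_subset[THEN subsetD] by (meson UnI1 UnI2)+
    then show ?thesis by simp
  qed
  have "Ck_on k UNIV (\<lambda>x. \<phi> x + (- 1) * \<psi> x)" for k
    using test_fun_smooth[OF assms(1)] test_fun_smooth[OF test_fun_cmult[OF assms(2), of "- 1"]]
    unfolding smooth_on_def by (intro Ck_on_add) auto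
  then show "smooth_on UNIV (\<lambda>x. \<phi> x - \<psi> x)" by (simp add: smooth_on_def)
qed

text \<open>A sequence of test functions that approximates \<open>u\<close> geometrically fast converges in \<open>L\<^sup>2\<close> on every
  graph chart of \<open>S\<close> by the trace inequality, always to its pointwise limit \<open>g\<close>. This \<open>g\<close> depends neither
  on the chart nor on \<open>\<Omega>\<close>; in particular the traces from the two sides of \<open>S\<close> agree.\<close>

lemma H10_trace_exists:
  fixes S D :: "'a::euclidean_space set"
  assumes D: "open D" and u: "H10 D u"
    and S: "\<And>x. x \<in> S \<Longrightarrow> \<exists>U e \<gamma>. open U \<and> x \<in> U \<and> e \<in> Basis \<and> smooth_on UNIV \<gamma> \<and> S \<inter> U = {y\<in>U. height e \<gamma> y = 0}"
  shows "\<exists>g. \<forall>\<Omega>. open \<Omega> \<longrightarrow> \<Omega> \<subseteq> D \<longrightarrow> has_trace \<Omega> S u g"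
proof -
  obtain \<psi> where \<psi>: "\<forall>k::nat. test_fun D (\<psi> k)" "(\<lambda>k. H1_norm D (\<lambda>x. u x - \<psi> k x)) \<longlonglongrightarrow> 0"
    using u unfolding H10_def by auto
  \<comment> \<open>Rate 1/4 for the norms is rate 1/16 for their squares.\<close>
  have "\<exists>n. H1_norm D (\<lambda>x. u x - \<psi> n x) < (1/4) ^ k" for k
    using order_tendstoD(2)[OF \<psi>(2), of "(1/4) ^ k"] eventually_happens[of _ sequentially] by fastforce
  then have "\<exists>r. \<forall>k. H1_norm D (\<lambda>x. u x - \<psi> (r k) x) < (1/4) ^ k" by (intro choice allI)
  then obtain r where r: "\<And>k. H1_norm D (\<lambda>x. u x - \<psi> (r k) x) < (1/4) ^ k" by blast
  define \<phi> where "\<phi> k = \<psi> (r k)" for k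
  have \<phi>: "test_fun D (\<phi> k)" "test_fun UNIV (\<phi> k)" for k
    using \<psi>(1) test_fun_mono[of D "\<phi> k" UNIV] by (auto simp: \<phi>_def)
  have H1u: "H1 D (\<lambda>x. u x - \<phi> k x)" for k
    by (intro H1_diff(1) H1_test_fun(1) D H10_H1 u \<phi>)
  have close: "(H1_norm D (\<lambda>x. u x - \<phi> k x))\<^sup>2 \<le> (1/16) ^ k" for k
  proof -
    have "(H1_norm D (\<lambda>x. u x - \<phi> k x))\<^sup>2 \<le> ((1/4) ^ k)\<^sup>2"
      using r[of k] H1_norm_nonneg by (intro power_mono) (auto simp: \<phi>_def intro: less_imp_le)
    also have "\<dots> = (1/16) ^ k" by (simp add: power2_eq_square power_mult_distrib[symmetric])
    finally show ?thesis .
  qed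
  have lim: "(\<lambda>k. H1_norm D (\<lambda>x. u x - \<phi> k x)) \<longlonglongrightarrow> 0"
  proof (rule tendsto_sandwich[OF _ _ tendsto_const])
    show "(\<lambda>k. (1/4::real) ^ k) \<longlonglongrightarrow> 0" by (rule LIMSEQ_power_zero) simp
    show "\<forall>\<^sub>F k in sequentially. 0 \<le> H1_norm D (\<lambda>x. u x - \<phi> k x)"
      by (intro always_eventually allI H1_norm_nonneg)
    show "\<forall>\<^sub>F k in sequentially. H1_norm D (\<lambda>x. u x - \<phi> k x) \<le> (1/4) ^ k"
      using r by (intro always_eventually allI less_imp_le) (simp add: \<phi>_def)
  qed
  have Cauchy: "(H1_norm D (\<lambda>x. \<phi> m x - \<phi> k x))\<^sup>2 \<le> 4 * (1/16) ^ k" if "k \<le> m" for k m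
  proof -
    have "(H1_norm D (\<lambda>x. (u x - \<phi> k x) - (u x - \<phi> m x)))\<^sup>2 \<le> 2 * (1/16) ^ k + 2 * (1/16) ^ m"
      using H1_diff(3)[OF D H1u[of k] H1u[of m]] close[of k] close[of m] by linarith
    moreover have "(1/16::real) ^ m \<le> (1/16) ^ k" using that by (intro power_decreasing) auto
    ultimately have "(H1_norm D (\<lambda>x. (u x - \<phi> k x) - (u x - \<phi> m x)))\<^sup>2 \<le> 4 * (1/16) ^ k" by linarith
    then show ?thesis by simp
  qed
  define g where "g x = lim (\<lambda>k. \<phi> k x)" for x
  have \<phi>_meas: "\<phi> k \<in> borel_measurable borel" for k using test_fun_borel[OF \<phi>(1)] .
  have g_meas: "g \<in> borel_measurable borel"
    unfolding g_def by (rule borel_measurable_lim_metric) (rule \<phi>_meas)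
  have "has_trace \<Omega> S u g" if \<Omega>: "open \<Omega>" "\<Omega> \<subseteq> D" for \<Omega>
    unfolding has_trace_def
  proof (intro conjI ballI)
    show "H1 \<Omega> u" by (rule H1_subset(1)[OF D \<Omega> H10_H1[OF u]])
    show "g \<in> borel_measurable borel" by (rule g_meas)
    fix x assume x: "x \<in> S"
    obtain U' e \<gamma> where U': "open U'" "x \<in> U'" and e: "e \<in> Basis" and \<gamma>: "smooth_on UNIV \<gamma>"
        and SU': "S \<inter> U' = {y\<in>U'. height e \<gamma> y = 0}"
      using S[OF x] by blast
    \<comment> \<open>On a bounded neighbourhood the density of the surface measure is bounded.\<close>
    define U where "U = U' \<inter> ball x 1"
    have U: "open U" "x \<in> U" using U' by (auto simp: U_def)
    have SU: "S \<inter> U = {y\<in>U. height e \<gamma> y = 0}" using SU' by (auto simp: U_def)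
    have "{y. height e \<gamma> y = 0} \<in> sets borel"
      using continuous_closed_preimage_constant[OF continuous_on_height[OF \<gamma>], of e 0] by simp
    moreover have "S \<inter> U = U \<inter> {y. height e \<gamma> y = 0}" using SU by auto
    ultimately have SU_borel: "S \<inter> U \<in> sets borel" using U(1) by simp
    have "compact (grad (height e \<gamma>) ` cball x 1)"
      using continuous_on_subset[OF continuous_on_grad_height[OF \<gamma> e] subset_UNIV] by (intro compact_continuous_image) auto
    then have "\<exists>K>0. \<forall>z\<in>grad (height e \<gamma>) ` cball x 1. norm z \<le> K"
      using compact_imp_bounded bounded_pos by blast
    then obtain K where K: "K > 0" "\<forall>z\<in>grad (height e \<gamma>) ` cball x 1. norm z \<le> K" by blast
    have KU: "norm (grad (height e \<gamma>) y) \<le> K" if "y \<in> S \<inter> U" for y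
      using that K(2) by (auto simp: U_def)
    let ?J = "\<lambda>k. \<integral>\<^sup>+y. ennreal ((g y - \<phi> k y)\<^sup>2) * indicator (S \<inter> U) y \<partial>graph_measure e \<gamma>"
    have bound: "?J k \<le> ennreal (4 * K * (1/16) ^ k)" for k
      unfolding g_def
    proof (rule fast_Cauchy_imp_L2_limit)
      show "\<phi> k \<in> borel_measurable (graph_measure e \<gamma>)" for k
        using \<phi>_meas[of k] by (simp cong: measurable_cong_sets)
      fix k m :: nat assume "k \<le> m"
      have "(\<integral>\<^sup>+y. ennreal ((\<phi> m y - \<phi> k y)\<^sup>2) * indicator (S \<inter> U) y \<partial>graph_measure e \<gamma>) \<le> ennreal (K * (H1_norm D (\<lambda>x. \<phi> m x - \<phi> k x))\<^sup>2)"
        by (rule trace_inequality[OF D test_fun_diff[OF \<phi>(1) \<phi>(1)] e \<gamma> SU_borel KU]) (use K in auto)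
      also have "\<dots> \<le> ennreal (4 * K * (1/16) ^ k)"
        using mult_left_mono[OF Cauchy[OF \<open>k \<le> m\<close>], of K] K(1) by (intro ennreal_leI) simp
      finally show "(\<integral>\<^sup>+y. ennreal ((\<phi> m y - \<phi> k y)\<^sup>2) * indicator (S \<inter> U) y \<partial>graph_measure e \<gamma>) \<le> ennreal (4 * K * (1/16) ^ k)" .
    qed (use SU_borel K in auto)
    have t1: "(\<lambda>k. \<integral>\<^sup>+y. ennreal ((g y - \<phi> k y)\<^sup>2) * indicator (S \<inter> U) y \<partial>graph_measure e \<gamma>) \<longlonglongrightarrow> 0"
    proof (rule tendsto_sandwich[OF _ _ tendsto_const])
      have "(\<lambda>k. 4 * K * (1/16) ^ k) \<longlonglongrightarrow> 4 * K * 0"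
        by (intro tendsto_mult_left LIMSEQ_power_zero) simp
      then show "(\<lambda>k. ennreal (4 * K * (1/16) ^ k)) \<longlonglongrightarrow> 0"
        using tendsto_ennrealI by fastforce
      show "\<forall>\<^sub>F k in sequentially. ?J k \<le> ennreal (4 * K * (1/16) ^ k)"
        by (intro always_eventually allI bound)
    qed simp
    have t2: "(\<lambda>k. H1_norm (\<Omega> \<inter> U) (\<lambda>y. u y - \<phi> k y)) \<longlonglongrightarrow> 0"
    proof (rule tendsto_sandwich[OF _ _ tendsto_const lim])
      show "\<forall>\<^sub>F k in sequentially. H1_norm (\<Omega> \<inter> U) (\<lambda>y. u y - \<phi> k y) \<le> H1_norm D (\<lambda>y. u y - \<phi> k y)"
        using \<Omega> U(1) by (intro always_eventually allI H1_subset(2)[OF D _ _ H1u]) auto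
    qed (auto intro!: always_eventually H1_norm_nonneg)
    show "\<exists>U e \<gamma>. open U \<and> x \<in> U \<and> e \<in> Basis \<and> smooth_on UNIV \<gamma> \<and> S \<inter> U = {y \<in> U. height e \<gamma> y = 0} \<and>
        (\<exists>\<phi>::nat \<Rightarrow> 'a \<Rightarrow> real. (\<forall>k. test_fun UNIV (\<phi> k)) \<and>
           (\<lambda>k. H1_norm (\<Omega> \<inter> U) (\<lambda>y. u y - \<phi> k y)) \<longlonglongrightarrow> 0 \<and>
           (\<lambda>k. \<integral>\<^sup>+y. ennreal ((g y - \<phi> k y)\<^sup>2) * indicator (S \<inter> U) y \<partial>graph_measure e \<gamma>) \<longlonglongrightarrow> 0)"
      using U e \<gamma> SU \<phi>(2) t1 t2 by (intro exI conjI) (assumption | rule allI)+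
  qed
  then show ?thesis by blast
qed

section \<open>Products of a function of time and a function of space\<close>

lemma borel_fst_snd:
  "(fst :: real \<times> 'a::euclidean_space \<Rightarrow> real) \<in> borel_measurable borel"
  "(snd :: real \<times> 'a::euclidean_space \<Rightarrow> 'a) \<in> borel_measurable borel"
  by (intro borel_measurable_continuous_onI continuous_intros)+

text \<open>Measurability for the completed measures needs that preimages of null sets are null.\<close>

lemma measurable_snd_lebesgue:
  "(snd :: real \<times> 'a::euclidean_space \<Rightarrow> 'a) \<in> lebesgue \<rightarrow>\<^sub>M lebesgue"
proof (rule completion.measurable_completion2)
  show s: "(snd :: real \<times> 'a \<Rightarrow> 'a) \<in> lebesgue \<rightarrow>\<^sub>M lborel"
    using borel_fst_snd(2) by (intro measurable_completion) simp
  show "null_sets lborel \<subseteq> null_sets (distr lebesgue lborel (snd :: real \<times> 'a \<Rightarrow> 'a))"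
  proof
    fix N :: "'a set" assume N: "N \<in> null_sets lborel"
    then have N': "N \<in> sets borel" "emeasure lborel N = 0" by (auto simp: null_sets_def)
    have m: "snd -` N \<in> sets (borel :: (real \<times> 'a) measure)"
      using measurable_sets[OF borel_fst_snd(2) N'(1)] by simp
    have "emeasure lebesgue (snd -` N :: (real \<times> 'a) set) = emeasure (lborel \<Otimes>\<^sub>M lborel) ((UNIV :: real set) \<times> N)"
      using m by (simp add: lborel_prod vimage_snd emeasure_completion)
    also have "\<dots> = 0" using N' by (subst lborel.emeasure_pair_measure_Times) auto
    finally show "N \<in> null_sets (distr lebesgue lborel (snd :: real \<times> 'a \<Rightarrow> 'a))"
      using N' s by (simp add: null_sets_def emeasure_distr)
  qed
qed

lemma AE_lebesgue_snd:
  assumes "AE x in lebesgue. P (x :: 'a::euclidean_space)"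
  shows "AE z in (lebesgue :: (real \<times> 'a) measure). P (snd z)"
proof -
  have "AE x in lborel. P x" using assms by (simp add: AE_completion_iff)
  then obtain N where N: "N \<in> null_sets lborel" "{x. \<not> P x} \<subseteq> N"
    by (auto simp: eventually_ae_filter)
  have "emeasure (lborel \<Otimes>\<^sub>M lborel) ((UNIV :: real set) \<times> N) = 0"
    using N(1) by (subst lborel.emeasure_pair_measure_Times) (auto simp: null_sets_def)
  then have "(UNIV :: real set) \<times> N \<in> null_sets lborel"
    using N(1) by (auto simp: null_sets_def lborel_prod[symmetric])
  then have "AE z in (lborel :: (real \<times> 'a) measure). P (snd z)"
    by (rule AE_I') (use N(2) in auto)
  then show ?thesis by (rule AE_completion)
qed

lemma nn_integral_lebesgue_product:
  fixes g :: "'a::euclidean_space \<Rightarrow> ennreal" and f :: "real \<Rightarrow> ennreal"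
  assumes f[measurable]: "f \<in> borel_measurable borel" and g: "g \<in> borel_measurable lebesgue"
  shows "(\<integral>\<^sup>+z. f (fst z) * g (snd z) \<partial>lebesgue) = (\<integral>\<^sup>+t. f t \<partial>lborel) * (\<integral>\<^sup>+x. g x \<partial>lebesgue)"
proof -
  obtain g' where g'[measurable]: "g' \<in> borel_measurable lborel" and eq: "AE x in lborel. g x = g' x"
    using completion_ex_borel_measurable[OF g] by auto
  have eq': "AE x in lebesgue. g x = g' x" using eq by (rule AE_completion)
  have "(\<integral>\<^sup>+z. f (fst z) * g (snd z) \<partial>lebesgue) = (\<integral>\<^sup>+z. f (fst z) * g' (snd z) \<partial>lebesgue)"
    using AE_lebesgue_snd[OF eq'] by (intro nn_integral_cong_AE) auto
  also have "\<dots> = (\<integral>\<^sup>+z. f (fst z) * g' (snd z) \<partial>(lborel \<Otimes>\<^sub>M lborel))"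
    by (simp add: nn_integral_completion lborel_prod)
  also have "\<dots> = (\<integral>\<^sup>+t. \<integral>\<^sup>+x. f t * g' x \<partial>lborel \<partial>lborel)"
    by (subst lborel.nn_integral_fst[symmetric]) auto
  also have "\<dots> = (\<integral>\<^sup>+t. f t \<partial>lborel) * (\<integral>\<^sup>+x. g' x \<partial>lborel)"
    by (simp add: nn_integral_cmult nn_integral_multc)
  also have "(\<integral>\<^sup>+x. g' x \<partial>lborel) = (\<integral>\<^sup>+x. g x \<partial>lebesgue)"
    using eq' by (subst nn_integral_completion[symmetric]) (intro nn_integral_cong_AE, auto)
  finally show ?thesis .
qed

lemma L2_time_product:
  fixes u :: "'a::euclidean_space \<Rightarrow> real" and a :: "real \<Rightarrow> real"
  assumes a: "a \<in> borel_measurable borel" "\<And>t. \<bar>a t\<bar> \<le> 1" and T: "T > 0"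
    and \<omega>: "\<omega> \<in> sets lebesgue" and u: "L2 \<omega> u"
  shows "L2 ({0<..<T} \<times> \<omega>) (\<lambda>(t, x). a t * u x)"
    and "L2_norm ({0<..<T} \<times> \<omega>) (\<lambda>(t, x). a t * u x) \<le> sqrt T * L2_norm \<omega> u"
proof -
  let ?P = "{0<..<T} \<times> \<omega>"
  define A where "A t = indicator {0<..<T} t * a t" for t
  define U where "U x = (if x \<in> \<omega> then u x else 0)" for x
  define h where "h z = A (fst z) * U (snd z)" for z
  have [measurable]: "A \<in> borel_measurable borel" unfolding A_def using a(1) by measurable
  have U: "U \<in> borel_measurable lebesgue"
    unfolding U_def using u \<omega> by (intro borel_measurable_if_I) (auto simp: L2_def)
  have h: "h = (\<lambda>z. if z \<in> ?P then (case z of (t, x) \<Rightarrow> a t * u x) else 0)"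
    by (auto simp: h_def A_def U_def indicator_def fun_eq_iff)
  have P: "?P \<in> sets lebesgue"
  proof -
    have "fst -` {0<..<T} \<in> sets (borel :: (real \<times> 'a) measure)"
      using measurable_sets[OF borel_fst_snd(1), of "{0<..<T}"] by simp
    moreover have "snd -` \<omega> \<in> sets (lebesgue :: (real \<times> 'a) measure)"
      using measurable_sets[OF measurable_snd_lebesgue \<omega>] by simp
    ultimately have "fst -` {0<..<T} \<inter> snd -` \<omega> \<in> sets (lebesgue :: (real \<times> 'a) measure)" by auto
    moreover have "fst -` {0<..<T} \<inter> snd -` \<omega> = ?P" by auto
    ultimately show ?thesis by simp
  qed
  have "(\<lambda>z. A (fst z)) \<in> borel_measurable (lebesgue :: (real \<times> 'a) measure)"
    by (intro borel_measurable_lebesgueI measurable_compose[OF borel_fst_snd(1)]) measurable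
  moreover have "(\<lambda>z. U (snd z)) \<in> borel_measurable (lebesgue :: (real \<times> 'a) measure)"
    by (rule measurable_compose[OF measurable_snd_lebesgue U])
  ultimately have hm: "h \<in> borel_measurable lebesgue" unfolding h_def by (rule borel_measurable_times)
  have Usq: "integrable lebesgue (\<lambda>x. (U x)\<^sup>2)" and Uint: "(LINT x|lebesgue. (U x)\<^sup>2) = (L2_norm \<omega> u)\<^sup>2"
  proof -
    have "(\<lambda>x. (U x)\<^sup>2) = (\<lambda>x. if x \<in> \<omega> then (u x)\<^sup>2 else 0)" by (auto simp: U_def)
    then show "integrable lebesgue (\<lambda>x. (U x)\<^sup>2)" "(LINT x|lebesgue. (U x)\<^sup>2) = (L2_norm \<omega> u)\<^sup>2"
      using u \<omega> by (simp_all add: L2_def Lebesgue_Measure.integrable_restrict_UNIV Lebesgue_Measure.integral_restrict_UNIV L2_norm_sq)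
  qed
  have "(\<integral>\<^sup>+z. ennreal ((h z)\<^sup>2) \<partial>lebesgue) = (\<integral>\<^sup>+z. ennreal ((A (fst z))\<^sup>2) * ennreal ((U (snd z))\<^sup>2) \<partial>lebesgue)"
    unfolding h_def by (simp add: power_mult_distrib ennreal_mult)
  also have "\<dots> = (\<integral>\<^sup>+t. ennreal ((A t)\<^sup>2) \<partial>lborel) * (\<integral>\<^sup>+x. ennreal ((U x)\<^sup>2) \<partial>lebesgue)"
    by (rule nn_integral_lebesgue_product) (use U in measurable)
  also have "\<dots> \<le> ennreal T * ennreal ((L2_norm \<omega> u)\<^sup>2)"
  proof (rule mult_mono)
    have "(\<integral>\<^sup>+t. ennreal ((A t)\<^sup>2) \<partial>lborel) \<le> (\<integral>\<^sup>+t. indicator {0<..<T} t \<partial>lborel)"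
      using a(2) by (intro nn_integral_mono) (auto simp: A_def indicator_def abs_square_le_1)
    also have "\<dots> = ennreal T" using T by simp
    finally show "(\<integral>\<^sup>+t. ennreal ((A t)\<^sup>2) \<partial>lborel) \<le> ennreal T" .
    show "(\<integral>\<^sup>+x. ennreal ((U x)\<^sup>2) \<partial>lebesgue) \<le> ennreal ((L2_norm \<omega> u)\<^sup>2)"
      using nn_integral_eq_integral[OF Usq] Uint by simp
  qed auto
  finally have bound: "(\<integral>\<^sup>+z. ennreal ((h z)\<^sup>2) \<partial>lebesgue) \<le> ennreal (T * (L2_norm \<omega> u)\<^sup>2)"
    using T by (simp add: ennreal_mult)
  then have int: "integrable lebesgue (\<lambda>z. (h z)\<^sup>2)"
    using hm by (intro integrableI_nonneg) (auto simp: le_less_trans)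
  have h2: "(\<lambda>z. (h z)\<^sup>2) = (\<lambda>z. if z \<in> ?P then (case z of (t, x) \<Rightarrow> a t * u x)\<^sup>2 else 0)"
    by (auto simp: h)
  show "L2 ?P (\<lambda>(t, x). a t * u x)"
    unfolding L2_def
    using int P borel_measurable_if_D[OF hm[unfolded h]] unfolding h2 by (simp add: Lebesgue_Measure.integrable_restrict_UNIV)
  have "(L2_norm ?P (\<lambda>(t, x). a t * u x))\<^sup>2 = (LINT z|lebesgue. (h z)\<^sup>2)"
    unfolding h2 L2_norm_sq using P by (simp add: Lebesgue_Measure.integral_restrict_UNIV)
  also have "\<dots> \<le> T * (L2_norm \<omega> u)\<^sup>2"
  proof -
    have "ennreal (LINT z|lebesgue. (h z)\<^sup>2) \<le> ennreal (T * (L2_norm \<omega> u)\<^sup>2)"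
      using bound nn_integral_eq_integral[OF int] by simp
    then show ?thesis using T by (subst (asm) ennreal_le_iff) auto
  qed
  also have "\<dots> = (sqrt T * L2_norm \<omega> u)\<^sup>2" using T by (simp add: power_mult_distrib)
  finally show "L2_norm ?P (\<lambda>(t, x). a t * u x) \<le> sqrt T * L2_norm \<omega> u"
    by (rule power2_le_imp_le) (use T in \<open>simp add: L2_norm_nonneg\<close>)
qed

section \<open>Derivatives in time\<close>

lemma at_within_Icc_nontrivial: "0 < T \<Longrightarrow> t \<in> {0..T} \<Longrightarrow> at t within {0..T::real} \<noteq> bot"
  using islimpt_Icc[of 0 T t] by (simp add: trivial_limit_within)

text \<open>The function \<open>time_deriv\<close> is an arbitrary choice; limits in \<open>L\<^sup>2\<close> are unique almost everywhere.\<close>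

lemma has_time_deriv_unique:
  assumes T: "0 < T" "t \<in> {0..T}" and w: "\<And>s. s \<in> {0..T} \<Longrightarrow> L2 D (w s)"
    and v: "has_time_deriv D T w t v" and v': "has_time_deriv D T w t v'"
  shows "AE x in lebesgue_on D. v x = v' x"
proof -
  have L: "L2 D v" "L2 D v'" using v v' by (auto simp: has_time_deriv_def)
  let ?q = "\<lambda>s x. (w s x - w t x) / (s - t)"
  let ?b = "\<lambda>s. 2 * (L2_norm D (\<lambda>x. ?q s x - v' x))\<^sup>2 + 2 * (L2_norm D (\<lambda>x. ?q s x - v x))\<^sup>2"
  have q: "L2 D (?q s)" if "s \<in> {0..T}" for s
    using L2_cmult[OF L2_diff[OF w[OF that] w[OF T(2)]], of "1 / (s - t)"] by simp
  have "\<forall>\<^sub>F s in at t within {0..T}. (L2_norm D (\<lambda>x. v x - v' x))\<^sup>2 \<le>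
      ?b s"
    unfolding eventually_at_filter
  proof (intro always_eventually allI impI)
    fix s assume "s \<in> {0..T}"
    from L2_norm_diff_sq[OF L2_diff[OF q[OF this] L(2)] L2_diff[OF q[OF this] L(1)]]
    show "(L2_norm D (\<lambda>x. v x - v' x))\<^sup>2 \<le> ?b s"
      by simp
  qed
  moreover have "((\<lambda>s. ?b s) \<longlongrightarrow> 2 * 0\<^sup>2 + 2 * 0\<^sup>2) (at t within {0..T})"
    using v v' unfolding has_time_deriv_def by (intro tendsto_intros) auto
  ultimately have "(L2_norm D (\<lambda>x. v x - v' x))\<^sup>2 \<le> 2 * 0\<^sup>2 + 2 * 0\<^sup>2"
    using at_within_Icc_nontrivial[OF T] by (intro tendsto_le[OF _ _ tendsto_const]) auto
  then have "L2_norm D (\<lambda>x. v x - v' x) = 0" by simp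
  from L2_norm_eq_0_imp[OF L2_diff[OF L] this] show ?thesis by simp
qed

lemma has_time_deriv_product:
  assumes u: "L2 D u" and a: "(a has_real_derivative d) (at t)"
  shows "has_time_deriv D T (\<lambda>t x. a t * u x) t (\<lambda>x. d * u x)"
  unfolding has_time_deriv_def
proof
  show "L2 D (\<lambda>x. d * u x)" by (rule L2_cmult[OF u])
  have eq: "L2_norm D (\<lambda>x. (a s * u x - a t * u x) / (s - t) - d * u x)
     = \<bar>(a s - a t) / (s - t) - d\<bar> * L2_norm D u" for s
    unfolding L2_norm_cmult[symmetric] by (simp add: algebra_simps diff_divide_distrib)
  have "((\<lambda>s. (a s - a t) / (s - t)) \<longlongrightarrow> d) (at t within {0..T})"
    using has_field_derivative_at_within[OF a] by (simp add: has_field_derivative_iff)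
  then have "((\<lambda>s. \<bar>(a s - a t) / (s - t) - d\<bar> * L2_norm D u) \<longlongrightarrow> \<bar>d - d\<bar> * L2_norm D u) (at t within {0..T})"
    by (intro tendsto_intros)
  then show "((\<lambda>s. L2_norm D (\<lambda>x. (a s * u x - a t * u x) / (s - t) - d * u x)) \<longlongrightarrow> 0) (at t within {0..T})"
    unfolding eq by simp
qed

lemma time_deriv_product:
  assumes u: "L2 D u" and a: "\<And>t. (a has_real_derivative a' t) (at t)" and T: "0 < T" "t \<in> {0..T}"
  shows "L2 D (time_deriv D T (\<lambda>t x. a t * u x) t)"
    and "AE x in lebesgue_on D. time_deriv D T (\<lambda>t x. a t * u x) t x = a' t * u x"
proof -
  have 1: "has_time_deriv D T (\<lambda>t x. a t * u x) t (time_deriv D T (\<lambda>t x. a t * u x) t)"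
    unfolding time_deriv_def using has_time_deriv_product[OF u a]
    by (intro someI_ex[of "has_time_deriv D T (\<lambda>t x. a t * u x) t"] exI)
  then show "L2 D (time_deriv D T (\<lambda>t x. a t * u x) t)" by (simp add: has_time_deriv_def)
  show "AE x in lebesgue_on D. time_deriv D T (\<lambda>t x. a t * u x) t x = a' t * u x"
    by (rule has_time_deriv_unique[OF T _ 1 has_time_deriv_product[OF u a]]) (rule L2_cmult[OF u])
qed

text \<open>Differences in time are scalar multiples of the fixed function \<open>u\<close>, so continuity in each of the
  norms reduces to continuity of \<open>a\<close> and \<open>a'\<close>.\<close>

lemma finite_energy_product:
  assumes D: "open D" and u: "H10 D u" and a: "\<And>t. (a has_real_derivative a' t) (at t)"
    and a': "continuous_on UNIV a'" and a1: "\<And>t. \<bar>a t\<bar> \<le> 1" and T: "0 < T"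
  shows "finite_energy D T (\<lambda>t x. a t * u x)"
  unfolding finite_energy_def
proof (intro conjI ballI)
  let ?v = "time_deriv D T (\<lambda>t x. a t * u x)"
  have H1: "H1 D u" and L: "L2 D u" using H10_H1[OF u] H1_L2 by auto
  have ca: "continuous_on UNIV a" using a DERIV_isCont continuous_at_imp_continuous_on by blast
  show "L2 ({0<..<T} \<times> D) (\<lambda>(t, x). a t * u x)"
    using D by (intro L2_time_product(1) borel_measurable_continuous_onI ca a1 T L) auto
  fix t assume t: "t \<in> {0..T}"
  show "H10 D (\<lambda>x. a t * u x)" by (rule H10_cmult[OF D u])
  show "\<exists>v. has_time_deriv D T (\<lambda>t x. a t * u x) t v" using has_time_deriv_product[OF L a] by blast
  have tend: "((\<lambda>s. \<bar>f s - f t\<bar> * C) \<longlongrightarrow> 0) (at t within {0..T})" if "continuous_on UNIV f" for f :: "real \<Rightarrow> real" and C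
  proof -
    have "(f \<longlongrightarrow> f t) (at t within {0..T})"
      using that continuous_on_subset[OF that, of "{0..T}"] t by (auto simp: continuous_on_def)
    then have "((\<lambda>s. \<bar>f s - f t\<bar> * C) \<longlongrightarrow> \<bar>f t - f t\<bar> * C) (at t within {0..T})"
      by (intro tendsto_intros)
    then show ?thesis by simp
  qed
  have "H1_norm D (\<lambda>x. a s * u x - a t * u x) = \<bar>a s - a t\<bar> * H1_norm D u" for s
    using H1_cmult(2)[OF D H1, of "a s - a t"] by (simp add: left_diff_distrib)
  then show "((\<lambda>s. H1_norm D (\<lambda>x. a s * u x - a t * u x)) \<longlongrightarrow> 0) (at t within {0..T})"
    using tend[OF ca] by simp
  have eq: "L2_norm D (\<lambda>x. ?v s x - ?v t x) = \<bar>a' s - a' t\<bar> * L2_norm D u"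
    if s: "s \<in> {0..T}" for s
  proof -
    have "L2_norm D (\<lambda>x. ?v s x - ?v t x) = L2_norm D (\<lambda>x. (a' s - a' t) * u x)"
    proof (rule L2_norm_cong_AE)
      show "AE x in lebesgue_on D. ?v s x - ?v t x = (a' s - a' t) * u x"
        using time_deriv_product(2)[of D u a a' T s, OF L a T s] time_deriv_product(2)[of D u a a' T t, OF L a T t]
        by eventually_elim (simp add: left_diff_distrib)
    qed (intro L2_diff L2_cmult L time_deriv_product(1)[OF L a T] s t)+
    then show ?thesis by (simp add: L2_norm_cmult)
  qed
  show "((\<lambda>s. L2_norm D (\<lambda>x. ?v s x - ?v t x)) \<longlongrightarrow> 0) (at t within {0..T})"
    by (rule Lim_transform_eventually[OF tend[OF a', of "L2_norm D u"]])
      (simp add: eventually_at_filter eq)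
qed

section \<open>Integration in time\<close>

lemma L2_integrable:
  fixes g :: "'a::euclidean_space \<Rightarrow> real"
  assumes "L2 \<Omega> g" "\<Omega> \<in> lmeasurable"
  shows "integrable (lebesgue_on \<Omega>) g"
proof (rule Bochner_Integration.integrable_bound)
  have "integrable (lebesgue_on \<Omega>) (\<lambda>x. 1::real)"
    by (rule finite_measure.integrable_const[OF finite_measure_lebesgue_on[OF assms(2)]])
  then show "integrable (lebesgue_on \<Omega>) (\<lambda>x. 1 + (g x)\<^sup>2)" using assms(1) by (simp add: L2_def)
  have "\<bar>g x\<bar> \<le> 1 + (g x)\<^sup>2" for x
    using sum_squares_bound[of "\<bar>g x\<bar>" 1] by simp
  then show "AE x in lebesgue_on \<Omega>. norm (g x) \<le> norm (1 + (g x)\<^sup>2)" by (auto intro!: AE_I2)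
qed (rule L2_measurable[OF assms(1)])

lemma test_fun_slice_borel:
  fixes \<psi> :: "real \<times> 'a::euclidean_space \<Rightarrow> real"
  assumes "test_fun W \<psi>"
  shows "(\<lambda>x. \<psi> (t, x)) \<in> borel_measurable borel"
  using test_fun_borel[OF assms] by measurable

lemma integrable_mult_slice:
  fixes \<psi> :: "real \<times> 'a::euclidean_space \<Rightarrow> real"
  assumes g: "integrable (lebesgue_on \<Omega>) g" and \<psi>: "test_fun W \<psi>"
  shows "integrable (lebesgue_on \<Omega>) (\<lambda>x. g x * \<psi> (t, x))"
proof -
  obtain B where "B > 0" and B[rule_format]: "\<forall>z. \<bar>\<psi> z\<bar> \<le> B" by (rule test_fun_boundedE[OF \<psi>])
  show ?thesis
  proof (rule Bochner_Integration.integrable_bound)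
    show "integrable (lebesgue_on \<Omega>) (\<lambda>x. B * \<bar>g x\<bar>)" using g by simp
    show "(\<lambda>x. g x * \<psi> (t, x)) \<in> borel_measurable (lebesgue_on \<Omega>)"
      using borel_measurable_integrable[OF g] borel_measurable_lebesgue_onI[OF test_fun_slice_borel[OF \<psi>]]
      by (rule borel_measurable_times)
    have "norm (g x * \<psi> (t, x)) \<le> norm (B * \<bar>g x\<bar>)" for x
      using B[of "(t, x)"] \<open>B > 0\<close> by (simp add: abs_mult mult.commute[of B] mult_left_mono)
    then show "AE x in lebesgue_on \<Omega>. norm (g x * \<psi> (t, x)) \<le> norm (B * \<bar>g x\<bar>)" by (intro AE_I2)
  qed
qed

lemma Basis_time: "(1, 0) \<in> (Basis :: (real \<times> 'a::euclidean_space) set)"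
  by (simp add: Basis_prod_def)

text \<open>Differentiation under the integral sign; the difference quotients are dominated because
  the time derivative of a test function is bounded.\<close>

lemma has_derivative_integral_slice:
  fixes \<psi> :: "real \<times> 'a::euclidean_space \<Rightarrow> real"
  assumes g: "integrable (lebesgue_on \<Omega>) g" and \<psi>: "test_fun W \<psi>"
  shows "((\<lambda>t. LINT x|lebesgue_on \<Omega>. g x * \<psi> (t, x)) has_real_derivative
     (LINT x|lebesgue_on \<Omega>. g x * pd (1, 0) \<psi> (t, x))) (at t)"
  unfolding DERIV_def tendsto_at_iff_sequentially
proof (intro allI impI)
  fix h :: "nat \<Rightarrow> real" assume "\<forall>i. h i \<in> UNIV - {0}" and h0: "h \<longlonglongrightarrow> 0"
  then have hn: "h i \<noteq> 0" for i by auto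
  have d\<psi>: "test_fun W (pd (1, 0) \<psi>)" by (rule test_fun_pd[OF \<psi> Basis_time])
  obtain B where "B > 0" and B[rule_format]: "\<forall>z. \<bar>pd (1, 0) \<psi> z\<bar> \<le> B" by (rule test_fun_boundedE[OF d\<psi>])
  have deriv: "((\<lambda>s. \<psi> (s, x)) has_real_derivative pd (1, 0) \<psi> (s, x)) (at s)" for s x
    using smooth_on_differentiable[OF test_fun_smooth[OF \<psi>]] by (intro pd_slice(3)) simp
  let ?q = "\<lambda>i x. g x * ((\<psi> (t + h i, x) - \<psi> (t, x)) / h i)"
  note m = borel_measurable_lebesgue_onI[OF test_fun_slice_borel[OF \<psi>]]
  have gm: "g \<in> borel_measurable (lebesgue_on \<Omega>)" using g by auto
  have "(\<lambda>i. LINT x|lebesgue_on \<Omega>. ?q i x) \<longlonglongrightarrow> (LINT x|lebesgue_on \<Omega>. g x * pd (1, 0) \<psi> (t, x))"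
  proof (rule integral_dominated_convergence[where w = "\<lambda>x. B * \<bar>g x\<bar>"])
    show "integrable (lebesgue_on \<Omega>) (\<lambda>x. B * \<bar>g x\<bar>)" using g by simp
    show "(\<lambda>x. g x * pd (1, 0) \<psi> (t, x)) \<in> borel_measurable (lebesgue_on \<Omega>)"
      using gm borel_measurable_lebesgue_onI[OF test_fun_slice_borel[OF d\<psi>]] by (rule borel_measurable_times)
    show "?q i \<in> borel_measurable (lebesgue_on \<Omega>)" for i
      by (intro borel_measurable_times gm borel_measurable_divide borel_measurable_diff m borel_measurable_const)
    have "(\<lambda>i. (\<psi> (t + h i, x) - \<psi> (t, x)) / h i) \<longlonglongrightarrow> pd (1, 0) \<psi> (t, x)" for x
      using deriv[of x t] h0 hn unfolding DERIV_def tendsto_at_iff_sequentially comp_def by auto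
    then show "AE x in lebesgue_on \<Omega>. (\<lambda>i. ?q i x) \<longlonglongrightarrow> g x * pd (1, 0) \<psi> (t, x)"
      by (intro AE_I2 tendsto_intros)
    have "norm (?q i x) \<le> B * \<bar>g x\<bar>" for i x
    proof -
      have "norm (\<psi> (t + h i, x) - \<psi> (t, x)) \<le> B * norm (t + h i - t)"
        using B deriv by (intro field_differentiable_bound[of UNIV "\<lambda>s. \<psi> (s, x)" "\<lambda>s. pd (1, 0) \<psi> (s, x)"]) auto
      then have "\<bar>(\<psi> (t + h i, x) - \<psi> (t, x)) / h i\<bar> \<le> B" using hn[of i] by (simp add: divide_le_eq)
      then show ?thesis by (simp only: real_norm_def abs_mult mult.commute[of B]) (rule mult_left_mono, auto)
    qed
    then show "AE x in lebesgue_on \<Omega>. norm (?q i x) \<le> B * \<bar>g x\<bar>" for i by (intro AE_I2)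
  qed
  moreover have "(LINT x|lebesgue_on \<Omega>. ?q i x) = ((LINT x|lebesgue_on \<Omega>. g x * \<psi> (t + h i, x)) - (LINT x|lebesgue_on \<Omega>. g x * \<psi> (t, x))) / h i" for i
  proof -
    have "(LINT x|lebesgue_on \<Omega>. ?q i x) = (LINT x|lebesgue_on \<Omega>. (g x * \<psi> (t + h i, x) - g x * \<psi> (t, x)) / h i)"
      by (simp add: right_diff_distrib diff_divide_distrib)
    then show ?thesis using integrable_mult_slice[OF g \<psi>] by (simp only: integral_divide_zero Bochner_Integration.integral_diff)
  qed
  ultimately show "((\<lambda>h. ((LINT x|lebesgue_on \<Omega>. g x * \<psi> (t + h, x)) - (LINT x|lebesgue_on \<Omega>. g x * \<psi> (t, x))) / h) \<circ> h)
     \<longlonglongrightarrow> (LINT x|lebesgue_on \<Omega>. g x * pd (1, 0) \<psi> (t, x))"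
    by (simp only: comp_def)
qed

lemma continuous_integral_slice:
  fixes \<psi> :: "real \<times> 'a::euclidean_space \<Rightarrow> real"
  assumes "integrable (lebesgue_on \<Omega>) g" "test_fun W \<psi>"
  shows "continuous_on UNIV (\<lambda>t. LINT x|lebesgue_on \<Omega>. g x * \<psi> (t, x))"
  using DERIV_isCont[OF has_derivative_integral_slice[OF assms]] by (intro continuous_at_imp_continuous_on) auto

lemma integrable_continuous_Ioo:
  fixes f :: "real \<Rightarrow> real"
  assumes "continuous_on UNIV f"
  shows "integrable (lebesgue_on {0<..<T}) f"
proof (rule integrable_lebesgue_on_subset)
  show "integrable (lebesgue_on {0..T}) f"
    using continuous_imp_integrable_real[of 0 T f] continuous_on_subset[OF assms] by auto
qed auto

lemma integral_by_parts_Ioo: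
  fixes a F :: "real \<Rightarrow> real"
  assumes a: "\<And>t. (a has_real_derivative a' t) (at t)" and a': "continuous_on UNIV a'"
    and F: "\<And>t. (F has_real_derivative F' t) (at t)" and F': "continuous_on UNIV F'"
    and F0: "F 0 = 0" "F T = 0" and T: "0 < T"
  shows "(LINT t|lebesgue_on {0<..<T}. a t * F' t) = - (LINT t|lebesgue_on {0<..<T}. a' t * F t)"
proof -
  have ca: "continuous_on UNIV a" "continuous_on UNIV F"
    by (auto intro!: continuous_at_imp_continuous_on DERIV_isCont a F)
  have 1: "integrable (lebesgue_on {0<..<T}) (\<lambda>t. a t * F' t)" and 2: "integrable (lebesgue_on {0<..<T}) (\<lambda>t. a' t * F t)"
    by (intro integrable_continuous_Ioo continuous_intros ca a' F')+
  have "(LINT t|lebesgue_on {0<..<T}. a t * F' t + a' t * F t) = integral {0<..<T} (\<lambda>t. a t * F' t + a' t * F t)"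
    using 1 2 by (intro lebesgue_integral_eq_integral) auto
  also have "\<dots> = integral {0..T} (\<lambda>t. a t * F' t + a' t * F t)"
    by (rule integral_open_interval_real[symmetric])
  also have "((\<lambda>t. a t * F' t + a' t * F t) has_integral a T * F T - a 0 * F 0) {0..T}"
  proof (rule fundamental_theorem_of_calculus)
    fix t
    have "((\<lambda>t. a t * F t) has_real_derivative a t * F' t + a' t * F t) (at t within {0..T})"
      by (rule has_field_derivative_at_within) (use DERIV_mult[OF a F] in \<open>simp add: algebra_simps\<close>)
    then show "((\<lambda>t. a t * F t) has_vector_derivative a t * F' t + a' t * F t) (at t within {0..T})"
      by (simp add: has_real_derivative_iff_has_vector_derivative)
  qed (use T in simp)
  then have "integral {0..T} (\<lambda>t. a t * F' t + a' t * F t) = 0"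
    using F0 by (simp add: integral_unique)
  finally show ?thesis using 1 2 by simp
qed

section \<open>The energy identity\<close>

text \<open>The weak equation may be tested with \<open>u\<close> itself, since \<open>u\<close> is a limit of test functions in \<open>H\<^sup>1\<close>.\<close>

lemma energy_identity:
  fixes u c :: "'a::euclidean_space \<Rightarrow> real"
  assumes D: "open D" and u: "H10 D u" and eigen: "minus_Delta_eq D c u (\<lambda>x. lam * u x)"
    and c: "c \<in> borel_measurable (lebesgue_on D)" "\<And>x. x \<in> D \<Longrightarrow> \<bar>c x\<bar> \<le> B"
  shows "(\<Sum>b\<in>Basis. LINT x|lebesgue_on D. c x * (wderiv D b u x)\<^sup>2) = lam * (L2_norm D u)\<^sup>2"
proof -
  have H1: "H1 D u" and L: "L2 D u" using H10_H1[OF u] H1_L2 by auto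
  note Lw = H1_wderiv(1)[OF H1]
  have Lcw: "L2 D (\<lambda>x. c x * wderiv D b u x)" if "b \<in> Basis" for b
    by (rule L2_mult_bounded[OF Lw[OF that] c])
  obtain \<phi> where \<phi>: "\<forall>k::nat. test_fun D (\<phi> k)" and lim: "(\<lambda>k. H1_norm D (\<lambda>x. u x - \<phi> k x)) \<longlonglongrightarrow> 0"
    using u unfolding H10_def by auto
  have L\<phi>: "L2 D (\<phi> k)" "b \<in> Basis \<Longrightarrow> L2 D (pd b (\<phi> k))" for k b
    using L2_test_fun[OF \<phi>[rule_format, of k]] L2_test_fun[OF test_fun_pd[OF \<phi>[rule_format, of k]]] D by auto
  have \<phi>U: "test_fun UNIV (\<phi> k)" for k using \<phi> test_fun_mono by blast
  let ?h = "\<lambda>k. H1_norm D (\<lambda>x. u x - \<phi> k x)"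
  have small: "(\<lambda>k. LINT x|lebesgue_on D. f x * g k x) \<longlonglongrightarrow> (LINT x|lebesgue_on D. f x * g' x)"
    if "L2 D f" "L2 D g'" "\<And>k. L2 D (g k)" "\<And>k. L2_norm D (\<lambda>x. g' x - g k x) \<le> ?h k" for f g' g
  proof -
    have "norm ((LINT x|lebesgue_on D. f x * g k x) - (LINT x|lebesgue_on D. f x * g' x)) \<le> ?h k * L2_norm D f" for k
    proof -
      have "(LINT x|lebesgue_on D. f x * g' x) - (LINT x|lebesgue_on D. f x * g k x) = (LINT x|lebesgue_on D. f x * (g' x - g k x))"
        using that by (simp add: right_diff_distrib L2_integrable_mult)
      moreover have "\<bar>LINT x|lebesgue_on D. f x * (g' x - g k x)\<bar> \<le> L2_norm D f * L2_norm D (\<lambda>x. g' x - g k x)"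
        by (rule L2_Cauchy_Schwarz[OF that(1) L2_diff[OF that(2,3)]])
      moreover have "\<dots> \<le> L2_norm D f * ?h k"
        by (rule mult_left_mono[OF that(4) L2_norm_nonneg])
      ultimately show ?thesis by (simp add: abs_minus_commute mult.commute)
    qed
    then have "(\<lambda>k. (LINT x|lebesgue_on D. f x * g k x) - (LINT x|lebesgue_on D. f x * g' x)) \<longlonglongrightarrow> 0"
      by (intro tendsto_0_le[OF tendsto_mult_left_zero[OF lim, of "L2_norm D f"], of _ 1] always_eventually allI)
        (simp add: H1_norm_nonneg L2_norm_nonneg)
    then show ?thesis by (simp add: LIM_zero_iff)
  qed
  have Ieq: "(\<Sum>b\<in>Basis. LINT x|lebesgue_on D. (c x * wderiv D b u x) * pd b (\<phi> k) x) = lam * (LINT x|lebesgue_on D. u x * \<phi> k x)" for k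
  proof -
    have "(\<Sum>b\<in>Basis. LINT x|lebesgue_on D. (c x * wderiv D b u x) * pd b (\<phi> k) x)
      = (LINT x|lebesgue_on D. (\<Sum>b\<in>Basis. (c x * wderiv D b u x) * pd b (\<phi> k) x))"
      using Lcw L\<phi> by (intro Bochner_Integration.integral_sum[symmetric] L2_integrable_mult)
    also have "\<dots> = (LINT x|lebesgue_on D. c x * (\<Sum>b\<in>Basis. wderiv D b u x * pd b (\<phi> k) x))"
      by (simp add: sum_distrib_left mult.assoc)
    also have "\<dots> = (LINT x|lebesgue_on D. (lam * u x) * \<phi> k x)"
      using eigen \<phi> unfolding minus_Delta_eq_def by blast
    finally show ?thesis by (simp add: mult.assoc)
  qed
  have "(\<lambda>k. \<Sum>b\<in>Basis. LINT x|lebesgue_on D. (c x * wderiv D b u x) * pd b (\<phi> k) x) \<longlonglongrightarrow>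
     (\<Sum>b\<in>Basis. LINT x|lebesgue_on D. (c x * wderiv D b u x) * wderiv D b u x)"
  proof (intro tendsto_sum small Lcw Lw L\<phi>)
    fix b :: 'a and k assume b: "b \<in> Basis"
    have "AE x in lebesgue_on D. wderiv D b u x - pd b (\<phi> k) x = wderiv D b (\<lambda>x. u x - \<phi> k x) x"
      using H1_diff(2)[OF D H1 H1_test_fun(1)[OF D \<phi>U[of k]] b] H1_test_fun(2)[OF D \<phi>U[of k] b]
      by eventually_elim simp
    then have "L2_norm D (\<lambda>x. wderiv D b u x - pd b (\<phi> k) x) = L2_norm D (wderiv D b (\<lambda>x. u x - \<phi> k x))"
      using H1_wderiv(1)[OF H1_diff(1)[OF D H1 H1_test_fun(1)[OF D \<phi>U[of k]]] b]
      by (intro L2_norm_cong_AE L2_diff Lw L\<phi> b) simp_all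
    then show "L2_norm D (\<lambda>x. wderiv D b u x - pd b (\<phi> k) x) \<le> ?h k"
      using L2_norm_wderiv_le_H1_norm[OF b] by simp
  qed
  moreover have "(\<lambda>k. lam * (LINT x|lebesgue_on D. u x * \<phi> k x)) \<longlonglongrightarrow> lam * (LINT x|lebesgue_on D. u x * u x)"
    by (intro tendsto_mult_left small L L\<phi> L2_norm_le_H1_norm)
  ultimately have "(\<Sum>b\<in>Basis. LINT x|lebesgue_on D. (c x * wderiv D b u x) * wderiv D b u x) = lam * (LINT x|lebesgue_on D. u x * u x)"
    unfolding Ieq by (rule LIMSEQ_unique)
  then show ?thesis unfolding L2_norm_sq by (simp add: power2_eq_square mult.assoc)
qed

section \<open>Separated solutions of the wave equation\<close>

lemma integral_slice_ends:
  fixes \<psi> :: "real \<times> 'a::euclidean_space \<Rightarrow> real"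
  assumes "test_fun ({0<..<T} \<times> \<Omega>) \<psi>"
  shows "(LINT x|lebesgue_on \<Omega>'. g x * \<psi> (0, x)) = 0" "(LINT x|lebesgue_on \<Omega>'. g x * \<psi> (T, x)) = 0"
proof -
  have "\<psi> (0, x) = 0" "\<psi> (T, x) = 0" for x by (rule test_fun_eq_0(1)[OF assms], simp)+
  then show "(LINT x|lebesgue_on \<Omega>'. g x * \<psi> (0, x)) = 0" "(LINT x|lebesgue_on \<Omega>'. g x * \<psi> (T, x)) = 0"
    by simp_all
qed

text \<open>For fixed time, integration by parts in space and the eigenvalue equation turn the inner integral
  into \<open>a (F'' + lam F)\<close> with \<open>F(t) = \<integral> u \<phi>(t, \<cdot>)\<close>. Two integrations by parts in time move the
  derivatives onto \<open>a\<close>, and \<open>a'' = - lam a\<close>.\<close>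

lemma wave_eq_product:
  fixes u c :: "'a::euclidean_space \<Rightarrow> real"
  assumes D: "open D" "bounded D" and \<Omega>: "open \<Omega>" "\<Omega> \<subseteq> D" and u: "H1 D u"
    and c: "smooth_on \<Omega> c" and eigen: "minus_Delta_eq D c u (\<lambda>x. lam * u x)"
    and a: "\<And>t. (a has_real_derivative a' t) (at t)" and a': "\<And>t. (a' has_real_derivative - lam * a t) (at t)"
    and T: "0 < T"
  shows "wave_eq \<Omega> c T (\<lambda>t x. a t * u x)"
  unfolding wave_eq_def
proof (intro allI impI)
  fix \<phi> :: "real \<times> 'a \<Rightarrow> real" assume \<phi>: "test_fun ({0<..<T} \<times> \<Omega>) \<phi>"
  let ?W = "\<lambda>t x. a t * u x * (pd (1, 0) (pd (1, 0) \<phi>) (t, x)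
      - (\<Sum>b\<in>Basis. pd (0, b) (\<lambda>z. c (snd z) * pd (0, b) \<phi> z) (t, x)))"
  have sets: "D \<in> sets lebesgue" "\<Omega> \<in> sets lebesgue" using D \<Omega> by auto
  have "\<Omega> \<in> lmeasurable" using bounded_subset[OF D(2) \<Omega>(2)] \<Omega>(1) lmeasurable_open by blast
  then have u\<Omega>: "integrable (lebesgue_on \<Omega>) u"
    by (rule L2_integrable[OF L2_subset[OF \<Omega>(2) sets(2,1) H1_L2[OF u]]])
  have \<phi>t: "test_fun ({0<..<T} \<times> \<Omega>) (pd (1, 0) \<phi>)" by (rule test_fun_pd[OF \<phi> Basis_time])
  have \<phi>tt: "test_fun ({0<..<T} \<times> \<Omega>) (pd (1, 0) (pd (1, 0) \<phi>))" by (rule test_fun_pd[OF \<phi>t Basis_time])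
  define F F' F'' where "F t = (LINT x|lebesgue_on \<Omega>. u x * \<phi> (t, x))"
    and "F' t = (LINT x|lebesgue_on \<Omega>. u x * pd (1, 0) \<phi> (t, x))"
    and "F'' t = (LINT x|lebesgue_on \<Omega>. u x * pd (1, 0) (pd (1, 0) \<phi>) (t, x))" for t
  have dF: "(F has_real_derivative F' t) (at t)" "(F' has_real_derivative F'' t) (at t)" for t
    unfolding F_def F'_def F''_def
    using has_derivative_integral_slice[OF u\<Omega> \<phi>] has_derivative_integral_slice[OF u\<Omega> \<phi>t] by simp_all
  have cF: "continuous_on UNIV F" "continuous_on UNIV F'" "continuous_on UNIV F''"
    unfolding F_def F'_def F''_def
    using continuous_integral_slice[OF u\<Omega> \<phi>] continuous_integral_slice[OF u\<Omega> \<phi>t] continuous_integral_slice[OF u\<Omega> \<phi>tt] by simp_all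
  have ca: "continuous_on UNIV a" "continuous_on UNIV a'"
    by (auto intro!: continuous_at_imp_continuous_on DERIV_isCont a a')
  have inner: "(LINT x|lebesgue_on \<Omega>. ?W t x) = a t * F'' t + lam * (a t * F t)" for t
  proof -
    define \<psi> where "\<psi> b x = c x * pd (0, b) \<phi> (t, x)" for b x
    have Bb: "(0, b) \<in> (Basis :: (real \<times> 'a) set)" if "b \<in> Basis" for b using that by (simp add: Basis_prod_def)
    have \<psi>: "test_fun \<Omega> (\<psi> b)" if "b \<in> Basis" for b
      unfolding \<psi>_def by (rule test_fun_mult_smooth[OF \<Omega>(1) c test_fun_slice[OF test_fun_pd[OF \<phi> Bb[OF that]]]])
    have pd\<psi>: "pd (0, b) (\<lambda>z. c (snd z) * pd (0, b) \<phi> z) (t, x) = pd b (\<psi> b) x" if b: "b \<in> Basis" and x: "x \<in> \<Omega>" for b x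
    proof -
      have "(\<lambda>z::real \<times> 'a. c (snd z)) differentiable (at (t, x))"
      proof -
        have "c differentiable (at (snd (t, x)))" using smooth_on_differentiable[OF c x] by simp
        moreover have "snd differentiable (at (t, x))"
          using bounded_linear_imp_differentiable[OF bounded_linear_snd] .
        ultimately show ?thesis using differentiable_chain_at[of snd "(t, x)" c] by (simp add: comp_def)
      qed
      moreover have "pd (0, b) \<phi> differentiable (at (t, x))"
        using smooth_on_differentiable[OF test_fun_smooth[OF test_fun_pd[OF \<phi> Bb[OF b]]]] by simp
      ultimately have "(\<lambda>z. c (snd z) * pd (0, b) \<phi> z) differentiable (at (t, x))" by (rule differentiable_mult)
      from pd_slice(2)[OF this, of b] show ?thesis by (simp add: \<psi>_def[abs_def])
    qed
    have ibp: "(LINT x|lebesgue_on \<Omega>. u x * pd b (\<psi> b) x) = - (LINT x|lebesgue_on D. wderiv D b u x * \<psi> b x)" if b: "b \<in> Basis" for b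
    proof -
      have "(LINT x|lebesgue_on \<Omega>. u x * pd b (\<psi> b) x) = (LINT x|lebesgue_on D. u x * pd b (\<psi> b) x)"
        using test_fun_eq_0(2)[OF \<psi>[OF b]] by (intro lebesgue_on_support(1) \<Omega> sets) auto
      also have "\<dots> = - (LINT x|lebesgue_on D. wderiv D b u x * \<psi> b x)"
        using H1_wderiv(2)[OF u b] test_fun_mono[OF \<psi>[OF b] \<Omega>(2)] unfolding has_weak_deriv_def by blast
      finally show ?thesis .
    qed
    have \<psi>L: "L2 D (\<psi> b)" if "b \<in> Basis" for b by (rule L2_test_fun[OF \<psi>[OF that] sets(1)])
    have "(\<Sum>b\<in>Basis. LINT x|lebesgue_on D. wderiv D b u x * \<psi> b x) = (LINT x|lebesgue_on D. (\<Sum>b\<in>Basis. wderiv D b u x * \<psi> b x))"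
      using H1_wderiv(1)[OF u] \<psi>L by (intro Bochner_Integration.integral_sum[symmetric] L2_integrable_mult)
    also have "\<dots> = (LINT x|lebesgue_on D. c x * (\<Sum>b\<in>Basis. wderiv D b u x * pd b (\<lambda>x. \<phi> (t, x)) x))"
    proof (intro Bochner_Integration.integral_cong refl)
      fix x
      have "pd b (\<lambda>x. \<phi> (t, x)) x = pd (0, b) \<phi> (t, x)" for b
        using smooth_on_differentiable[OF test_fun_smooth[OF \<phi>]] by (intro pd_slice(2)) simp
      then show "(\<Sum>b\<in>Basis. wderiv D b u x * \<psi> b x) = c x * (\<Sum>b\<in>Basis. wderiv D b u x * pd b (\<lambda>x. \<phi> (t, x)) x)"
        by (simp add: \<psi>_def sum_distrib_left mult.left_commute)
    qed
    also have "\<dots> = (LINT x|lebesgue_on D. lam * u x * \<phi> (t, x))"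
      using eigen test_fun_mono[OF test_fun_slice[OF \<phi>] \<Omega>(2)] unfolding minus_Delta_eq_def by blast
    also have "\<dots> = (LINT x|lebesgue_on \<Omega>. lam * u x * \<phi> (t, x))"
      using test_fun_eq_0(1)[OF test_fun_slice[OF \<phi>]] by (intro lebesgue_on_support(1)[symmetric] \<Omega> sets) auto
    also have "\<dots> = lam * F t" by (simp add: F_def mult.assoc)
    finally have sum_eq: "(\<Sum>b\<in>Basis. LINT x|lebesgue_on \<Omega>. u x * pd b (\<psi> b) x) = - (lam * F t)"
      by (simp add: ibp sum_negf)
    have int: "integrable (lebesgue_on \<Omega>) (\<lambda>x. u x * pd b (\<psi> b) x)" if b: "b \<in> Basis" for b
      using L2_subset[OF \<Omega>(2) sets(2,1) H1_L2[OF u]] L2_test_fun[OF test_fun_pd[OF \<psi>[OF b] b] sets(2)]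
      by (rule L2_integrable_mult)
    have "(LINT x|lebesgue_on \<Omega>. ?W t x)
      = (LINT x|lebesgue_on \<Omega>. a t * (u x * pd (1, 0) (pd (1, 0) \<phi>) (t, x) - (\<Sum>b\<in>Basis. u x * pd b (\<psi> b) x)))"
      by (intro Bochner_Integration.integral_cong) (auto simp: pd\<psi> sum_distrib_left right_diff_distrib mult.assoc)
    also have "\<dots> = a t * (F'' t - (\<Sum>b\<in>Basis. LINT x|lebesgue_on \<Omega>. u x * pd b (\<psi> b) x))"
      using integrable_mult_slice[OF u\<Omega> \<phi>tt] int by (simp add: F''_def)
    finally show ?thesis unfolding sum_eq by (simp add: algebra_simps)
  qed
  have "(LINT t|lebesgue_on {0<..<T}. a t * F'' t) = - (LINT t|lebesgue_on {0<..<T}. a' t * F' t)"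
    by (rule integral_by_parts_Ioo[OF a ca(2) dF(2) cF(3) _ _ T]) (simp_all add: F'_def integral_slice_ends[OF \<phi>t])
  also have "(LINT t|lebesgue_on {0<..<T}. a' t * F' t) = - (LINT t|lebesgue_on {0<..<T}. - lam * a t * F t)"
    by (rule integral_by_parts_Ioo[OF a' _ dF(1) cF(2) _ _ T])
      (auto simp: F_def integral_slice_ends[OF \<phi>] intro!: continuous_intros ca)
  finally have key: "(LINT t|lebesgue_on {0<..<T}. a t * F'' t) = - lam * (LINT t|lebesgue_on {0<..<T}. a t * F t)"
    by (simp add: mult.assoc)
  have "integrable (lebesgue_on {0<..<T}) (\<lambda>t. a t * F'' t)" "integrable (lebesgue_on {0<..<T}) (\<lambda>t. a t * F t)"
    by (intro integrable_continuous_Ioo continuous_intros ca cF)+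
  then show "(LINT t|lebesgue_on {0<..<T}. LINT x|lebesgue_on \<Omega>. ?W t x) = 0"
    unfolding inner using key by simp
qed

text \<open>The chosen weak and time derivatives are replaced by those of the product, to which they are equal
  almost everywhere. Integrability in time, by continuity, is recorded because the traces from the
  two sides of the interface have to be added.\<close>

lemma outer_conormal_trace_product:
  fixes u c :: "'a::euclidean_space \<Rightarrow> real"
  assumes D: "open D" "bounded D" and \<Omega>: "open \<Omega>" "\<Omega> \<subseteq> D" and u: "H1 D u"
    and c: "c \<in> borel_measurable (lebesgue_on \<Omega>)" "\<And>x. x \<in> \<Omega> \<Longrightarrow> \<bar>c x\<bar> \<le> B"
    and a: "\<And>t. (a has_real_derivative a' t) (at t)" and ca': "continuous_on UNIV a'"
    and T: "0 < T" and \<phi>: "test_fun W \<phi>"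
  defines "G \<equiv> \<lambda>t. LINT x|lebesgue_on \<Omega>. c x * (\<Sum>b\<in>Basis. wderiv D b u x * pd (0, b) \<phi> (t, x))"
    and "H \<equiv> \<lambda>t. LINT x|lebesgue_on \<Omega>. u x * pd (1, 0) \<phi> (t, x)"
  shows "outer_conormal_trace D \<Omega> c T (\<lambda>t x. a t * u x) \<phi> = (LINT t|lebesgue_on {0<..<T}. a t * G t - a' t * H t)"
    and "integrable (lebesgue_on {0<..<T}) (\<lambda>t. a t * G t - a' t * H t)"
    and "\<And>t. integrable (lebesgue_on \<Omega>) (\<lambda>x. c x * (\<Sum>b\<in>Basis. wderiv D b u x * pd (0, b) \<phi> (t, x)))"
    and "\<And>t. integrable (lebesgue_on \<Omega>) (\<lambda>x. u x * pd (1, 0) \<phi> (t, x))"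
proof -
  let ?g = "\<lambda>t x. \<Sum>b\<in>Basis. wderiv D b u x * pd (0, b) \<phi> (t, x)"
    and ?g' = "\<lambda>t x. \<Sum>b\<in>Basis. wderiv \<Omega> b (\<lambda>x. a t * u x) x * pd (0, b) \<phi> (t, x)"
  have sets: "D \<in> sets lebesgue" "\<Omega> \<in> sets lebesgue" using D \<Omega> by auto
  have lm: "\<Omega> \<in> lmeasurable" using bounded_subset[OF D(2) \<Omega>(2)] \<Omega>(1) lmeasurable_open by blast
  have L\<Omega>: "L2 \<Omega> f" if "L2 D f" for f by (rule L2_subset[OF \<Omega>(2) sets(2,1) that])
  have Lw: "L2 \<Omega> (wderiv D b u)" if "b \<in> Basis" for b by (rule L\<Omega>[OF H1_wderiv(1)[OF u that]])
  have u\<Omega>: "integrable (lebesgue_on \<Omega>) u" by (rule L2_integrable[OF L\<Omega>[OF H1_L2[OF u]] lm])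
  have cw: "integrable (lebesgue_on \<Omega>) (\<lambda>x. c x * wderiv D b u x)" if "b \<in> Basis" for b
    by (rule L2_integrable[OF L2_mult_bounded[OF Lw[OF that] c] lm])
  have Bb: "(0, b) \<in> (Basis :: (real \<times> 'a) set)" if "b \<in> Basis" for b using that by (simp add: Basis_prod_def)
  have \<phi>b: "test_fun W (pd (0, b) \<phi>)" if "b \<in> Basis" for b by (rule test_fun_pd[OF \<phi> Bb[OF that]])
  have \<phi>t: "test_fun W (pd (1, 0) \<phi>)" by (rule test_fun_pd[OF \<phi> Basis_time])
  have expand: "c x * ?g t x = (\<Sum>b\<in>Basis. (c x * wderiv D b u x) * pd (0, b) \<phi> (t, x))" for t x
    by (simp add: sum_distrib_left mult.assoc)
  show intG: "integrable (lebesgue_on \<Omega>) (\<lambda>x. c x * ?g t x)" for t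
    unfolding expand using integrable_mult_slice[OF cw \<phi>b] by (intro Bochner_Integration.integrable_sum)
  show intH: "integrable (lebesgue_on \<Omega>) (\<lambda>x. u x * pd (1, 0) \<phi> (t, x))" for t
    by (rule integrable_mult_slice[OF u\<Omega> \<phi>t])
  have "G = (\<lambda>t. \<Sum>b\<in>Basis. LINT x|lebesgue_on \<Omega>. (c x * wderiv D b u x) * pd (0, b) \<phi> (t, x))"
    unfolding G_def expand using integrable_mult_slice[OF cw \<phi>b] by (simp add: Bochner_Integration.integral_sum)
  moreover have "continuous_on UNIV (\<lambda>t. \<Sum>b\<in>Basis. LINT x|lebesgue_on \<Omega>. (c x * wderiv D b u x) * pd (0, b) \<phi> (t, x))"
    by (intro continuous_on_sum continuous_integral_slice[OF cw \<phi>b])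
  ultimately have cG: "continuous_on UNIV G" by simp
  have cH: "continuous_on UNIV H" unfolding H_def by (rule continuous_integral_slice[OF u\<Omega> \<phi>t])
  have ca: "continuous_on UNIV a" by (auto intro!: continuous_at_imp_continuous_on DERIV_isCont a)
  show "integrable (lebesgue_on {0<..<T}) (\<lambda>t. a t * G t - a' t * H t)"
    by (intro integrable_continuous_Ioo continuous_intros ca ca' cG cH)
  show "outer_conormal_trace D \<Omega> c T (\<lambda>t x. a t * u x) \<phi> = (LINT t|lebesgue_on {0<..<T}. a t * G t - a' t * H t)"
    unfolding outer_conormal_trace_def
  proof (intro Bochner_Integration.integral_cong refl)
    fix t assume "t \<in> space (lebesgue_on {0<..<T})"
    then have t: "t \<in> {0..T}" by simp
    let ?td = "time_deriv D T (\<lambda>t x. a t * u x) t"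
    have H1u: "H1 \<Omega> u" by (rule H1_subset(1)[OF D(1) \<Omega> u])
    have "AE x in lebesgue_on \<Omega>. wderiv \<Omega> b (\<lambda>x. a t * u x) x = a t * wderiv D b u x" if b: "b \<in> Basis" for b
      using H1_cmult(3)[OF \<Omega>(1) H1u b, of "a t"] H1_subset(3)[OF D(1) \<Omega> u b] by eventually_elim simp
    then have "AE x in lebesgue_on \<Omega>. \<forall>b\<in>Basis. wderiv \<Omega> b (\<lambda>x. a t * u x) x = a t * wderiv D b u x"
      by (intro AE_finite_allI) auto
    moreover have "AE x in lebesgue_on \<Omega>. ?td x = a' t * u x"
      by (rule AE_lebesgue_on_subset[OF \<Omega>(2) sets(2,1) time_deriv_product(2)[OF H1_L2[OF u] a T t]])
    ultimately have AE: "AE x in lebesgue_on \<Omega>. c x * ?g' t x - ?td x * pd (1, 0) \<phi> (t, x)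
      = a t * (c x * ?g t x) - a' t * (u x * pd (1, 0) \<phi> (t, x))"
      by eventually_elim (simp add: sum_distrib_left mult_ac)
    have m1: "(\<lambda>x. \<psi> (t, x)) \<in> borel_measurable (lebesgue_on \<Omega>)" if "test_fun W \<psi>" for \<psi>
      by (rule borel_measurable_lebesgue_onI[OF test_fun_slice_borel[OF that]])
    have m2: "wderiv \<Omega> b (\<lambda>x. a t * u x) \<in> borel_measurable (lebesgue_on \<Omega>)" if "b \<in> Basis" for b
      by (rule L2_measurable[OF H1_wderiv(1)[OF H1_cmult(1)[OF \<Omega>(1) H1u] that]])
    have m3: "?td \<in> borel_measurable (lebesgue_on \<Omega>)"
      by (rule L2_measurable[OF L\<Omega>[OF time_deriv_product(1)[OF H1_L2[OF u] a T t]]])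
    have "(LINT x|lebesgue_on \<Omega>. c x * ?g' t x - ?td x * pd (1, 0) \<phi> (t, x))
       = (LINT x|lebesgue_on \<Omega>. a t * (c x * ?g t x) - a' t * (u x * pd (1, 0) \<phi> (t, x)))"
    proof (rule integral_cong_AE[OF _ _ AE])
      show "(\<lambda>x. c x * ?g' t x - ?td x * pd (1, 0) \<phi> (t, x)) \<in> borel_measurable (lebesgue_on \<Omega>)"
        by (intro borel_measurable_diff borel_measurable_times borel_measurable_sum c(1) m1 m2 m3 \<phi>b \<phi>t)
      show "(\<lambda>x. a t * (c x * ?g t x) - a' t * (u x * pd (1, 0) \<phi> (t, x))) \<in> borel_measurable (lebesgue_on \<Omega>)"
        by (intro borel_measurable_diff borel_measurable_times borel_measurable_const
            borel_measurable_integrable[OF intG] borel_measurable_integrable[OF intH] borel_measurable_sum c(1) m1 \<phi>b \<phi>t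
            L2_measurable[OF Lw] borel_measurable_integrable[OF u\<Omega>])
    qed
    also have "\<dots> = a t * G t - a' t * H t"
      using intG[of t] intH[of t] by (simp add: G_def H_def)
    finally show "(LINT x|lebesgue_on \<Omega>. c x * ?g' t x - ?td x * pd (1, 0) \<phi> (t, x))
       = a t * G t - a' t * H t" .
  qed
qed

lemma integral_split_null:
  fixes f :: "'a::euclidean_space \<Rightarrow> real"
  assumes sets: "A \<in> sets lebesgue" "B \<in> sets lebesgue" "D \<in> sets lebesgue"
    and AB: "A \<inter> B = {}" "A \<subseteq> D" "B \<subseteq> D" "negligible (D - (A \<union> B))"
    and int: "integrable (lebesgue_on A) f" "integrable (lebesgue_on B) f" and fm: "f \<in> borel_measurable (lebesgue_on D)"
  shows "(LINT x|lebesgue_on D. f x) = (LINT x|lebesgue_on A. f x) + (LINT x|lebesgue_on B. f x)"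
proof -
  have "(LINT x|lebesgue_on A. f x) + (LINT x|lebesgue_on B. f x) = (LINT x|lebesgue. (if x \<in> A then f x else 0)) + (LINT x|lebesgue. (if x \<in> B then f x else 0))"
    using sets by (simp add: Lebesgue_Measure.integral_restrict_UNIV)
  also have "\<dots> = (LINT x|lebesgue. (if x \<in> A then f x else 0) + (if x \<in> B then f x else 0))"
    using int sets by (intro Bochner_Integration.integral_add[symmetric]) (simp_all add: Lebesgue_Measure.integrable_restrict_UNIV)
  also have "\<dots> = (LINT x|lebesgue. (if x \<in> D then f x else 0))"
  proof (rule integral_cong_AE)
    have "AE x in lebesgue. x \<notin> D - (A \<union> B)"
      using AB(4) by (intro AE_not_in) (simp add: negligible_iff_null_sets)
    then show "AE x in lebesgue. (if x \<in> A then f x else 0) + (if x \<in> B then f x else 0) = (if x \<in> D then f x else 0)"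
      by eventually_elim (use AB in auto)
    show "(\<lambda>x. if x \<in> D then f x else 0) \<in> borel_measurable lebesgue"
      by (rule borel_measurable_if_I[OF fm sets(3)])
    show "(\<lambda>x. (if x \<in> A then f x else 0) + (if x \<in> B then f x else 0)) \<in> borel_measurable lebesgue"
      by (intro borel_measurable_add borel_measurable_if_I borel_measurable_integrable int sets)
  qed
  also have "\<dots> = (LINT x|lebesgue_on D. f x)" using sets by (simp add: Lebesgue_Measure.integral_restrict_UNIV)
  finally show ?thesis by simp
qed

text \<open>The eigenvalue equation holds in the sense of distributions across the interface, so it already
  contains the transmission condition. Since \<open>\<Omega>m\<close> and \<open>\<Omega>p\<close> fill the interior of \<open>M\<close> up to a null set,
  the two conormal traces add up to \<open>\<integral> (lam a F - a' F') dt\<close> with \<open>F(t) = \<integral> u \<phi>(t, \<cdot>)\<close>, which vanishes after one integration by parts in time.\<close>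

lemma flux_transmission_product:
  fixes u c cm cp :: "'a::euclidean_space \<Rightarrow> real"
  assumes D: "bounded (interior M)" and \<Omega>m: "open \<Omega>m" "\<Omega>m \<subseteq> interior M" and \<Omega>p: "open \<Omega>p" "\<Omega>p \<subseteq> interior M"
    and disj: "\<Omega>m \<inter> \<Omega>p = {}" and null: "negligible (interior M - (\<Omega>m \<union> \<Omega>p))" and u: "H1 (interior M) u"
    and cm: "cm \<in> borel_measurable (lebesgue_on \<Omega>m)" "\<And>x. x \<in> \<Omega>m \<Longrightarrow> \<bar>cm x\<bar> \<le> B" "\<And>x. x \<in> \<Omega>m \<Longrightarrow> c x = cm x"
    and cp: "cp \<in> borel_measurable (lebesgue_on \<Omega>p)" "\<And>x. x \<in> \<Omega>p \<Longrightarrow> \<bar>cp x\<bar> \<le> B" "\<And>x. x \<in> \<Omega>p \<Longrightarrow> c x = cp x"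
    and c: "c \<in> borel_measurable (lebesgue_on (interior M))"
    and eigen: "minus_Delta_eq (interior M) c u (\<lambda>x. lam * u x)"
    and a: "\<And>t. (a has_real_derivative a' t) (at t)" and a': "\<And>t. (a' has_real_derivative - lam * a t) (at t)"
    and T: "0 < T"
  shows "flux_transmission M \<Omega>m \<Omega>p cm cp T (\<lambda>t x. a t * u x)"
  unfolding flux_transmission_def
proof (intro allI impI)
  let ?D = "interior M"
  fix \<phi> :: "real \<times> 'a \<Rightarrow> real" assume \<phi>: "test_fun ({0<..<T} \<times> ?D) \<phi>"
  have oD: "open ?D" by simp
  have sets: "?D \<in> sets lebesgue" "\<Omega>m \<in> sets lebesgue" "\<Omega>p \<in> sets lebesgue" using \<Omega>m \<Omega>p by auto
  have ca: "continuous_on UNIV a" "continuous_on UNIV a'"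
    by (auto intro!: continuous_at_imp_continuous_on DERIV_isCont a a')
  have \<phi>t: "test_fun ({0<..<T} \<times> ?D) (pd (1, 0) \<phi>)" by (rule test_fun_pd[OF \<phi> Basis_time])
  have \<phi>b: "test_fun ({0<..<T} \<times> ?D) (pd (0, b) \<phi>)" if "b \<in> Basis" for b
    using that by (intro test_fun_pd[OF \<phi>]) (simp add: Basis_prod_def)
  have uD: "integrable (lebesgue_on ?D) u"
    by (rule L2_integrable[OF H1_L2[OF u] lmeasurable_open[OF D oD]])
  note om = outer_conormal_trace_product[OF oD D \<Omega>m u cm(1) cm(2) a ca(2) T \<phi>, simplified]
  note op = outer_conormal_trace_product[OF oD D \<Omega>p u cp(1) cp(2) a ca(2) T \<phi>, simplified]
  let ?e = "\<lambda>c t x. c x * (\<Sum>b\<in>Basis. wderiv ?D b u x * pd (0, b) \<phi> (t, x))"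
  let ?Gm = "\<lambda>t. LINT x|lebesgue_on \<Omega>m. ?e cm t x" and ?Gp = "\<lambda>t. LINT x|lebesgue_on \<Omega>p. ?e cp t x"
  let ?Hm = "\<lambda>t. LINT x|lebesgue_on \<Omega>m. u x * pd (1, 0) \<phi> (t, x)"
  let ?Hp = "\<lambda>t. LINT x|lebesgue_on \<Omega>p. u x * pd (1, 0) \<phi> (t, x)"
  define F F' where "F t = (LINT x|lebesgue_on ?D. u x * \<phi> (t, x))"
    and "F' t = (LINT x|lebesgue_on ?D. u x * pd (1, 0) \<phi> (t, x))" for t
  have dF: "(F has_real_derivative F' t) (at t)" for t
    unfolding F_def F'_def by (rule has_derivative_integral_slice[OF uD \<phi>])
  have cF: "continuous_on UNIV F" "continuous_on UNIV F'"
    unfolding F_def F'_def using continuous_integral_slice[OF uD \<phi>] continuous_integral_slice[OF uD \<phi>t] by simp_all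
  have m1: "(\<lambda>x. \<psi> (t, x)) \<in> borel_measurable (lebesgue_on ?D)" if "test_fun W \<psi>" for \<psi> W and t :: real
    by (rule borel_measurable_lebesgue_onI[OF test_fun_slice_borel[OF that]])
  have G: "?Gm t + ?Gp t = lam * F t" for t
  proof -
    have "?Gm t = (LINT x|lebesgue_on \<Omega>m. ?e c t x)"
      "?Gp t = (LINT x|lebesgue_on \<Omega>p. ?e c t x)"
      using cm(3) cp(3) by (intro Bochner_Integration.integral_cong; simp)+
    moreover have "(LINT x|lebesgue_on ?D. ?e c t x) = (LINT x|lebesgue_on \<Omega>m. ?e c t x) + (LINT x|lebesgue_on \<Omega>p. ?e c t x)"
    proof (rule integral_split_null[OF sets(2,3,1) disj \<Omega>m(2) \<Omega>p(2) null])
      show "integrable (lebesgue_on \<Omega>m) (?e c t)"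
        using om(3)[of t] by (rule Bochner_Integration.integrable_cong[THEN iffD1, rotated 2]) (auto simp: cm(3))
      show "integrable (lebesgue_on \<Omega>p) (?e c t)"
        using op(3)[of t] by (rule Bochner_Integration.integrable_cong[THEN iffD1, rotated 2]) (auto simp: cp(3))
      show "?e c t \<in> borel_measurable (lebesgue_on ?D)"
        by (intro borel_measurable_times borel_measurable_sum c m1[OF \<phi>b] L2_measurable[OF H1_wderiv(1)[OF u]])
    qed
    moreover have "(LINT x|lebesgue_on ?D. ?e c t x) = lam * F t"
    proof -
      have "pd b (\<lambda>x. \<phi> (t, x)) x = pd (0, b) \<phi> (t, x)" for b x
        using smooth_on_differentiable[OF test_fun_smooth[OF \<phi>]] by (intro pd_slice(2)) simp
      moreover have "(LINT x|lebesgue_on ?D. c x * (\<Sum>b\<in>Basis. wderiv ?D b u x * pd b (\<lambda>x. \<phi> (t, x)) x)) = (LINT x|lebesgue_on ?D. lam * u x * \<phi> (t, x))"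
        using eigen test_fun_slice[OF \<phi>] unfolding minus_Delta_eq_def by blast
      ultimately show ?thesis by (simp add: F_def mult.assoc)
    qed
    ultimately show ?thesis by simp
  qed
  have H: "?Hm t + ?Hp t = F' t" for t
    unfolding F'_def
  proof (rule integral_split_null[OF sets(2,3,1) disj \<Omega>m(2) \<Omega>p(2) null, symmetric])
    show "integrable (lebesgue_on \<Omega>m) (\<lambda>x. u x * pd (1, 0) \<phi> (t, x))" by (rule om(4))
    show "integrable (lebesgue_on \<Omega>p) (\<lambda>x. u x * pd (1, 0) \<phi> (t, x))" by (rule op(4))
    show "(\<lambda>x. u x * pd (1, 0) \<phi> (t, x)) \<in> borel_measurable (lebesgue_on ?D)"
      by (intro borel_measurable_times borel_measurable_integrable[OF uD] m1[OF \<phi>t])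
  qed
  have "outer_conormal_trace ?D \<Omega>m cm T (\<lambda>t x. a t * u x) \<phi> + outer_conormal_trace ?D \<Omega>p cp T (\<lambda>t x. a t * u x) \<phi>
     = (LINT t|lebesgue_on {0<..<T}. (a t * ?Gm t - a' t * ?Hm t)
        + (a t * ?Gp t - a' t * ?Hp t))"
    unfolding om(1) op(1) by (rule Bochner_Integration.integral_add[OF om(2) op(2), symmetric])
  also have "\<dots> = (LINT t|lebesgue_on {0<..<T}. lam * (a t * F t) - a' t * F' t)"
  proof (intro Bochner_Integration.integral_cong refl)
    have "a t * g1 - a' t * h1 + (a t * g2 - a' t * h2) = a t * (g1 + g2) - a' t * (h1 + h2)" for t g1 g2 h1 h2
      by (simp add: algebra_simps)
    then show "(a t * ?Gm t - a' t * ?Hm t)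
        + (a t * ?Gp t - a' t * ?Hp t)
        = lam * (a t * F t) - a' t * F' t" for t
      unfolding G[symmetric] H[symmetric] by (simp only: G H mult.left_commute)
  qed
  also have "\<dots> = lam * (LINT t|lebesgue_on {0<..<T}. a t * F t) - (LINT t|lebesgue_on {0<..<T}. a' t * F' t)"
  proof -
    have "integrable (lebesgue_on {0<..<T}) (\<lambda>t. a t * F t)" "integrable (lebesgue_on {0<..<T}) (\<lambda>t. a' t * F' t)"
      by (intro integrable_continuous_Ioo continuous_intros ca cF)+
    then show ?thesis by simp
  qed
  also have "(LINT t|lebesgue_on {0<..<T}. a' t * F' t) = - (LINT t|lebesgue_on {0<..<T}. - lam * a t * F t)"
    by (rule integral_by_parts_Ioo[OF a' _ dF cF(2) _ _ T])
      (auto simp: F_def integral_slice_ends[OF \<phi>] intro!: continuous_intros ca)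
  finally show "outer_conormal_trace ?D \<Omega>m cm T (\<lambda>t x. a t * u x) \<phi> = - outer_conormal_trace ?D \<Omega>p cp T (\<lambda>t x. a t * u x) \<phi>"
    by (simp add: mult.assoc)
qed

section \<open>The coefficient\<close>

lemma coefficient_bounds:
  assumes "smooth_up_to_closure \<Omega> c" "bounded \<Omega>" "\<And>x. x \<in> closure \<Omega> \<Longrightarrow> c x > 0"
  obtains m B where "m > 0" "\<forall>x\<in>\<Omega>. m \<le> c x \<and> c x \<le> B"
proof (cases "\<Omega> = {}")
  case True
  then show ?thesis using that[of 1] by simp
next
  case False
  have K: "compact (closure \<Omega>)" "closure \<Omega> \<noteq> {}" using assms(2) False by auto
  obtain V where V: "closure \<Omega> \<subseteq> V" "smooth_on V c" using assms(1) unfolding smooth_up_to_closure_def by blast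
  have cont: "continuous_on (closure \<Omega>) c"
    using continuous_on_subset[OF smooth_on_continuous[OF V(2)] V(1)] .
  obtain x where x: "x \<in> closure \<Omega>" "\<forall>y\<in>closure \<Omega>. c x \<le> c y"
    using continuous_attains_inf[OF K cont] by blast
  obtain y where y: "y \<in> closure \<Omega>" "\<forall>z\<in>closure \<Omega>. c z \<le> c y"
    using continuous_attains_sup[OF K cont] by blast
  show ?thesis
    using x y assms(3)[OF x(1)] closure_subset[of \<Omega>] by (intro that[of "c x" "c y"]) auto
qed

lemma smooth_up_to_closure_smooth_on: "smooth_up_to_closure \<Omega> c \<Longrightarrow> smooth_on \<Omega> c"
  unfolding smooth_up_to_closure_def smooth_on_def by (meson Ck_on_subset closure_subset order_trans)

lemma smooth_on_measurable:
  assumes "open \<Omega>" "smooth_on \<Omega> c"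
  shows "c \<in> borel_measurable (lebesgue_on \<Omega>)"
  using assms by (intro continuous_imp_measurable_on_sets_lebesgue smooth_on_continuous) auto

lemma smooth_on_glue_coeff:
  assumes "open \<Omega>m" "open \<Omega>p" "\<Omega>m \<inter> \<Omega>p = {}" "smooth_on \<Omega>m cm" "smooth_on \<Omega>p cp"
  shows "smooth_on (\<Omega>m \<union> \<Omega>p) (glue_coeff \<Omega>m \<Omega>p cm cp)"
  unfolding smooth_on_def
proof
  fix k
  have "Ck_on k \<Omega>m (glue_coeff \<Omega>m \<Omega>p cm cp)"
    by (rule Ck_on_cong[OF assms(1), of cm]) (use assms in \<open>auto simp: glue_coeff_def smooth_on_def indicator_def\<close>)
  moreover have "Ck_on k \<Omega>p (glue_coeff \<Omega>m \<Omega>p cm cp)"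
    by (rule Ck_on_cong[OF assms(2), of cp]) (use assms in \<open>auto simp: glue_coeff_def smooth_on_def indicator_def\<close>)
  ultimately show "Ck_on k (\<Omega>m \<union> \<Omega>p) (glue_coeff \<Omega>m \<Omega>p cm cp)"
    by (rule Ck_on_Un[OF assms(1,2)])
qed

lemma glue_coeff_measurable:
  assumes "\<Omega>m \<in> sets lebesgue" "\<Omega>p \<in> sets lebesgue"
    "cm \<in> borel_measurable (lebesgue_on \<Omega>m)" "cp \<in> borel_measurable (lebesgue_on \<Omega>p)"
  shows "glue_coeff \<Omega>m \<Omega>p cm cp \<in> borel_measurable (lebesgue_on D)"
proof -
  have "glue_coeff \<Omega>m \<Omega>p cm cp = (\<lambda>x. (if x \<in> \<Omega>m then cm x else 0) + (if x \<in> \<Omega>p then cp x else 0))"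
    by (auto simp: glue_coeff_def)
  then have "glue_coeff \<Omega>m \<Omega>p cm cp \<in> borel_measurable lebesgue"
    by (simp only:) (intro borel_measurable_add borel_measurable_if_I assms)
  then show ?thesis by (rule measurable_restrict_space1)
qed

section \<open>Frequency of the separated solutions\<close>

text \<open>The initial velocity vanishes, so only the norms of \<open>u\<close> remain.\<close>

lemma typical_frequency_product:
  assumes D: "open D" and u: "H1 D u" and u1: "L2_norm D u = 1"
    and a: "\<And>t. (a has_real_derivative a' t) (at t)" and a0: "a 0 = 1" "a' 0 = 0" and T: "0 < T"
  shows "typical_frequency D T (\<lambda>t x. a t * u x) = H1_norm D u"
proof -
  let ?v = "time_deriv D T (\<lambda>t x. a t * u x) 0"
  have L: "L2 D ?v" and AE: "AE x in lebesgue_on D. ?v x = 0"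
    using time_deriv_product[OF H1_L2[OF u] a T, of 0] T a0 by auto
  have "L2_norm D ?v = L2_norm D (\<lambda>x. 0)"
    by (rule L2_norm_cong_AE[OF AE L L2_zero])
  then have v0: "L2_norm D ?v = 0" by (simp add: L2_norm_def)
  have "Hm1_norm D ?v = 0"
  proof -
    let ?B = "{\<phi>. H10 D \<phi> \<and> H1_norm D \<phi> \<le> 1}"
    have z: "test_fun D (\<lambda>x. 0)" by (rule test_fun_zero)
    have H1z: "H1 D (\<lambda>x. 0)" and nz: "H1_norm D (\<lambda>x. 0) = 0"
      using H1_cmult(1,2)[OF D u, of 0] by simp_all
    then have "H10 D (\<lambda>x. 0)"
      unfolding H10_def using z by (intro conjI exI[of _ "\<lambda>k x. 0"]) simp_all
    then have ne: "?B \<noteq> {}" using nz by force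
    have "\<bar>LINT x|lebesgue_on D. ?v x * \<phi> x\<bar> = 0" for \<phi>
    proof -
      have "AE x in lebesgue_on D. ?v x * \<phi> x = 0" using AE by eventually_elim simp
      then show ?thesis by (simp add: integral_eq_zero_AE)
    qed
    then show ?thesis unfolding Hm1_norm_def using ne by simp
  qed
  then show ?thesis
    using v0 u1 H1_norm_nonneg[of D u] by (simp add: typical_frequency_def a0)
qed

text \<open>The energy identity gives \<open>c0 \<parallel>\<nabla>u\<parallel>\<^sup>2 \<le> lam\<close>. Thus the frequency is at most of the order \<open>sqrt lam\<close>, the
  rate in the decay of the eigenfunctions.\<close>

lemma H1_norm_eigenfunction_bound:
  fixes u c :: "'a::euclidean_space \<Rightarrow> real"
  assumes D: "open D" and u: "H10 D u" and eigen: "minus_Delta_eq D c u (\<lambda>x. lam * u x)"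
    and c: "c \<in> borel_measurable (lebesgue_on D)" "\<And>x. x \<in> D \<Longrightarrow> \<bar>c x\<bar> \<le> B"
    and c0: "c0 > 0" "AE x in lebesgue_on D. c0 \<le> c x" and u1: "L2_norm D u = 1"
  shows "0 \<le> lam" and "H1_norm D u \<le> 1 + sqrt lam / sqrt c0"
proof -
  have H1: "H1 D u" using H10_H1[OF u] .
  let ?E = "\<Sum>b\<in>Basis. (L2_norm D (wderiv D b u))\<^sup>2"
  have "c0 * ?E = (\<Sum>b\<in>Basis. LINT x|lebesgue_on D. c0 * (wderiv D b u x)\<^sup>2)"
    by (simp add: L2_norm_sq sum_distrib_left)
  also have "\<dots> \<le> (\<Sum>b\<in>Basis. LINT x|lebesgue_on D. c x * (wderiv D b u x)\<^sup>2)"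
  proof (intro sum_mono integral_mono_AE)
    fix b :: 'a assume b: "b \<in> Basis"
    note L = H1_wderiv(1)[OF H1 b]
    show "integrable (lebesgue_on D) (\<lambda>x. c0 * (wderiv D b u x)\<^sup>2)" using L by (simp add: L2_def)
    have "integrable (lebesgue_on D) (\<lambda>x. (c x * wderiv D b u x) * wderiv D b u x)"
      by (rule L2_integrable_mult[OF L2_mult_bounded[OF L c] L])
    then show "integrable (lebesgue_on D) (\<lambda>x. c x * (wderiv D b u x)\<^sup>2)"
      by (simp add: power2_eq_square mult.assoc)
    show "AE x in lebesgue_on D. c0 * (wderiv D b u x)\<^sup>2 \<le> c x * (wderiv D b u x)\<^sup>2"
      using c0(2) by eventually_elim (simp add: mult_right_mono)
  qed
  also have "\<dots> = lam" using energy_identity[OF D u eigen c] u1 by simp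
  finally have le: "c0 * ?E \<le> lam" .
  have "0 \<le> ?E" by (intro sum_nonneg) simp
  with le c0(1) show lam0: "0 \<le> lam" by (meson mult_nonneg_nonneg less_imp_le order_trans)
  have "(H1_norm D u)\<^sup>2 \<le> 1 + lam / c0"
    using le c0(1) u1 by (simp add: H1_norm_sq le_divide_eq mult.commute)
  also have "\<dots> \<le> (1 + sqrt lam / sqrt c0)\<^sup>2"
    using lam0 c0(1) by (simp add: power2_sum power_divide)
  finally show "H1_norm D u \<le> 1 + sqrt lam / sqrt c0"
    by (rule power2_le_imp_le) (use lam0 c0(1) in simp)
qed

theorem theorem1p4:
  fixes M S \<Omega>m \<Omega>p :: "'a::euclidean_space set"
    and \<nu> :: "'a \<Rightarrow> 'a"
    and cm cp :: "'a \<Rightarrow> real"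
    and lam :: "nat \<Rightarrow> real"
    and u :: "nat \<Rightarrow> 'a \<Rightarrow> real"
    and T :: real
  assumes setting: "interface_setting M S \<Omega>m \<Omega>p \<nu> cm cp"
    and lam_lim: "filterlim lam at_top sequentially"
    and u_dom: "\<And>n. dom_A M S \<Omega>m \<Omega>p \<nu> cm cp (u n)"
    and u_eigen: "\<And>n. minus_Delta_eq (interior M) (glue_coeff \<Omega>m \<Omega>p cm cp) (u n)
                     (\<lambda>x. lam n * u n x)"
    and u_norm: "\<And>n. L2_norm M (u n) = 1"
    and u_decay: "\<And>\<omega>. \<omega> \<in> sets lebesgue \<Longrightarrow> \<omega> \<subseteq> M \<Longrightarrow> setdist (closure \<omega>) S > 0 \<Longrightarrow>
                     \<exists>C>0. \<exists>d>0. \<forall>n. L2_norm \<omega> (u n) \<le> C * exp (- d * sqrt (lam n))"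
    and T_pos: "T > 0"
  shows "\<exists>(w :: nat \<Rightarrow> real \<Rightarrow> 'a \<Rightarrow> real) (w0 :: nat \<Rightarrow> 'a \<Rightarrow> real) (w1 :: nat \<Rightarrow> 'a \<Rightarrow> real).
           (\<forall>n. wave_solution M S \<Omega>m \<Omega>p cm cp T (w0 n) (w1 n) (w n) \<and>
                L2_norm M (w n 0) = 1) \<and>
           (\<forall>\<omega>. \<omega> \<in> sets lebesgue \<longrightarrow> \<omega> \<subseteq> M \<longrightarrow> setdist (closure \<omega>) S > 0 \<longrightarrow>
              (\<exists>C>0. \<exists>d>0. \<forall>n.
                 L2_norm ({0<..<T} \<times> \<omega>) (\<lambda>(t, x). w n t x)
                   \<le> C * exp (- d * typical_frequency (interior M) T (w n))))"
proof -
  let ?D = "interior M"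
  let ?c = "glue_coeff \<Omega>m \<Omega>p cm cp"
  have M: "compact M" "smooth_boundary M" and S: "S \<subseteq> ?D" "?D - S = \<Omega>m \<union> \<Omega>p" and disj: "\<Omega>m \<inter> \<Omega>p = {}"
    and o: "open \<Omega>m" "open \<Omega>p" and SI: "smooth_interface S \<Omega>m \<Omega>p \<nu>"
    and sm: "smooth_up_to_closure \<Omega>m cm" "smooth_up_to_closure \<Omega>p cp"
    and pos: "\<And>x. x \<in> closure \<Omega>m \<Longrightarrow> cm x > 0" "\<And>x. x \<in> closure \<Omega>p \<Longrightarrow> cp x > 0"
    using setting unfolding interface_setting_def by auto
  have sub: "\<Omega>m \<subseteq> ?D" "\<Omega>p \<subseteq> ?D" "\<Omega>m \<union> \<Omega>p \<subseteq> ?D" using S(2) by auto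
  have bM: "bounded M" using compact_imp_bounded[OF M(1)] .
  have bD: "bounded ?D" using bounded_subset[OF bM interior_subset] .
  have sets: "?D \<in> sets lebesgue" "\<Omega>m \<in> sets lebesgue" "\<Omega>p \<in> sets lebesgue" "M \<in> sets lebesgue"
    using o compact_imp_closed[OF M(1)] by auto
  have null: "negligible (?D - (\<Omega>m \<union> \<Omega>p))"
    by (rule negligible_subset[OF negligible_interface[OF SI]]) (use S(2) in auto)
  have Mnull: "negligible (M - ?D)"
    by (rule negligible_subset[OF negligible_frontier_smooth_boundary[OF compact_imp_closed[OF M(1)] M(2)]])
      (use closure_subset in \<open>auto simp: frontier_def\<close>)
  obtain mm Bm where mB: "mm > 0" "\<forall>x\<in>\<Omega>m. mm \<le> cm x \<and> cm x \<le> Bm"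
    using coefficient_bounds[OF sm(1) bounded_subset[OF bD sub(1)] pos(1)] by blast
  obtain mp Bp where pB: "mp > 0" "\<forall>x\<in>\<Omega>p. mp \<le> cp x \<and> cp x \<le> Bp"
    using coefficient_bounds[OF sm(2) bounded_subset[OF bD sub(2)] pos(2)] by blast
  define c0 where "c0 = min mm mp"
  define B where "B = max 0 (max Bm Bp)"
  have c0: "c0 > 0" using mB pB by (simp add: c0_def)
  have cm_b: "\<bar>cm x\<bar> \<le> B" "c0 \<le> cm x" "?c x = cm x" if "x \<in> \<Omega>m" for x
    using mB that disj by (force simp: B_def c0_def glue_coeff_def indicator_def)+
  have cp_b: "\<bar>cp x\<bar> \<le> B" "c0 \<le> cp x" "?c x = cp x" if "x \<in> \<Omega>p" for x
    using pB that disj by (force simp: B_def c0_def glue_coeff_def indicator_def)+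
  have c_b: "\<bar>?c x\<bar> \<le> B" for x
    using cm_b[of x] cp_b[of x] by (cases "x \<in> \<Omega>m"; cases "x \<in> \<Omega>p") (auto simp: glue_coeff_def B_def)
  have smo: "smooth_on \<Omega>m cm" "smooth_on \<Omega>p cp" using sm smooth_up_to_closure_smooth_on by auto
  have cmm: "cm \<in> borel_measurable (lebesgue_on \<Omega>m)" "cp \<in> borel_measurable (lebesgue_on \<Omega>p)"
    using smooth_on_measurable o smo by auto
  have c_meas: "?c \<in> borel_measurable (lebesgue_on ?D)"
    by (rule glue_coeff_measurable[OF sets(2,3) cmm])
  have c_smooth: "smooth_on (\<Omega>m \<union> \<Omega>p) ?c" by (rule smooth_on_glue_coeff[OF o disj smo])
  have c_lower: "AE x in lebesgue_on ?D. c0 \<le> ?c x"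
  proof -
    have "AE x in lebesgue. x \<notin> ?D - (\<Omega>m \<union> \<Omega>p)"
      using null by (intro AE_not_in) (simp add: negligible_iff_null_sets)
    then have "AE x in lebesgue. x \<in> ?D \<longrightarrow> c0 \<le> ?c x"
      by eventually_elim (use cm_b cp_b in auto)
    then show ?thesis by (simp add: AE_restrict_space_iff)
  qed
  have uH10: "H10 ?D (u n)" for n using u_dom[of n] by (simp add: dom_A_def)
  have uH1: "H1 ?D (u n)" for n using H10_H1[OF uH10] .
  have MD: "AE x in lebesgue. x \<notin> M - ?D"
    using Mnull by (intro AE_not_in) (simp add: negligible_iff_null_sets)
  have eqMD: "AE x in lebesgue. (if x \<in> ?D then f x else 0) = (if x \<in> M then f x else 0)" for f :: "'a \<Rightarrow> real"
    using MD by eventually_elim (use interior_subset in auto)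
  \<comment> \<open>The eigenfunctions are normalized on \<open>M\<close>, whereas the Sobolev spaces live on its interior;
    the difference is a null set.\<close>
  have uL2M: "L2 M (u n)" and uD1: "L2_norm ?D (u n) = 1" for n
  proof -
    have "(\<lambda>x. if x \<in> ?D then u n x else 0) \<in> borel_measurable lebesgue"
      using H1_L2[OF uH1[of n]] sets(1) by (intro borel_measurable_if_I) (auto simp: L2_def)
    from borel_measurable_AE[OF this eqMD] have m: "u n \<in> borel_measurable (lebesgue_on M)"
      by (rule borel_measurable_if_D)
    have "(LINT x|lebesgue_on M. (u n x)\<^sup>2) = 1" using u_norm[of n] L2_norm_sq[of M "u n"] by simp
    then have "integrable (lebesgue_on M) (\<lambda>x. (u n x)\<^sup>2)" using not_integrable_integral_eq by fastforce
    then show LM: "L2 M (u n)" using m by (simp add: L2_def)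
    have "(LINT x|lebesgue. (if x \<in> ?D then (u n x)\<^sup>2 else 0)) = (LINT x|lebesgue. (if x \<in> M then (u n x)\<^sup>2 else 0))"
      using LM H1_L2[OF uH1[of n]] sets by (intro integral_cong_AE eqMD borel_measurable_if_I) (auto simp: L2_def)
    then have "(L2_norm ?D (u n))\<^sup>2 = (L2_norm M (u n))\<^sup>2"
      unfolding L2_norm_sq using sets by (simp add: Lebesgue_Measure.integral_restrict_UNIV)
    then have "(L2_norm ?D (u n))\<^sup>2 = 1\<^sup>2" using u_norm by simp
    then show "L2_norm ?D (u n) = 1" by (rule power2_eq_imp_eq) (simp_all add: L2_norm_nonneg)
  qed
  have lam0: "0 \<le> lam n" and freq: "H1_norm ?D (u n) \<le> 1 + sqrt (lam n) / sqrt c0" for n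
    using H1_norm_eigenfunction_bound[OF open_interior uH10 u_eigen c_meas c_b c0 c_lower uD1] by auto
  define \<mu> where "\<mu> n = sqrt (lam n)" for n
  define a where "a n t = cos (\<mu> n * t)" for n t
  define a' where "a' n t = - \<mu> n * sin (\<mu> n * t)" for n t
  have \<mu>: "\<mu> n * \<mu> n = lam n" for n using lam0 by (simp add: \<mu>_def)
  have a: "(a n has_real_derivative a' n t) (at t)" for n t
    unfolding a_def[abs_def] a'_def by (auto intro!: derivative_eq_intros)
  have a': "(a' n has_real_derivative - lam n * a n t) (at t)" for n t
    unfolding a_def a'_def[abs_def] \<mu>[symmetric] by (auto intro!: derivative_eq_intros)
  have ca': "continuous_on UNIV (a' n)" for n
    by (auto intro!: continuous_at_imp_continuous_on DERIV_isCont a')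
  have a1: "\<bar>a n t\<bar> \<le> 1" for n t by (simp add: a_def)
  have a0: "a n 0 = 1" "a' n 0 = 0" for n by (simp_all add: a_def a'_def)
  define w where "w n t x = a n t * u n x" for n t x
  have w: "w n = (\<lambda>t x. a n t * u n x)" for n by (simp add: w_def fun_eq_iff)
  have w0: "w n 0 = u n" for n by (simp add: w_def a0 fun_eq_iff)
  have Lam: "typical_frequency ?D T (w n) = H1_norm ?D (u n)" for n
    unfolding w by (rule typical_frequency_product[OF open_interior uH1 uD1 a a0 T_pos])
  have sol: "wave_solution M S \<Omega>m \<Omega>p cm cp T (u n) (\<lambda>x. 0) (w n)" for n
    unfolding wave_solution_def
  proof (intro conjI ballI)
    show "H10 ?D (u n)" by (rule uH10)
    show "L2 ?D (\<lambda>x. 0)" by (rule L2_zero)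
    show "finite_energy ?D T (w n)"
      unfolding w by (rule finite_energy_product[OF open_interior uH10 a ca' a1 T_pos])
    show "wave_eq (\<Omega>m \<union> \<Omega>p) ?c T (w n)"
      unfolding w by (rule wave_eq_product[OF open_interior bD open_Un[OF o] sub(3) uH1 c_smooth u_eigen a a' T_pos])
    show "\<exists>g. has_trace \<Omega>m S (w n t) g \<and> has_trace \<Omega>p S (w n t) g" for t
    proof -
      have "H10 ?D (w n t)" unfolding w by (rule H10_cmult[OF open_interior uH10])
      moreover have "\<exists>U e \<gamma>. open U \<and> x \<in> U \<and> e \<in> Basis \<and> smooth_on UNIV \<gamma> \<and> S \<inter> U = {y\<in>U. height e \<gamma> y = 0}"
        if "x \<in> S" for x
        using SI[unfolded smooth_interface_def, THEN bspec, OF that] by (elim exE conjE) (intro exI conjI, assumption+)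
      ultimately have "\<exists>g. \<forall>\<Omega>. open \<Omega> \<longrightarrow> \<Omega> \<subseteq> ?D \<longrightarrow> has_trace \<Omega> S (w n t) g"
        by (intro H10_trace_exists open_interior)
      then obtain g where "\<forall>\<Omega>. open \<Omega> \<longrightarrow> \<Omega> \<subseteq> ?D \<longrightarrow> has_trace \<Omega> S (w n t) g" ..
      then show ?thesis using o sub(1,2) by (intro exI[of _ g] conjI) simp_all
    qed
    show "flux_transmission M \<Omega>m \<Omega>p cm cp T (w n)"
      unfolding w
      by (rule flux_transmission_product[where B = B and c = ?c and lam = "lam n" and a = "a n" and a' = "a' n"];
          (rule bD o sub(1,2) disj null uH1 cmm c_meas u_eigen a a' T_pos | (rule cm_b cp_b, assumption)))
    show "AE x in lebesgue_on ?D. w n 0 x = u n x" by (simp add: w0)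
    have "AE x in lebesgue_on ?D. time_deriv ?D T (\<lambda>t x. a n t * u n x) 0 x = a' n 0 * u n x"
      by (rule time_deriv_product(2)[where a = "a n" and a' = "a' n", OF H1_L2[OF uH1] a T_pos]) (use T_pos in simp)
    then show "AE x in lebesgue_on ?D. time_deriv ?D T (w n) 0 x = 0"
      unfolding w a0 by simp
  qed
  have decay: "\<exists>C>0. \<exists>d>0. \<forall>n. L2_norm ({0<..<T} \<times> \<omega>) (\<lambda>(t, x). w n t x) \<le> C * exp (- d * typical_frequency ?D T (w n))"
    if \<omega>: "\<omega> \<in> sets lebesgue" "\<omega> \<subseteq> M" "setdist (closure \<omega>) S > 0" for \<omega>
  proof -
    obtain C d where C: "C > 0" "d > 0" "\<forall>n. L2_norm \<omega> (u n) \<le> C * exp (- d * sqrt (lam n))"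
      using u_decay[OF \<omega>] by blast
    have "L2_norm ({0<..<T} \<times> \<omega>) (\<lambda>(t, x). w n t x) \<le> (sqrt T * C * exp (d * sqrt c0)) * exp (- (d * sqrt c0) * typical_frequency ?D T (w n))" for n
    proof -
      have "L2_norm ({0<..<T} \<times> \<omega>) (\<lambda>(t, x). w n t x) \<le> sqrt T * L2_norm \<omega> (u n)"
        unfolding w_def
        by (rule L2_time_product(2)[OF _ a1 T_pos \<omega>(1) L2_subset[OF \<omega>(2,1) sets(4) uL2M]])
          (intro borel_measurable_continuous_onI continuous_at_imp_continuous_on ballI DERIV_isCont[OF a])
      also have "\<dots> \<le> sqrt T * (C * exp (- d * sqrt (lam n)))"
        using C(3) T_pos by (intro mult_left_mono) auto
      also have "\<dots> \<le> sqrt T * (C * exp (d * sqrt c0 - d * sqrt c0 * H1_norm ?D (u n)))"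
      proof -
        \<comment> \<open>The summand 1 in the frequency bound costs the constant factor \<open>exp (d * sqrt c0)\<close>.\<close>
        have "sqrt c0 * H1_norm ?D (u n) \<le> sqrt c0 * (1 + sqrt (lam n) / sqrt c0)"
          using freq[of n] c0 by (intro mult_left_mono) auto
        also have "\<dots> = sqrt c0 + sqrt (lam n)" using c0 by (simp add: field_simps)
        finally have "d * (sqrt c0 * H1_norm ?D (u n)) \<le> d * (sqrt c0 + sqrt (lam n))"
          using C(2) by (intro mult_left_mono) auto
        then have "- d * sqrt (lam n) \<le> d * sqrt c0 - d * sqrt c0 * H1_norm ?D (u n)"
          by (simp add: algebra_simps)
        then show ?thesis using C(1) T_pos by (intro mult_left_mono) auto
      qed
      also have "\<dots> = (sqrt T * C * exp (d * sqrt c0)) * exp (- (d * sqrt c0) * H1_norm ?D (u n))"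
        by (simp add: exp_add[symmetric] mult.assoc)
      finally show ?thesis unfolding Lam .
    qed
    then show ?thesis
      using C T_pos c0 by (intro exI[of _ "sqrt T * C * exp (d * sqrt c0)"] exI[of _ "d * sqrt c0"] conjI allI) simp_all
  qed
  show ?thesis
    using sol decay u_norm by (intro exI[of _ w] exI[of _ u] exI[of _ "\<lambda>n x. 0"]) (simp add: w0)
qed

end
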